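(* Let $A\in\mathscr R$ be a fixed set. Let $\mathbf X^{(1)},\mathbf X^{(2)},\dots$ be i.i.d. copies of a non-negative random vector $\mathbf X$ in $\mathbb R^d_+$ with distribution $F$, let $0=\tau_0\le\tau_1\le\tau_2\le\cdots$ be the claim arrival times with inter-arrival times $\theta_i=\tau_i-\tau_{i-1}$ and finite renewal function $\lambda(t)=\sum_{i\ge1}\mathbf P(\tau_i\le t)$, let $\{R(t),t\ge0\}$ be a Lévy process starting from zero with Laplace exponent $\phi(s)=\log\mathbf E[e^{-sR(1)}]$, and let $\mathbf D(\infty)=\sum_{i=1}^\infty \mathbf X^{(i)}e^{-R(\tau_i)}$. Suppose that: (1) $\{\theta_i,\ i\in\mathbb N\}$ are i.i.d. non-negative random variables, independent of all the other sources of randomness. (2) The pairs $(\mathbf X^{(i)},e^{R(\tau_{i-1})-R(\tau_i)})$, $i\in\mathbb N$, are i.i.d. copies of $(\mathbf X,e^{-R(\theta_1)})$. With $Q$ the distribution of $e^{-R(\theta_1)}$ and $S(Q)$ its support, there is a function $h:[0,\infty)\to(0,\infty)$ with $0<\inf_{y\in E}h(y)\le\sup_{y\in E}h(y)<\infty$ for a left neighborhood $E$ of the upper bound of $S(Q)$, such that $$\mathbf P\big(\mathbf X\in xA\mid e^{-R(s_1)}=y,\ \theta_1=s_1\big)\sim h(y)\,\mathbf P(\mathbf X\in xA),\qquad x\to\infty,$$ uniformly for $y\in S(Q)$ and $s_1\in\Lambda:=\{t:\lambda(t)>0\}$. (3) $F\in MRV(\alpha,\mu)$ with $\alpha\in(0,\infty)$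 and auxiliary distribution $G\in\mathcal R_{-\alpha}$. (4) $\phi(p)<0$ for some $p>J^+_{F_A}$ (here $J^+_{F_A}=\alpha$). Then, as $x\to\infty$, $$\mathbf P\big[\mathbf D(\infty)\in xA\big]\sim\mu(A)\,\overline G(x)\,\mathbf E\Big[e^{-\alpha R(\theta_1)}h\big(e^{-R(\theta_1)}\big)\Big]\left(1+\int_\Lambda\int_0^\infty\mathbf E\big[e^{-\alpha R(s)}\big]\,\lambda(ds)\,\mathbf P(\theta_1\in du)\right).$$
   Context: Fix $d\in\mathbb N$, $\mathbb R^d_+=[0,\infty)^d$. A set $B\subset\mathbb R^d$ is increasing if $\mathbf x+\mathbf y\in B$ for all $\mathbf x\in B$, $\mathbf y\in\mathbb R^d_+$. Let $$\mathscr R=\{A\subsetneq\mathbb R^d: A \text{ open, increasing, } A^c \text{ convex, } \mathbf 0\notin\overline A\}.$$ For $\mathbf X$ with distribution $F$ on $\mathbb R^d_+$ and $A\in\mathscr R$, $F_A$ denotes the one-dimensional distribution of $\sup\{u:\mathbf X\in uA\}$; its tail is $\overline F_A(x)=\mathbf P(\mathbf X\in xA)$ for $x>0$. For a one-dimensional distribution $G$ with tail $\overline G=1-G$, the upper Matuszewska index is $J_G^+=-\lim_{v\to\infty}\frac{\ln\overline G_*(v)}{\ln v}$, where $\overline G_*(v)=\liminf_{x\to\infty}\overline G(vx)/\overline G(x)$. $G\in\mathcal R_{-\alpha}$ means $\lim_{x\to\infty}\overline G(tx)/\overline G(x)=t^{-\alpha}$ for all $t>0$. $F\in MRV(\alpha,\mu)$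 with auxiliary distribution $G\in\mathcal R_{-\alpha}$ means that $\mu$ is a non-degenerate to zero Radon measure on $[0,\infty]^d\setminus\{\mathbf 0\}$ and $\lim_{x\to\infty}\mathbf P(\mathbf X\in x\mathbb B)/\overline G(x)=\mu(\mathbb B)$ for every $\mu$-continuous Borel set $\mathbb B\subsetneq[0,\infty]^d\setminus\{\mathbf 0\}$ bounded away from $\mathbf 0$. $f(x)\sim g(x)$ means $f(x)/g(x)\to1$ as $x\to\infty$. Uniformity in (2) means $$\lim_{x\to\infty}\sup_{s_1\in\Lambda}\sup_{y\in S(Q)}\left|\frac{\mathbf P(\mathbf X\in xA\mid e^{-R(s_1)}=y,\theta_1=s_1)}{h(y)\mathbf P(\mathbf X\in xA)}-1\right|=0.$$ The conditional probability in (2) is understood as the limit, as $\varepsilon_1,\varepsilon_2\to0$, of $\mathbf P(\mathbf X\in xA\mid e^{-R(s_1)}\in[y-\varepsilon_1,y+\varepsilon_1],\theta_1\in[s_1-\varepsilon_2,s_1+\varepsilon_2])$; where the conditioning event has no mass in an open set around $y$ (or $s_1\notin\Lambda$), it is understood as the unconditional probability, with $h(y)=1$.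
   Formalization: The hypothesis μ(A)>0 is added; without it the right-hand side is identically 0 and the claim fails, e.g. for independent X₁, X₂ with tails x^{-α} and x^{-α}/log x and A={x₂>1}. *)

theory Defs
  imports "HOL-Probability.Probability" "HOL-Library.Landau_Symbols"
begin

section \<open>One-dimensional distributions\<close>

definition tail :: "real measure \<Rightarrow> real \<Rightarrow> real" where
  "tail G x = 1 - cdf G x"

definition regularly_varying :: "real \<Rightarrow> real measure \<Rightarrow> bool" where
  "regularly_varying \<alpha> G \<longleftrightarrow> real_distribution G \<and>
     (\<forall>t>0. ((\<lambda>x. tail G (t * x) / tail G x) \<longlongrightarrow> t powr (- \<alpha>)) at_top)"

text \<open>Logarithm with values in the extended reals: \<open>ln 0 = -\<infinity>\<close> and \<open>ln \<infinity> = \<infinity>\<close>.\<close>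

definition eln :: "ereal \<Rightarrow> ereal" where
  "eln x = (if x \<le> 0 then - \<infinity> else if x = \<infinity> then \<infinity> else ereal (ln (real_of_ereal x)))"

definition lower_tail_ratio :: "real measure \<Rightarrow> real \<Rightarrow> ereal" where
  "lower_tail_ratio G v = Liminf at_top (\<lambda>x. ereal (tail G (v * x) / tail G x))"

definition upper_matuszewska :: "real measure \<Rightarrow> ereal" where
  "upper_matuszewska G = - Lim at_top (\<lambda>v. eln (lower_tail_ratio G v) / ereal (ln v))"

definition support :: "real measure \<Rightarrow> real set" where
  "support Q = {y. \<forall>U. open U \<longrightarrow> y \<in> U \<longrightarrow> measure Q U > 0}"

text \<open>The point \<open>u\<close> itself may or may not belong to a left neighbourhood of \<open>u\<close>, and \<open>u = \<infinity>\<close>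
  is allowed.\<close>

definition left_neighbourhood :: "real set \<Rightarrow> ereal \<Rightarrow> bool" where
  "left_neighbourhood E u \<longleftrightarrow> E \<subseteq> {y. 0 \<le> y \<and> ereal y \<le> u} \<and>
     (\<exists>c<u. {y. 0 \<le> y \<and> c < ereal y \<and> ereal y < u} \<subseteq> E)"


section \<open>Increasing sets and multivariate regular variation\<close>

definition increasing_set :: "(real ^ 'd) set \<Rightarrow> bool" where
  "increasing_set B \<longleftrightarrow> (\<forall>x\<in>B. \<forall>y. (\<forall>j. 0 \<le> y $ j) \<longrightarrow> x + y \<in> B)"

definition rare_sets :: "(real ^ 'd) set set" where
  "rare_sets = {A. A \<noteq> UNIV \<and> open A \<and> increasing_set A \<and> convex (- A) \<and> 0 \<notin> closure A}"

abbreviation dilate :: "real \<Rightarrow> (real ^ 'd) set \<Rightarrow> (real ^ 'd) set" where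
  "dilate u A \<equiv> (*\<^sub>R) u ` A"

text \<open>\<open>sup {u. v \<in> u A}\<close> for \<open>v\<close> in the nonnegative orthant; the supremum is taken in
  \<open>[0,\<infinity>)\<close>, so the supremum of the empty set is \<open>0\<close>.\<close>

definition gauge_sup :: "(real ^ 'd) set \<Rightarrow> real ^ 'd \<Rightarrow> real" where
  "gauge_sup A v = Sup (insert 0 {u. 0 < u \<and> v \<in> dilate u A})"

definition dist_along :: "(real ^ 'd) set \<Rightarrow> (real ^ 'd) measure \<Rightarrow> real measure" where
  "dist_along A F = distr F borel (gauge_sup A)"

text \<open>The compactified orthant \<open>[0,\<infinity>]\<^sup>d\<close> is the type \<^typ>\<open>ennreal ^ 'd\<close>.\<close>

definition orthant_embed :: "real ^ 'd \<Rightarrow> ennreal ^ 'd" where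
  "orthant_embed v = (\<chi> j. ennreal (v $ j))"

definition edilate :: "real \<Rightarrow> (ennreal ^ 'd) set \<Rightarrow> (ennreal ^ 'd) set" where
  "edilate u B = (\<lambda>b. \<chi> j. ennreal u * b $ j) ` B"

text \<open>On the locally compact, second countable space \<open>[0,\<infinity>]\<^sup>d - {0}\<close> a Borel measure that is
  finite on compact sets is automatically regular.\<close>

definition radon_punctured :: "(ennreal ^ 'd) measure \<Rightarrow> bool" where
  "radon_punctured \<mu> \<longleftrightarrow> sets \<mu> = sets (restrict_space borel (- {0})) \<and>
     (\<forall>K. compact K \<and> K \<subseteq> - {0} \<longrightarrow> emeasure \<mu> K < \<infinity>)"

definition MRV :: "real \<Rightarrow> (ennreal ^ 'd) measure \<Rightarrow> real measure \<Rightarrow> (real ^ 'd) measure \<Rightarrow> bool" where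
  "MRV \<alpha> \<mu> G F \<longleftrightarrow>
     regularly_varying \<alpha> G \<and> radon_punctured \<mu> \<and> emeasure \<mu> (space \<mu>) \<noteq> 0 \<and>
     (\<forall>B. B \<in> sets borel \<and> B \<subset> - {0} \<and> 0 \<notin> closure B \<and> emeasure \<mu> (frontier B) = 0 \<longrightarrow>
        ((\<lambda>x. measure F {v. orthant_embed v \<in> edilate x B} / tail G x) \<longlongrightarrow> measure \<mu> B) at_top)"

text \<open>The mass that a measure on \<open>[0,\<infinity>]\<^sup>d - {0}\<close> gives to a subset of \<open>\<real>\<^sup>d\<close>.\<close>

definition orthant_mass :: "(ennreal ^ 'd) measure \<Rightarrow> (real ^ 'd) set \<Rightarrow> real" where
  "orthant_mass \<mu> A = measure \<mu> (orthant_embed ` {v \<in> A. \<forall>j. 0 \<le> v $ j})"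


section \<open>Levy processes and renewal functions\<close>

definition cadlag :: "(real \<Rightarrow> real) \<Rightarrow> bool" where
  "cadlag f \<longleftrightarrow> (\<forall>t\<ge>0. (f \<longlongrightarrow> f t) (at_right t)) \<and> (\<forall>t>0. \<exists>l. (f \<longlongrightarrow> l) (at_left t))"

definition levy_process :: "'a measure \<Rightarrow> (real \<Rightarrow> 'a \<Rightarrow> real) \<Rightarrow> bool" where
  "levy_process M R \<longleftrightarrow>
     (\<forall>t\<ge>0. R t \<in> borel_measurable M) \<and>
     (AE \<omega> in M. R 0 \<omega> = 0) \<and>
     (\<forall>n (t :: nat \<Rightarrow> real). 0 \<le> t 0 \<and> mono t \<longrightarrow>
        prob_space.indep_vars M (\<lambda>_. borel) (\<lambda>i \<omega>. R (t (Suc i)) \<omega> - R (t i) \<omega>) {..<n}) \<and>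
     (\<forall>s\<ge>0. \<forall>t\<ge>0. distr M borel (\<lambda>\<omega>. R (s + t) \<omega> - R s \<omega>) = distr M borel (R t)) \<and>
     (\<forall>t\<ge>0. \<forall>e>0. ((\<lambda>s. \<P>(\<omega> in M. \<bar>R s \<omega> - R t \<omega>\<bar> > e)) \<longlongrightarrow> 0) (at t within {0..})) \<and>
     (AE \<omega> in M. cadlag (\<lambda>t. R t \<omega>))"

definition laplace_exponent :: "'a measure \<Rightarrow> (real \<Rightarrow> 'a \<Rightarrow> real) \<Rightarrow> real \<Rightarrow> ereal" where
  "laplace_exponent M R s = eln (enn2ereal (\<integral>\<^sup>+\<omega>. ennreal (exp (- s * R 1 \<omega>)) \<partial>M))"

definition renewal_function :: "'a measure \<Rightarrow> (nat \<Rightarrow> 'a \<Rightarrow> real) \<Rightarrow> real \<Rightarrow> real" where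
  "renewal_function M \<tau> t = (\<Sum>i. \<P>(\<omega> in M. \<tau> (Suc i) \<omega> \<le> t))"


section \<open>Conditioning on the values of two random variables\<close>

definition charged :: "'a measure \<Rightarrow> ('a \<Rightarrow> real) \<Rightarrow> ('a \<Rightarrow> real) \<Rightarrow> real \<Rightarrow> real \<Rightarrow> bool" where
  "charged M U V y s \<longleftrightarrow>
     (\<forall>a>0. \<forall>b>0. \<P>(\<omega> in M. U \<omega> \<in> {y - a..y + a} \<and> V \<omega> \<in> {s - b..s + b}) > 0)"

definition has_cond_prob ::
  "'a measure \<Rightarrow> ('a \<Rightarrow> bool) \<Rightarrow> ('a \<Rightarrow> real) \<Rightarrow> ('a \<Rightarrow> real) \<Rightarrow> real \<Rightarrow> real \<Rightarrow> real \<Rightarrow> bool" where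
  "has_cond_prob M P U V y s c \<longleftrightarrow>
     ((\<lambda>(a, b). \<P>(\<omega> in M. P \<omega> \<bar> U \<omega> \<in> {y - a..y + a} \<and> V \<omega> \<in> {s - b..s + b})) \<longlongrightarrow> c)
       (at_right 0 \<times>\<^sub>F at_right 0)"

definition point_cond_prob ::
  "'a measure \<Rightarrow> ('a \<Rightarrow> bool) \<Rightarrow> ('a \<Rightarrow> real) \<Rightarrow> ('a \<Rightarrow> real) \<Rightarrow> real \<Rightarrow> real \<Rightarrow> real" where
  "point_cond_prob M P U V y s =
     (if charged M U V y s then THE c. has_cond_prob M P U V y s c else \<P>(\<omega> in M. P \<omega>))"

text \<open>\<open>P(X \<in> x A | e\<^bsup>-R(s)\<^esup> = y, \<theta> = s) \<sim> h(y) P(X \<in> x A)\<close> uniformly over \<open>s \<in> \<Lambda>\<close> and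
  \<open>y \<in> S\<close>, including the existence of the limits that define the left-hand side. Where the
  conditioning event carries no mass, both the conditional probability and \<open>h(y)\<close> are replaced by
  their unconditional values \<open>P(X \<in> x A)\<close> and \<open>1\<close>; such points impose no condition on \<open>h\<close>.\<close>

definition uniform_conditional_tail ::
  "'a measure \<Rightarrow> ('a \<Rightarrow> real ^ 'd) \<Rightarrow> (real \<Rightarrow> 'a \<Rightarrow> real) \<Rightarrow> ('a \<Rightarrow> real) \<Rightarrow> (real ^ 'd) set \<Rightarrow>
   (real \<Rightarrow> real) \<Rightarrow> real set \<Rightarrow> real set \<Rightarrow> bool" where
  "uniform_conditional_tail M X R \<theta> A h \<Lambda> S \<longleftrightarrow>
     (\<forall>\<^sub>F x in at_top. \<forall>s\<in>\<Lambda>. \<forall>y\<in>S. charged M (\<lambda>\<omega>. exp (- R s \<omega>)) \<theta> y s \<longrightarrow>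
        (\<exists>c. has_cond_prob M (\<lambda>\<omega>. X \<omega> \<in> dilate x A) (\<lambda>\<omega>. exp (- R s \<omega>)) \<theta> y s c)) \<and>
     ((\<lambda>x. SUP s\<in>\<Lambda>. SUP y\<in>S.
         ereal \<bar>point_cond_prob M (\<lambda>\<omega>. X \<omega> \<in> dilate x A) (\<lambda>\<omega>. exp (- R s \<omega>)) \<theta> y s /
                 ((if charged M (\<lambda>\<omega>. exp (- R s \<omega>)) \<theta> y s then h y else 1) *
                   \<P>(\<omega> in M. X \<omega> \<in> dilate x A)) - 1\<bar>) \<longlongrightarrow> 0) at_top"

end

(*  For a rare set A with gauge g v = sup {u. v : u A}, the event D : x A is g(D) > x, and g is monotone
    and sublinear. With W_n the product of the first n discount factors Y_k and
    Z_n = g(X_(n+1)) Y_n W_n, this sandwiches g(D) between sup Z_n and sum Z_n, so the problem becomes a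
    one-dimensional perpetuity: by Bonferroni's inequality and the single big jump principle both
    bounds have tail ~ P(g(X) Y > x) * sum_n (E Y^alpha)^n. Potter bounds provide all the
    dominating functions.

    P(g(X) Y > x) is evaluated by a Breiman argument for dependent factors. It needs
    P(g(X) > t, Y : B) ~ P(g(X) > t) E(h(Y); Y : B) uniformly in B, which is the hypothesis on the
    pointwise conditional probabilities once these are recognised, by a covering argument for
    symmetric intervals, as a Radon-Nikodym density. MRV gives P(g(X) > x) ~ mu(A) tail G x: by scaling,
    mu charges neither the boundary of A nor the points at infinity. *)

theory Submission
  imports Defs
begin

text \<open>A claim may depend on the discount factor of its own inter-arrival period, but not on
  the earlier ones. So the dependence is confined to one variable, the gauge of a claim times its
  own factor. It is met once, in the Breiman argument; in the perpetuity that follows, the n-th term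
  is such a variable times an independent product of n earlier factors.

  The obstacle is the form of hypothesis (2): limits of conditional probabilities over boxes
  shrinking to a point (y, s), known only for \<open>y\<close> in the support of \<open>Q\<close>.
  The time \<open>\<theta> 1\<close> is independent of \<open>X\<close> and of the path of
  \<open>R\<close>, so its window cancels and what remains, for each fixed time s, is a symmetric
  derivative of one finite measure on the line with respect to another. The bounds obtained for
  almost every s are then integrated over the law of \<open>\<theta> 1\<close>, and this requires a
  path functional that is measurable jointly in time and path.

  The constant is a geometric series. With \<rho> = E exp(-\<alpha> R(\<theta>_1)), the renewal
  integral is the sum of \<rho>^i over i >= 1, and the leading 1 in the theorem is the term i = 0.
  That \<rho> < 1 follows from E exp(-p R(\<theta>_1)) < 1 by concavity of powers.\<close>

section \<open>Symmetric derivatives of measures on the line\<close>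

text \<open>In a subfamily of least cardinality with the same union, no three intervals share a
  point: the one reaching furthest left and the one reaching furthest right already cover the third,
  which could be dropped. The bound 2 does not depend on \<open>F\<close>; this is the
  one-dimensional case of a Besicovitch covering.\<close>

lemma interval_subcover_multiplicity_two:
  fixes l u :: "'i \<Rightarrow> real"
  assumes "finite F"
  obtains F' where "F' \<subseteq> F" "(\<Union>i\<in>F'. {l i..u i}) = (\<Union>i\<in>F. {l i..u i})"
    "\<And>x. card {i\<in>F'. x \<in> {l i..u i}} \<le> 2"
proof -
  define good where "good F' \<longleftrightarrow> F' \<subseteq> F \<and> (\<Union>i\<in>F'. {l i..u i}) = (\<Union>i\<in>F. {l i..u i})" for F'
  obtain F' where F': "good F'" and min: "\<And>F''. good F'' \<Longrightarrow> card F' \<le> card F''"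
    using ex_has_least_nat[of good F card] by (auto simp: good_def)
  have fin: "finite F'" using F' assms by (auto simp: good_def intro: finite_subset)
  have "card {i\<in>F'. x \<in> {l i..u i}} \<le> 2" for x
  proof (rule ccontr)
    define J where "J = {i\<in>F'. x \<in> {l i..u i}}"
    assume "\<not> card {i\<in>F'. x \<in> {l i..u i}} \<le> 2"
    then have c: "card J > 2" by (simp add: J_def)
    have finJ: "finite J" using fin by (simp add: J_def)
    have ne: "J \<noteq> {}" using c by auto
    obtain i1 where i1: "i1 \<in> J" "\<And>k. k \<in> J \<Longrightarrow> l i1 \<le> l k"
      using Min_in[of "l ` J"] Min_le[of "l ` J"] finJ ne by fastforce
    obtain i2 where i2: "i2 \<in> J" "\<And>k. k \<in> J \<Longrightarrow> u k \<le> u i2"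
      using Max_in[of "u ` J"] Max_ge[of "u ` J"] finJ ne by fastforce
    have "card {i1,i2} \<le> 2" by (simp add: card_insert_if)
    then have "\<not> J \<subseteq> {i1,i2}" using c card_mono[of "{i1,i2}" J] by auto
    then obtain k where k: "k \<in> J" "k \<noteq> i1" "k \<noteq> i2" by auto
    have "{l k..u k} \<subseteq> {l i1..u i1} \<union> {l i2..u i2}"
      using i1 i2 k by (fastforce simp: J_def)
    moreover have "i1 \<in> F' - {k}" "i2 \<in> F' - {k}" using i1(1) i2(1) k by (auto simp: J_def)
    ultimately have "{l k..u k} \<subseteq> (\<Union>i\<in>F' - {k}. {l i..u i})" by blast
    then have "(\<Union>i\<in>F'. {l i..u i}) = (\<Union>i\<in>F' - {k}. {l i..u i})" by blast
    then have "good (F' - {k})" using F' by (auto simp: good_def)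
    moreover have "card (F' - {k}) < card F'"
      using k fin by (intro psubset_card_mono) (auto simp: J_def)
    ultimately show False using min by fastforce
  qed
  then show ?thesis using that F' by (auto simp: good_def)
qed

text \<open>\<open>N1\<close> and \<open>N2\<close> are the positive and negative parts of the
  signed measure with density \<open>\<phi>\<close>. Small symmetric intervals about points of
  \<open>P\<close> have no more mass under \<open>N1\<close> than under \<open>N2\<close>, while
  \<open>N2\<close> vanishes on \<open>P\<close>. Covering a compact \<open>K\<close> inside
  \<open>P\<close> by such intervals within an open \<open>U\<close> costs only the factor 2, and
  regularity (\<open>K\<close> from inside, \<open>U\<close> from outside) gives \<open>N1\<close>
  no mass on \<open>P\<close>, where its density is positive.\<close>

lemma signed_density_null:
  fixes Q :: "real measure" and \<phi> :: "real \<Rightarrow> real"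
  assumes fin: "finite_measure Q" and sQ: "sets Q = sets borel" and int: "integrable Q \<phi>"
    and P: "P \<in> sets borel" and pos: "\<And>y. y \<in> P \<Longrightarrow> \<phi> y > 0"
    and small: "\<And>y. y \<in> P \<Longrightarrow> \<exists>r>0. \<forall>a. 0 < a \<and> a < r \<longrightarrow> (LINT x:{y - a..y + a}|Q. \<phi> x) \<le> 0"
  shows "emeasure Q P = 0"
proof -
  define N1 where "N1 = density Q (\<lambda>x. ennreal (\<phi> x))"
  define N2 where "N2 = density Q (\<lambda>x. ennreal (- \<phi> x))"
  have [measurable_cong]: "sets Q = sets borel" by fact
  have [measurable]: "\<phi> \<in> borel_measurable borel" using int sQ by (simp add: borel_measurable_integrable cong: measurable_cong_sets)
  have m[measurable]: "P \<in> sets borel" by fact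
  have sp: "space Q = UNIV" using sets_eq_imp_space_eq[OF sQ] by simp
  have s1: "sets N1 = sets borel" and s2: "sets N2 = sets borel" by (simp_all add: N1_def N2_def sQ)
  have f1: "emeasure N1 (space N1) \<noteq> \<infinity>"
    using real_integrable_def[of Q \<phi>] int by (simp add: N1_def emeasure_density sp)
  have f2: "emeasure N2 (space N2) \<noteq> \<infinity>"
    using real_integrable_def[of Q \<phi>] int by (simp add: N2_def emeasure_density sp)
  have N2P: "emeasure N2 P = 0"
  proof -
    have "emeasure N2 P = (\<integral>\<^sup>+x. ennreal (- \<phi> x) * indicator P x \<partial>Q)"
      by (simp add: N2_def emeasure_density)
    also have "\<dots> = (\<integral>\<^sup>+x. 0 \<partial>Q)"
      using pos by (intro nn_integral_cong) (fastforce simp: indicator_def ennreal_neg less_imp_le)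
    finally show ?thesis by simp
  qed
  have int_le: "emeasure N1 {y - a..y + a} \<le> emeasure N2 {y - a..y + a}"
    if "(LINT x:{y - a..y + a}|Q. \<phi> x) \<le> 0" for y a
  proof -
    let ?I = "{y - a..y + a}"
    have i: "integrable Q (\<lambda>x. indicator ?I x * \<phi> x)"
      using integrable_mult_indicator[of ?I Q \<phi>] int by (simp add: sQ)
    have e1: "(\<integral>\<^sup>+x. ennreal (indicator ?I x * \<phi> x) \<partial>Q) = emeasure N1 ?I"
      by (simp add: N1_def emeasure_density) (auto intro!: nn_integral_cong simp: indicator_def)
    have e2: "(\<integral>\<^sup>+x. ennreal (- (indicator ?I x * \<phi> x)) \<partial>Q) = emeasure N2 ?I"
      by (simp add: N2_def emeasure_density) (auto intro!: nn_integral_cong simp: indicator_def)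
    have fi: "emeasure N1 ?I \<noteq> \<infinity>" "emeasure N2 ?I \<noteq> \<infinity>"
      using i e1 e2 by (auto simp: real_integrable_def)
    have "enn2real (emeasure N1 ?I) - enn2real (emeasure N2 ?I) \<le> 0"
      using that real_lebesgue_integral_def[OF i] e1 e2 by (simp add: set_lebesgue_integral_def)
    then show ?thesis using fi
      by (metis diff_le_0_iff_le enn2real_positive_iff ennreal_enn2real ennreal_leI infinity_ennreal_def less_top)
  qed
  have K0: "emeasure N1 K \<le> 2 * emeasure N2 U" if K: "compact K" "K \<subseteq> P" and U: "P \<subseteq> U" "open U" for K U
  proof -
    have "\<exists>a>0. {y - a..y + a} \<subseteq> U \<and> emeasure N1 {y - a..y + a} \<le> emeasure N2 {y - a..y + a}"
      if "y \<in> K" for y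
    proof -
      have yP: "y \<in> P" using that K by auto
      obtain r where r: "r > 0" "\<And>a. 0 < a \<and> a < r \<longrightarrow> (LINT x:{y - a..y + a}|Q. \<phi> x) \<le> 0"
        using small[OF yP] by auto
      obtain e where e: "e > 0" "cball y e \<subseteq> U"
        using U yP open_contains_cball by (metis subsetD)
      define a where "a = min e (r/2)"
      have "a > 0" "a < r" "a \<le> e" using e r by (auto simp: a_def)
      moreover have "{y - a..y + a} \<subseteq> cball y e"
        using \<open>a \<le> e\<close> by (auto simp: dist_real_def)
      ultimately show ?thesis using int_le r e by (intro exI[of _ a]) auto
    qed
    then obtain a where a: "\<And>y. y \<in> K \<Longrightarrow> a y > 0" "\<And>y. y \<in> K \<Longrightarrow> {y - a y..y + a y} \<subseteq> U"
      "\<And>y. y \<in> K \<Longrightarrow> emeasure N1 {y - a y..y + a y} \<le> emeasure N2 {y - a y..y + a y}"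
      by metis
    \<comment> \<open>Compactness needs the open intervals, the comparison of \<open>N1\<close> with
      \<open>N2\<close> the closed ones; passing from the former to the latter only enlarges the
      cover.\<close>
    have "K \<subseteq> (\<Union>y\<in>K. {y - a y<..<y + a y})" using a(1) by force
    then obtain F where F: "F \<subseteq> K" "finite F" "K \<subseteq> (\<Union>y\<in>F. {y - a y<..<y + a y})"
      using compactE_image[OF K(1), of K "\<lambda>y. {y - a y<..<y + a y}"] by auto
    obtain F' where F': "F' \<subseteq> F" "(\<Union>y\<in>F'. {y - a y..y + a y}) = (\<Union>y\<in>F. {y - a y..y + a y})"
      "\<And>x. card {y\<in>F'. x \<in> {y - a y..y + a y}} \<le> 2"
      by (rule interval_subcover_multiplicity_two[OF F(2), of "\<lambda>y. y - a y" "\<lambda>y. y + a y"]) blast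
    have finF': "finite F'" using F F' finite_subset by auto
    have KF: "K \<subseteq> (\<Union>y\<in>F'. {y - a y..y + a y})" using F F'(2) by fastforce
    have sum2: "(\<Sum>y\<in>F'. indicator {y - a y..y + a y} x) \<le> (2 * indicator U x :: ennreal)" for x
    proof (cases "x \<in> U")
      case True
      have "(\<Sum>y\<in>F'. indicator {y - a y..y + a y} x :: ennreal) = of_nat (card {y\<in>F'. x \<in> {y - a y..y + a y}})"
        using finF' by (simp add: indicator_def sum.If_cases Int_def conj_commute)
      also have "\<dots> \<le> of_nat 2" using F'(3)[of x] by (intro of_nat_mono)
      finally show ?thesis using True by simp
    next
      case False
      have "x \<notin> {y - a y..y + a y}" if "y \<in> F'" for y
        using a(2)[of y] False that F F' by blast
      then have "(\<Sum>y\<in>F'. indicator {y - a y..y + a y} x :: ennreal) = 0"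
        by (intro sum.neutral) (auto simp: indicator_def)
      then show ?thesis by simp
    qed
    have "emeasure N1 K \<le> emeasure N1 (\<Union>y\<in>F'. {y - a y..y + a y})"
      using KF s1 finF' by (intro emeasure_mono) auto
    also have "\<dots> \<le> (\<Sum>y\<in>F'. emeasure N1 {y - a y..y + a y})"
      by (rule emeasure_subadditive_finite[OF finF']) (simp add: s1 image_subset_iff)
    also have "\<dots> \<le> (\<Sum>y\<in>F'. emeasure N2 {y - a y..y + a y})"
      using a(3) F F' by (intro sum_mono) auto
    also have "\<dots> = (\<integral>\<^sup>+x. (\<Sum>y\<in>F'. indicator {y - a y..y + a y} x) \<partial>N2)"
      using s2 by (subst nn_integral_sum) auto
    also have "\<dots> \<le> (\<integral>\<^sup>+x. 2 * indicator U x \<partial>N2)"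
      by (intro nn_integral_mono sum2)
    also have "\<dots> = 2 * emeasure N2 U"
      using U s2 by (simp add: nn_integral_cmult_indicator)
    finally show ?thesis .
  qed
  have "emeasure N1 K = 0" if K: "compact K" "K \<subseteq> P" for K
  proof -
    have "emeasure N1 K / 2 \<le> emeasure N2 U" if "P \<subseteq> U" "open U" for U
      using K0[OF K that] by (intro divide_le_posI_ennreal) (simp_all add: mult.commute)
    then have "emeasure N1 K / 2 \<le> (INF U\<in>{U. P \<subseteq> U \<and> open U}. emeasure N2 U)"
      by (intro INF_greatest) auto
    also have "\<dots> = 0" using outer_regular[OF s2 f2 P] N2P by simp
    finally show ?thesis by (simp add: ennreal_divide_eq_0_iff)
  qed
  then have "emeasure N1 P = 0"
    unfolding inner_regular[OF s1 f1 P] by (auto intro!: antisym SUP_least)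
  then have "AE x in Q. x \<in> P \<longrightarrow> ennreal (\<phi> x) = 0"
    by (simp add: N1_def emeasure_density nn_integral_0_iff_AE) (auto simp: indicator_def)
  then have "AE x in Q. x \<notin> P"
    by eventually_elim (use pos in \<open>force simp: ennreal_eq_0_iff not_le\<close>)
  then show ?thesis using AE_iff_measurable[of P Q "\<lambda>x. x \<notin> P"] sp sQ m by auto
qed

text \<open>If the density \<open>D\<close> of \<open>N\<close> exceeded a level q >
  \<open>k2 y\<close> on a non-null set, then \<open>D - q\<close> would be positive there although
  its integrals over small symmetric intervals are not, contrary to
  \<open>signed_density_null\<close>. The limit \<open>c\<close> depends on \<open>y\<close> and
  carries no measurability, so it enters only through the Borel bounds \<open>k1\<close> and
  \<open>k2\<close>.\<close>

lemma density_bounds_of_symmetric_derivative: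
  fixes Q N :: "real measure" and k1 k2 :: "real \<Rightarrow> real"
  assumes fQ: "finite_measure Q" and fN: "finite_measure N"
    and sQ: "sets Q = sets borel" and sN: "sets N = sets borel"
    and le: "\<And>B. B \<in> sets borel \<Longrightarrow> emeasure N B \<le> emeasure Q B"
    and k[measurable]: "k1 \<in> borel_measurable borel" "k2 \<in> borel_measurable borel"
    and S: "S \<in> sets borel" "emeasure Q (- S) = 0"
    and Qpos: "\<And>y a. y \<in> S \<Longrightarrow> 0 < a \<Longrightarrow> measure Q {y - a..y + a} > 0"
    and lim: "\<And>y. y \<in> S \<Longrightarrow> \<exists>c. ((\<lambda>a. measure N {y - a..y + a} / measure Q {y - a..y + a}) \<longlongrightarrow> c) (at_right 0)
              \<and> k1 y \<le> c \<and> c \<le> k2 y"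
    and B: "B \<in> sets borel"
  shows "(\<integral>\<^sup>+y. ennreal (k1 y) * indicator B y \<partial>Q) \<le> emeasure N B"
    and "emeasure N B \<le> (\<integral>\<^sup>+y. ennreal (k2 y) * indicator B y \<partial>Q)"
proof -
  interpret Q: finite_measure Q by fact
  interpret N: finite_measure N by fact
  have [measurable_cong]: "sets Q = sets borel" by fact
  note m[measurable] = S(1) B
  have sp: "space Q = UNIV" using sets_eq_imp_space_eq[OF sQ] by simp
  have ac: "absolutely_continuous Q N"
    using le by (auto simp: absolutely_continuous_def null_sets_def sQ sN) (metis le_zero_eq)
  obtain D where D: "D \<in> borel_measurable Q" "AE x in Q. RN_deriv Q N x = ennreal (D x)" "\<And>x. 0 \<le> D x"
    using Q.real_RN_deriv[OF fN ac] sQ sN by metis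
  have [measurable]: "D \<in> borel_measurable borel" using D(1) sQ by (simp cong: measurable_cong_sets)
  have N_eq: "N = density Q (\<lambda>x. ennreal (D x))"
    using Q.density_RN_deriv[OF ac] sQ sN D(1,2) density_cong[of "RN_deriv Q N" Q "\<lambda>x. ennreal (D x)"] by simp
  have intD: "integrable Q D"
  proof (rule integrableI_nonneg)
    show "(\<integral>\<^sup>+x. ennreal (D x) \<partial>Q) < \<infinity>"
      using N.emeasure_finite[of UNIV] sp by (simp add: N_eq emeasure_density less_top)
  qed (use D in auto)
  have intI: "(LINT x:I|Q. D x) = measure N I" if [measurable]: "I \<in> sets borel" for I
  proof -
    have "measure N I = (\<integral>x. indicator I x \<partial>N)" using that by (simp add: sN N.emeasure_finite)
    also have "\<dots> = (\<integral>x. D x * indicator I x \<partial>Q)"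
      unfolding N_eq using D by (intro integral_real_density) auto
    finally show ?thesis by (simp add: set_lebesgue_integral_def mult.commute)
  qed
  have intc: "(LINT x:I|Q. D x - q) = measure N I - q * measure Q I" if [measurable]: "I \<in> sets borel" for I q
  proof -
    have "(LINT x:I|Q. D x - q) = (LINT x:I|Q. D x) - (LINT x:I|Q. q)"
      using intD integrable_mult_indicator[of I Q D] that Q.emeasure_finite[of I]
      by (intro set_integral_diff)
        (auto simp: set_integrable_def sQ less_top[symmetric] intro!: integrable_mult_left integrable_real_indicator)
    also have "(LINT x:I|Q. q) = q * measure Q I"
      using that by (subst set_integral_const) (auto simp: sQ Q.emeasure_finite)
    finally show ?thesis using intI[OF that] by simp
  qed
  have up0: "emeasure Q {y\<in>S. k2 y < q \<and> q < D y} = 0" for q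
  proof (rule signed_density_null[OF fQ sQ, where \<phi>="\<lambda>y. D y - q"])
    fix y assume y: "y \<in> {y\<in>S. k2 y < q \<and> q < D y}"
    then obtain c where c: "((\<lambda>a. measure N {y - a..y + a} / measure Q {y - a..y + a}) \<longlongrightarrow> c) (at_right 0)" "c < q"
      using lim[of y] by force
    from order_tendstoD(2)[OF c] obtain r where "r > 0"
      "\<And>a. 0 < a \<Longrightarrow> a < r \<Longrightarrow> measure N {y - a..y + a} / measure Q {y - a..y + a} < q"
      by (auto simp: eventually_at_right_field)
    then show "\<exists>r>0. \<forall>a. 0 < a \<and> a < r \<longrightarrow> (LINT x:{y - a..y + a}|Q. D x - q) \<le> 0"
      using Qpos[of y] y by (intro exI[of _ r]) (fastforce simp: intc divide_less_eq)
  qed (use intD in auto)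
  have lo0: "emeasure Q {y\<in>S. D y < q \<and> q < k1 y} = 0" for q
  proof (rule signed_density_null[OF fQ sQ, where \<phi>="\<lambda>y. q - D y"])
    fix y assume y: "y \<in> {y\<in>S. D y < q \<and> q < k1 y}"
    then obtain c where c: "((\<lambda>a. measure N {y - a..y + a} / measure Q {y - a..y + a}) \<longlongrightarrow> c) (at_right 0)" "q < c"
      using lim[of y] by force
    from order_tendstoD(1)[OF c] obtain r where r: "r > 0"
      "\<And>a. 0 < a \<Longrightarrow> a < r \<Longrightarrow> q < measure N {y - a..y + a} / measure Q {y - a..y + a}"
      by (auto simp: eventually_at_right_field)
    have "(LINT x:I|Q. q - D x) = - (LINT x:I|Q. D x - q)" for I
      by (simp add: set_lebesgue_integral_def algebra_simps flip: integral_minus)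
    then show "\<exists>r>0. \<forall>a. 0 < a \<and> a < r \<longrightarrow> (LINT x:{y - a..y + a}|Q. q - D x) \<le> 0"
      using Qpos[of y] y r by (intro exI[of _ r]) (fastforce simp: intc less_divide_eq)
  qed (use intD in auto)
  have aeS: "AE y in Q. y \<in> S"
    using S by (intro AE_I[of _ _ "- S"]) (auto simp: sQ)
  \<comment> \<open>A rational level fits strictly between \<open>k2 y\<close> and
    \<open>D y\<close> whenever they are in the wrong order, so countably many null sets
    suffice.\<close>
  have "AE y in Q. \<forall>q\<in>\<rat>. \<not> (y \<in> S \<and> k2 y < q \<and> q < D y)"
    using up0 by (intro AE_ball_countable' countable_rat) (auto intro!: AE_I[of _ _ "{y\<in>S. k2 y < _ \<and> _ < D y}"])
  then have up: "AE y in Q. D y \<le> k2 y"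
    using aeS by eventually_elim (metis Rats_dense_in_real not_le)
  have "AE y in Q. \<forall>q\<in>\<rat>. \<not> (y \<in> S \<and> D y < q \<and> q < k1 y)"
    using lo0 by (intro AE_ball_countable' countable_rat) (auto intro!: AE_I[of _ _ "{y\<in>S. D y < _ \<and> _ < k1 y}"])
  then have lo: "AE y in Q. k1 y \<le> D y"
    using aeS by eventually_elim (metis Rats_dense_in_real not_le)
  have NB: "emeasure N B = (\<integral>\<^sup>+y. ennreal (D y) * indicator B y \<partial>Q)"
    by (simp add: N_eq emeasure_density)
  show "(\<integral>\<^sup>+y. ennreal (k1 y) * indicator B y \<partial>Q) \<le> emeasure N B"
    unfolding NB using lo by (intro nn_integral_mono_AE) (auto elim!: eventually_mono intro!: mult_right_mono ennreal_leI)
  show "emeasure N B \<le> (\<integral>\<^sup>+y. ennreal (k2 y) * indicator B y \<partial>Q)"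
    unfolding NB using up by (intro nn_integral_mono_AE) (auto elim!: eventually_mono intro!: mult_right_mono ennreal_leI)
qed

section \<open>Regularly varying tails\<close>

text \<open>Stated for functions rather than distributions, so that it applies alike to the tail of
  \<open>G\<close>, to the tail of the gauge of a claim and to that of a discounted claim.\<close>

definition rv_tail :: "real \<Rightarrow> (real \<Rightarrow> real) \<Rightarrow> bool" where
  "rv_tail \<alpha> H \<longleftrightarrow> antimono H \<and> (\<forall>x. 0 \<le> H x \<and> H x \<le> 1) \<and>
     (\<forall>t>0. ((\<lambda>x. H (t * x) / H x) \<longlongrightarrow> t powr (- \<alpha>)) at_top)"

text \<open>A zero of \<open>H\<close> would persist to the right, and since x / 0 = 0 the ratio at
  t = 1 would tend to 0 instead of 1.\<close>

lemma rv_tail_pos: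
  assumes "rv_tail \<alpha> H"
  shows "H x > 0"
proof (rule ccontr)
  assume "\<not> H x > 0"
  moreover have "H y \<le> H x" "0 \<le> H y" if "y \<ge> x" for y
    using assms that by (auto simp: rv_tail_def antimono_def)
  ultimately have "H y = 0" if "y \<ge> x" for y
    using that by force
  then have "\<forall>\<^sub>F y in at_top. H (1 * y) / H y = 0"
    by (intro eventually_at_top_linorderI[of x]) simp
  then have "((\<lambda>y. H (1 * y) / H y) \<longlongrightarrow> 0) at_top" by (rule tendsto_eventually)
  moreover have "((\<lambda>y. H (1 * y) / H y) \<longlongrightarrow> 1 powr (- \<alpha>)) at_top"
    using assms unfolding rv_tail_def by (metis zero_less_one)
  ultimately show False using tendsto_unique[OF trivial_limit_at_top_linorder] by force
qed

text \<open>Beyond some point the ratio at t = 2 lies strictly between 2^(-p) and 2^(-q). Doubling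
  the argument never leaves that region, so the two bounds can be iterated.\<close>

lemma rv_tail_doubling:
  assumes H: "rv_tail \<alpha> H" and qp: "q < \<alpha>" "\<alpha> < p"
  obtains x1 where "x1 > 0" "\<And>n x. x \<ge> x1 \<Longrightarrow> (2 ^ n) powr (- p) * H x \<le> H (2 ^ n * x)"
    "\<And>n x. x \<ge> x1 \<Longrightarrow> H (2 ^ n * x) \<le> (2 ^ n) powr (- q) * H x"
proof -
  have lim: "((\<lambda>x. H (2 * x) / H x) \<longlongrightarrow> 2 powr (- \<alpha>)) at_top"
    using H by (simp add: rv_tail_def)
  have "2 powr (- p) < 2 powr (- \<alpha>)" "2 powr (- \<alpha>) < 2 powr (- q)" using qp by auto
  then have "\<forall>\<^sub>F x in at_top. 2 powr (- p) < H (2 * x) / H x \<and> H (2 * x) / H x < 2 powr (- q)"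
    using order_tendstoD[OF lim] by (intro eventually_conj) auto
  then obtain x0 where x0: "\<And>x. x \<ge> x0 \<Longrightarrow> 2 powr (- p) < H (2 * x) / H x \<and> H (2 * x) / H x < 2 powr (- q)"
    by (auto simp: eventually_at_top_linorder)
  define x1 where "x1 = max x0 1"
  have pos: "H x > 0" for x using rv_tail_pos[OF H] .
  have one: "2 powr (- p) * H x \<le> H (2 * x)" "H (2 * x) \<le> 2 powr (- q) * H x" if "x \<ge> x1" for x
    using x0[of x] that pos[of x] by (auto simp: x1_def field_simps)
  have big: "2 ^ n * x \<ge> x1" if "x \<ge> x1" for n :: nat and x
  proof -
    have "1 * x \<le> 2 ^ n * x" using that by (intro mult_right_mono) (auto simp: x1_def)
    then show ?thesis using that by simp
  qed
  have A: "(2 ^ n) powr (- p) * H x \<le> H (2 ^ n * x)" if "x \<ge> x1" for n x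
  proof (induction n)
    case (Suc n)
    have "(2 ^ Suc n) powr (- p) * H x = 2 powr (- p) * ((2 ^ n) powr (- p) * H x)"
      by (simp add: powr_mult)
    also have "\<dots> \<le> 2 powr (- p) * H (2 ^ n * x)" using Suc by (intro mult_left_mono) auto
    also have "\<dots> \<le> H (2 * (2 ^ n * x))" using one(1) big that by blast
    finally show ?case by (simp add: mult.assoc)
  qed simp
  have B: "H (2 ^ n * x) \<le> (2 ^ n) powr (- q) * H x" if "x \<ge> x1" for n x
  proof (induction n)
    case (Suc n)
    have "H (2 * (2 ^ n * x)) \<le> 2 powr (- q) * H (2 ^ n * x)" using one(2) big that by blast
    also have "\<dots> \<le> 2 powr (- q) * ((2 ^ n) powr (- q) * H x)" using Suc by (intro mult_left_mono) auto
    finally show ?case by (simp add: powr_mult mult.assoc)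
  qed simp
  show ?thesis using that[of x1] A B by (simp add: x1_def)
qed

lemma power_of_two_bracket:
  fixes z :: real
  assumes "z \<ge> 1"
  obtains n :: nat where "2 ^ n \<le> z" "z < 2 * 2 ^ n"
proof -
  have "\<exists>n::nat. z < 2 ^ n" using real_arch_pow[of 2 z] by simp
  then obtain n :: nat where n: "z < 2 ^ n" "\<And>m. m < n \<Longrightarrow> \<not> z < 2 ^ m"
    using exists_least_iff[of "\<lambda>n. z < 2 ^ n"] by auto
  then have "n \<noteq> 0" using assms by (intro notI) auto
  then obtain m where "n = Suc m" by (cases n) auto
  then show ?thesis using n that[of m] by (auto simp: not_less)
qed

text \<open>Between consecutive powers of two only monotonicity is used, which costs a factor 2 in
  the argument; hence \<open>2 * z\<close> and \<open>z / 2\<close>.\<close>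

lemma rv_tail_bounds:
  assumes H: "rv_tail \<alpha> H" and qp: "0 < q" "q < \<alpha>" "\<alpha> < p"
  obtains x1 where "x1 > 0" "\<And>x z. x \<ge> x1 \<Longrightarrow> z \<ge> 1 \<Longrightarrow> (2 * z) powr (- p) * H x \<le> H (z * x)"
    "\<And>x z. x \<ge> x1 \<Longrightarrow> z \<ge> 1 \<Longrightarrow> H (z * x) \<le> (z / 2) powr (- q) * H x"
proof -
  obtain x1 where x1: "x1 > 0" "\<And>n x. x \<ge> x1 \<Longrightarrow> (2 ^ n) powr (- p) * H x \<le> H (2 ^ n * x)"
    "\<And>n x. x \<ge> x1 \<Longrightarrow> H (2 ^ n * x) \<le> (2 ^ n) powr (- q) * H x"
    using rv_tail_doubling[OF H qp(2,3)] by metis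
  have anti: "H y \<le> H x" if "x \<le> y" for x y using H that by (auto simp: rv_tail_def antimono_def)
  have pos: "H x > 0" for x using rv_tail_pos[OF H] .
  have "(2 * z) powr (- p) * H x \<le> H (z * x) \<and> H (z * x) \<le> (z / 2) powr (- q) * H x"
    if x: "x \<ge> x1" and z: "z \<ge> 1" for x z
  proof -
    obtain n :: nat where n: "2 ^ n \<le> z" "z < 2 * 2 ^ n" using power_of_two_bracket[OF z] .
    have "(2 * z) powr (- p) * H x \<le> (2 ^ Suc n) powr (- p) * H x"
      using n qp pos[of x] z by (intro mult_right_mono powr_mono2') auto
    also have "\<dots> \<le> H (2 ^ Suc n * x)" using x1(2) x by blast
    also have "\<dots> \<le> H (z * x)" using n x x1(1) by (intro anti mult_right_mono) auto
    finally have 1: "(2 * z) powr (- p) * H x \<le> H (z * x)" .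
    have "H (z * x) \<le> H (2 ^ n * x)" using n x x1(1) by (intro anti mult_right_mono) auto
    also have "\<dots> \<le> (2 ^ n) powr (- q) * H x" using x1(3) x by blast
    also have "\<dots> \<le> (z / 2) powr (- q) * H x"
      using n qp pos[of x] z by (intro mult_right_mono powr_mono2') auto
    finally show ?thesis using 1 by simp
  qed
  then show ?thesis using that x1(1) by blast
qed

text \<open>The form of Potter's bounds that serves as a dominating function: it holds for every w >
  0, in particular for w so large that \<open>x / w\<close> leaves the asymptotic region. There
  \<open>H (x / w)\<close> is bounded by 1 and the polynomial lower bound for \<open>H x\<close>
  takes over.\<close>

lemma rv_tail_potter:
  assumes H: "rv_tail \<alpha> H" and qp: "0 < q" "q < \<alpha>" "\<alpha> < p"
  obtains C x0 where "C > 0" "x0 > 0"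
    "\<And>x w. x \<ge> x0 \<Longrightarrow> w > 0 \<Longrightarrow> H (x / w) \<le> C * H x * (w powr p + w powr q)"
proof -
  obtain x1 where x1: "x1 > 0" "\<And>x z. x \<ge> x1 \<Longrightarrow> z \<ge> 1 \<Longrightarrow> (2 * z) powr (- p) * H x \<le> H (z * x)"
    "\<And>x z. x \<ge> x1 \<Longrightarrow> z \<ge> 1 \<Longrightarrow> H (z * x) \<le> (z / 2) powr (- q) * H x"
    using rv_tail_bounds[OF H qp] by metis
  have pos: "H x > 0" for x using rv_tail_pos[OF H] .
  have le1: "H x \<le> 1" for x using H by (simp add: rv_tail_def)
  \<comment> \<open>Dictated by the case \<open>x / w < x1\<close>, where \<open>H x\<close> is
    compared with \<open>H x1\<close>. Since \<open>H x1 <= 1\<close>, the constant also dominates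
    the factors 2^p and 2^q of the other two cases.\<close>
  define C where "C = 2 powr p / H x1"
  have Cge: "2 powr p \<le> C" using pos[of x1] le1[of x1] by (simp add: C_def field_simps)
  then have C: "C > 0" by (smt (verit) powr_gt_zero)
  have "H (x / w) \<le> C * H x * (w powr p + w powr q)" if x: "x \<ge> x1" and w: "w > 0" for x w
  proof (cases "w \<le> 1")
    case True
    have "H (x / w) = H ((1 / w) * x)" by simp
    also have "\<dots> \<le> (1 / w / 2) powr (- q) * H x" using x True w by (intro x1(3)) auto
    also have "(1 / w / 2) powr (- q) = 2 powr q * w powr q"
      using w by (simp add: powr_minus powr_divide powr_mult field_simps)
    also have "2 powr q * w powr q * H x \<le> C * w powr q * H x"
      using Cge qp pos[of x] powr_mono[of q p "2::real"] by (intro mult_right_mono) (linarith, auto)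
    also have "\<dots> \<le> C * H x * (w powr p + w powr q)" using C pos[of x] by (simp add: field_simps)
    finally show ?thesis .
  next
    case False
    have "H (x / w) \<le> C * H x * w powr p"
    proof (cases "x / w \<ge> x1")
      case True
      have "(2 * w) powr (- p) * H (x / w) \<le> H (w * (x / w))" using True False by (intro x1(2)) auto
      then have "H (x / w) \<le> (2 powr p * w powr p) * H x"
        using w by (simp add: powr_minus powr_mult field_simps)
      also have "\<dots> \<le> (C * w powr p) * H x" using Cge pos[of x] by (intro mult_right_mono) auto
      finally show ?thesis by (simp add: field_simps)
    next
      case False2: False
      have xw: "x / x1 \<le> w" using False2 w x1(1) by (simp add: field_simps)
      have "(2 * w) powr (- p) * H x1 \<le> (2 * (x / x1)) powr (- p) * H x1"
        using xw qp pos[of x1] x x1(1) by (intro mult_right_mono powr_mono2') auto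
      also have "\<dots> \<le> H (x / x1 * x1)" using x x1(1) by (intro x1(2)) auto
      finally have "(2 * w) powr (- p) * H x1 \<le> H x" using x1(1) by simp
      then have "1 \<le> C * H x * w powr p"
        using w pos[of x1] by (simp add: C_def powr_minus powr_mult field_simps)
      then show ?thesis using le1[of "x / w"] by simp
    qed
    also have "\<dots> \<le> C * H x * (w powr p + w powr q)" using C pos[of x] by (simp add: field_simps)
    finally show ?thesis .
  qed
  then show ?thesis using that C x1(1) by blast
qed

lemma rv_tail_polynomial_lower:
  assumes H: "rv_tail \<alpha> H" and p: "0 < \<alpha>" "\<alpha> < p"
  obtains c x0 where "c > 0" "x0 > 0" "\<And>x. x \<ge> x0 \<Longrightarrow> c * x powr (- p) \<le> H x"
proof -
  obtain x1 where x1: "x1 > 0" "\<And>x z. x \<ge> x1 \<Longrightarrow> z \<ge> 1 \<Longrightarrow> (2 * z) powr (- p) * H x \<le> H (z * x)"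
    using rv_tail_bounds[OF H _ _ p(2), of "\<alpha> / 2"] p(1) by (metis field_sum_of_halves half_gt_zero less_add_same_cancel1)
  define c where "c = (2 / x1) powr (- p) * H x1"
  have "c * x powr (- p) \<le> H x" if "x \<ge> x1" for x
  proof -
    have "c * x powr (- p) = (2 * (x / x1)) powr (- p) * H x1"
      using x1(1) that by (simp add: c_def powr_mult powr_divide)
    also have "\<dots> \<le> H (x / x1 * x1)" using that x1(1) by (intro x1(2)) auto
    finally show ?thesis using x1(1) by simp
  qed
  moreover have "c > 0" using x1(1) rv_tail_pos[OF H, of x1] by (simp add: c_def)
  ultimately show ?thesis using that x1(1) by blast
qed

lemma rv_tail_polynomial_upper:
  assumes H: "rv_tail \<alpha> H" and q: "0 < q" "q < \<alpha>"
  obtains C x0 where "C > 0" "x0 > 0" "\<And>x. x \<ge> x0 \<Longrightarrow> H x \<le> C * x powr (- q)"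
proof -
  obtain x1 where x1: "x1 > 0" "\<And>x z. x \<ge> x1 \<Longrightarrow> z \<ge> 1 \<Longrightarrow> H (z * x) \<le> (z / 2) powr (- q) * H x"
    using rv_tail_bounds[OF H q less_add_one] by metis
  define C where "C = (1 / (2 * x1)) powr (- q) * H x1"
  have "H x \<le> C * x powr (- q)" if "x \<ge> x1" for x
  proof -
    have "H (x / x1 * x1) \<le> (x / x1 / 2) powr (- q) * H x1" using that x1(1) by (intro x1(2)) auto
    also have "\<dots> = C * x powr (- q)"
      using x1(1) that by (simp add: C_def powr_mult powr_divide mult.commute)
    finally show ?thesis using x1(1) by simp
  qed
  moreover have "C > 0" using x1(1) rv_tail_pos[OF H, of x1] by (simp add: C_def)
  ultimately show ?thesis using that x1(1) by blast
qed

lemma rv_tail_equivalent: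
  assumes lim: "((\<lambda>x. K x / H x) \<longlongrightarrow> c) at_top" and c: "c > 0"
    and H: "\<And>t. t > 0 \<Longrightarrow> ((\<lambda>x. H (t * x) / H x) \<longlongrightarrow> t powr (- \<alpha>)) at_top"
    and K: "antimono K" "\<And>x. 0 \<le> K x" "\<And>x. K x \<le> 1"
  shows "rv_tail \<alpha> K"
  unfolding rv_tail_def
proof (intro conjI allI impI K)
  fix t :: real assume t: "t > 0"
  have ft: "filterlim (\<lambda>x. t * x) at_top at_top" by (rule filterlim_tendsto_pos_mult_at_top[OF tendsto_const t filterlim_ident])
  have nz: "\<forall>\<^sub>F x in at_top. K x \<noteq> 0 \<and> H x \<noteq> 0"
    using order_tendstoD(1)[OF lim c] by eventually_elim auto
  have nzt: "\<forall>\<^sub>F x in at_top. K (t * x) \<noteq> 0 \<and> H (t * x) \<noteq> 0"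
    using nz ft by (rule eventually_compose_filterlim)
  have "((\<lambda>x. (K (t * x) / H (t * x)) * (H (t * x) / H x) / (K x / H x)) \<longlongrightarrow> c * t powr (- \<alpha>) / c) at_top"
    using c t by (intro tendsto_divide tendsto_mult H lim filterlim_compose[OF lim ft]) auto
  moreover have "\<forall>\<^sub>F x in at_top. (K (t * x) / H (t * x)) * (H (t * x) / H x) / (K x / H x) = K (t * x) / K x"
    using nz nzt by eventually_elim (simp add: field_simps)
  ultimately have "((\<lambda>x. K (t * x) / K x) \<longlongrightarrow> c * t powr (- \<alpha>) / c) at_top"
    by (rule Lim_transform_eventually)
  then show "((\<lambda>x. K (t * x) / K x) \<longlongrightarrow> t powr (- \<alpha>)) at_top"
    using c by simp
qed

section \<open>Tails of perpetuities\<close>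

text \<open>\<^const>\<open>prob_space.indep_var\<close> forces both variables to take values in the same type, hence the
  explicit product formula as hypothesis.\<close>

lemma (in prob_space) nn_integral_indep:
  assumes [measurable]: "X \<in> M \<rightarrow>\<^sub>M S" "Y \<in> M \<rightarrow>\<^sub>M N"
    and prod: "\<And>A B. A \<in> sets S \<Longrightarrow> B \<in> sets N \<Longrightarrow>
      prob ((X -` A \<inter> space M) \<inter> (Y -` B \<inter> space M)) = prob (X -` A \<inter> space M) * prob (Y -` B \<inter> space M)"
    and f[measurable]: "f \<in> borel_measurable (S \<Otimes>\<^sub>M N)"
  shows "(\<integral>\<^sup>+\<omega>. f (X \<omega>, Y \<omega>) \<partial>M) = (\<integral>\<^sup>+\<omega>. (\<integral>\<^sup>+\<omega>'. f (X \<omega>, Y \<omega>') \<partial>M) \<partial>M)"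
proof -
  interpret X: prob_space "distr M S X" by (rule prob_space_distr) simp
  interpret Y: prob_space "distr M N Y" by (rule prob_space_distr) simp
  have eq: "distr M S X \<Otimes>\<^sub>M distr M N Y = distr M (S \<Otimes>\<^sub>M N) (\<lambda>\<omega>. (X \<omega>, Y \<omega>))"
  proof (rule pair_measure_eqI)
    fix A B assume "A \<in> sets (distr M S X)" "B \<in> sets (distr M N Y)"
    then have [measurable]: "A \<in> sets S" "B \<in> sets N" by auto
    have "emeasure (distr M (S \<Otimes>\<^sub>M N) (\<lambda>\<omega>. (X \<omega>, Y \<omega>))) (A \<times> B) = prob ((X -` A \<inter> space M) \<inter> (Y -` B \<inter> space M))"
      by (simp add: emeasure_distr emeasure_eq_measure) (auto intro!: arg_cong[where f=prob])
    then show "emeasure (distr M S X) A * emeasure (distr M N Y) B =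
        emeasure (distr M (S \<Otimes>\<^sub>M N) (\<lambda>\<omega>. (X \<omega>, Y \<omega>))) (A \<times> B)"
      by (simp add: prod emeasure_distr emeasure_eq_measure ennreal_mult)
  qed (auto intro: X.sigma_finite_measure_axioms Y.sigma_finite_measure_axioms)
  have "(\<integral>\<^sup>+\<omega>. f (X \<omega>, Y \<omega>) \<partial>M) = (\<integral>\<^sup>+z. f z \<partial>distr M (S \<Otimes>\<^sub>M N) (\<lambda>\<omega>. (X \<omega>, Y \<omega>)))"
    by (subst nn_integral_distr) simp_all
  also have "\<dots> = (\<integral>\<^sup>+z. f z \<partial>(distr M S X \<Otimes>\<^sub>M distr M N Y))"
    by (simp add: eq)
  also have "\<dots> = (\<integral>\<^sup>+x. \<integral>\<^sup>+y. f (x, y) \<partial>distr M N Y \<partial>distr M S X)"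
    by (rule Y.nn_integral_fst[symmetric]) (simp add: f cong: measurable_cong_sets)
  also have "\<dots> = (\<integral>\<^sup>+x. \<integral>\<^sup>+\<omega>'. f (x, Y \<omega>') \<partial>M \<partial>distr M S X)"
    by (intro nn_integral_cong nn_integral_distr) simp_all
  also have "\<dots> = (\<integral>\<^sup>+\<omega>. (\<integral>\<^sup>+\<omega>'. f (X \<omega>, Y \<omega>') \<partial>M) \<partial>M)"
    by (subst nn_integral_distr) simp_all
  finally show ?thesis .
qed

text \<open>Weighted arithmetic-geometric mean for u and 1. With u = Y^p it passes E Y^p < 1 on to
  every smaller positive exponent.\<close>

lemma powr_le_linear:
  fixes u r :: real
  assumes "u > 0" "0 \<le> r" "r \<le> 1"
  shows "u powr r \<le> 1 + r * (u - 1)"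
  using Youngs_inequality_0[of r "1 - r" u 1] assms by (simp add: algebra_simps)

lemma (in finite_measure) bonferroni_lower:
  fixes A :: "nat \<Rightarrow> 'a set"
  assumes A[measurable]: "\<And>n. A n \<in> sets M"
  shows "(\<Sum>n<N. measure M (A n)) - (\<Sum>n<N. \<Sum>m<n. measure M (A m \<inter> A n)) \<le> measure M (\<Union>n<N. A n)"
proof (induction N)
  case (Suc N)
  have "(\<Union>n<N. A n) \<inter> A N = (\<Union>n<N. A n \<inter> A N)" by auto
  then have "measure M ((\<Union>n<N. A n) \<inter> A N) \<le> (\<Sum>m<N. measure M (A m \<inter> A N))"
    using finite_measure_subadditive_finite[of "{..<N}" "\<lambda>n. A n \<inter> A N"] A
    by (simp add: image_subset_iff sets.Int)
  moreover have "measure M (\<Union>n<Suc N. A n) = measure M (\<Union>n<N. A n) + measure M (A N) - measure M ((\<Union>n<N. A n) \<inter> A N)"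
    using measure_Un3[of "\<Union>n<N. A n" M "A N"] A
    by (simp add: lessThan_Suc Un_commute fmeasurable_eq_sets)
  ultimately show ?case using Suc by simp
qed simp

text \<open>If all three alternatives fail, at most one of the first N terms exceeds
  \<open>\<delta> / N * x\<close>. That term is at most c x, the other early terms add up to at most
  \<delta> x, and the geometric thresholds bound the remainder by \<delta> x, so the whole sum is at
  most (c + 2 \<delta>) x = x.\<close>

lemma single_big_jump:
  fixes z :: "nat \<Rightarrow> real"
  assumes z: "\<And>n. 0 \<le> z n" "summable z" "x < (\<Sum>n. z n)" and x: "0 < x"
    and c: "0 < c" "c + 2 * \<delta> = 1" "0 < \<delta>" and r: "0 < r" "r < 1"
  shows "(\<exists>n<N. z n > c * x) \<or> (\<exists>n<N. \<exists>m<n. z m > \<delta> / N * x \<and> z n > \<delta> / N * x) \<or>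
    (\<exists>n\<ge>N. z n > \<delta> * (1 - r) * r ^ n * x)"
proof (rule ccontr)
  assume "\<not> ?thesis"
  then have a: "\<And>n. n < N \<Longrightarrow> z n \<le> c * x"
    and b: "\<And>m n. m < n \<Longrightarrow> n < N \<Longrightarrow> z m \<le> \<delta> / N * x \<or> z n \<le> \<delta> / N * x"
    and d: "\<And>n. n \<ge> N \<Longrightarrow> z n \<le> \<delta> * (1 - r) * r ^ n * x"
    by (meson not_le)+
  have "\<exists>k. \<forall>n<N. n \<noteq> k \<longrightarrow> z n \<le> \<delta> / N * x"
  proof (cases "\<exists>k<N. z k > \<delta> / N * x")
    case True
    then obtain k where k: "k < N" "z k > \<delta> / N * x" by auto
    have "z n \<le> \<delta> / N * x" if "n < N" "n \<noteq> k" for n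
      using b[of n k] b[of k n] k that by (cases "n < k") auto
    then show ?thesis by blast
  next
    case False
    then show ?thesis by (meson not_less)
  qed
  then obtain k where k: "\<And>n. n < N \<Longrightarrow> n \<noteq> k \<Longrightarrow> z n \<le> \<delta> / N * x" by blast
  have "(\<Sum>n<N. z n) \<le> (\<Sum>n<N. (if n = k then c * x else 0) + \<delta> / N * x)"
    using k a c x by (intro sum_mono) (auto intro: add_increasing2)
  also have "\<dots> \<le> c * x + \<delta> * x"
    using c x by (simp add: sum.distrib)
  finally have 1: "(\<Sum>n<N. z n) \<le> c * x + \<delta> * x" .
  have g: "summable (\<lambda>n. \<delta> * (1 - r) * x * r ^ (n + N))"
    using r by (intro summable_mult) (simp add: summable_iff_shift summable_geometric)
  have "(\<Sum>n. z (n + N)) \<le> (\<Sum>n. \<delta> * (1 - r) * x * r ^ (n + N))"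
    using d z by (intro suminf_le g) (auto simp: summable_iff_shift mult_ac)
  also have "\<dots> = \<delta> * x * r ^ N"
    using r by (simp add: power_add suminf_mult suminf_mult2[symmetric] suminf_geometric summable_geometric flip: mult.assoc)
  also have "\<dots> \<le> \<delta> * x" using r c x by (simp add: mult_left_le power_le_one)
  finally have "(\<Sum>n. z n) \<le> (c + 2 * \<delta>) * x"
    using 1 suminf_split_initial_segment[OF z(2), of N] by (simp add: algebra_simps)
  then show False using c z(3) by simp
qed

text \<open>\<open>T i\<close> stands for the gauge of claim i + 1 already multiplied by its own
  discount factor \<open>Y i\<close>, so the two components of a pair may depend on each other. For
  this reason the product \<open>W n\<close> below stops before \<open>Y n\<close>: it is then
  independent of \<open>T n\<close>.\<close>

locale perpetuity = prob_space M for M :: "'a measure" +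
  fixes T Y :: "nat \<Rightarrow> 'a \<Rightarrow> real" and \<alpha> p :: real
  assumes indep: "indep_vars (\<lambda>_. borel \<Otimes>\<^sub>M borel) (\<lambda>i \<omega>. (T i \<omega>, Y i \<omega>)) UNIV"
    and T_nonneg: "\<omega> \<in> space M \<Longrightarrow> 0 \<le> T i \<omega>"
    and Y_pos: "\<omega> \<in> space M \<Longrightarrow> 0 < Y i \<omega>"
    and T_ident: "distr M borel (T i) = distr M borel (T 0)"
    and Y_ident: "distr M borel (Y i) = distr M borel (Y 0)"
    and \<alpha>p: "0 < \<alpha>" "\<alpha> < p"
    and rv: "rv_tail \<alpha> (\<lambda>x. \<P>(\<omega> in M. T 0 \<omega> > x))"
    and moment: "integrable M (\<lambda>\<omega>. Y 0 \<omega> powr p)" "(\<integral>\<omega>. Y 0 \<omega> powr p \<partial>M) < 1"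
begin

definition H where "H x = \<P>(\<omega> in M. T 0 \<omega> > x)"
definition W where "W n \<omega> = (\<Prod>k<n. Y k \<omega>)"
definition Z where "Z n \<omega> = T n \<omega> * W n \<omega>"
definition \<rho> where "\<rho> s = (\<integral>\<omega>. Y 0 \<omega> powr s \<partial>M)"

lemma pair_measurable: "(\<lambda>\<omega>. (T i \<omega>, Y i \<omega>)) \<in> M \<rightarrow>\<^sub>M borel \<Otimes>\<^sub>M borel"
  using indep by (auto simp: indep_vars_def)

lemma T_measurable[measurable]: "T i \<in> borel_measurable M"
  using measurable_compose[OF pair_measurable[of i] measurable_fst] by simp

lemma Y_measurable[measurable]: "Y i \<in> borel_measurable M"
  using measurable_compose[OF pair_measurable[of i] measurable_snd] by simp

lemma W_measurable[measurable]: "W i \<in> borel_measurable M"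
  unfolding W_def by measurable

lemma Z_measurable[measurable]: "Z i \<in> borel_measurable M"
  unfolding Z_def by measurable

lemma W_pos: "\<omega> \<in> space M \<Longrightarrow> W n \<omega> > 0"
  unfolding W_def using Y_pos by (intro prod_pos) auto

lemma Z_nonneg: "\<omega> \<in> space M \<Longrightarrow> Z n \<omega> \<ge> 0"
  using T_nonneg W_pos by (simp add: Z_def less_imp_le)

lemma H_rv: "rv_tail \<alpha> H"
  using rv unfolding H_def[abs_def] .

lemma H_pos: "H x > 0" using rv_tail_pos[OF H_rv] .
lemma H_bounds: "0 \<le> H x" "H x \<le> 1" using H_rv by (auto simp: rv_tail_def)
lemma H_antimono: "antimono H" using H_rv by (auto simp: rv_tail_def)

lemma H_measurable[measurable]: "H \<in> borel_measurable borel"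
proof -
  have "mono (\<lambda>x. - H x)" using H_antimono by (auto simp: mono_def antimono_def)
  from borel_measurable_uminus[OF borel_measurable_mono[OF this]] show ?thesis by simp
qed

lemma \<rho>_integrable_less_one:
  assumes s: "0 < s" "s \<le> p"
  shows "integrable M (\<lambda>\<omega>. Y 0 \<omega> powr s)" "\<rho> s < 1" "0 \<le> \<rho> s"
proof -
  have le: "Y 0 \<omega> powr s \<le> 1 + s / p * (Y 0 \<omega> powr p - 1)" if "\<omega> \<in> space M" for \<omega>
    using powr_le_linear[of "Y 0 \<omega> powr p" "s / p"] s Y_pos[OF that, of 0] \<alpha>p
    by (simp add: powr_powr)
  have i: "integrable M (\<lambda>\<omega>. 1 + s / p * (Y 0 \<omega> powr p - 1))"
    using moment by (intro Bochner_Integration.integrable_add integrable_mult_right Bochner_Integration.integrable_diff) auto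
  show 1: "integrable M (\<lambda>\<omega>. Y 0 \<omega> powr s)"
    by (rule Bochner_Integration.integrable_bound[OF i])
       (auto intro!: AE_I2 order.trans[OF le] abs_ge_self)
  have "\<rho> s \<le> (\<integral>\<omega>. 1 + s / p * (Y 0 \<omega> powr p - 1) \<partial>M)"
    unfolding \<rho>_def by (intro integral_mono 1 i le)
  also have "\<dots> = 1 + s / p * ((\<integral>\<omega>. Y 0 \<omega> powr p \<partial>M) - 1)"
    using moment by (simp add: prob_space)
  also have "\<dots> < 1" using mult_pos_neg[of "s / p" "(\<integral>\<omega>. Y 0 \<omega> powr p \<partial>M) - 1"] moment(2) s \<alpha>p by auto
  finally show "\<rho> s < 1" .
  show "0 \<le> \<rho> s" unfolding \<rho>_def by (rule integral_nonneg_AE) auto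
qed

lemma Y_powr_integral:
  assumes "0 < s" "s \<le> p"
  shows "integrable M (\<lambda>\<omega>. Y k \<omega> powr s)" "(\<integral>\<omega>. Y k \<omega> powr s \<partial>M) = \<rho> s"
proof -
  have "integrable (distr M borel (Y k)) (\<lambda>y. y powr s)"
    unfolding Y_ident[of k] using \<rho>_integrable_less_one(1)[OF assms] by (simp add: integrable_distr_eq)
  then show "integrable M (\<lambda>\<omega>. Y k \<omega> powr s)" by (simp add: integrable_distr_eq)
  have "(\<integral>y. y powr s \<partial>distr M borel (Y k)) = (\<integral>y. y powr s \<partial>distr M borel (Y 0))"
    by (simp only: Y_ident[of k])
  then show "(\<integral>\<omega>. Y k \<omega> powr s \<partial>M) = \<rho> s" by (simp add: integral_distr \<rho>_def)
qed

lemma W_powr_integral: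
  assumes "0 < s" "s \<le> p"
  shows "integrable M (\<lambda>\<omega>. W n \<omega> powr s)" "(\<integral>\<omega>. W n \<omega> powr s \<partial>M) = \<rho> s ^ n"
proof -
  have "indep_vars (\<lambda>_. borel) (\<lambda>i \<omega>. (\<lambda>z. snd z powr s) (T i \<omega>, Y i \<omega>)) {..<n}"
    by (rule indep_vars_compose2[OF indep_vars_subset[OF indep]]) auto
  then have iv: "indep_vars (\<lambda>_. borel) (\<lambda>i \<omega>. Y i \<omega> powr s) {..<n}" by simp
  have eq: "W n \<omega> powr s = (\<Prod>k<n. Y k \<omega> powr s)" for \<omega>
    by (simp add: W_def prod_powr_distrib)
  show "integrable M (\<lambda>\<omega>. W n \<omega> powr s)"
    unfolding eq by (intro indep_vars_integrable iv Y_powr_integral assms) auto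
  show "(\<integral>\<omega>. W n \<omega> powr s \<partial>M) = \<rho> s ^ n"
    unfolding eq using indep_vars_lebesgue_integral[OF _ iv] Y_powr_integral[OF assms] by simp
qed

lemma prob_T_gt: "\<P>(\<omega> in M. T n \<omega> > x) = H x"
proof -
  have "measure (distr M borel (T n)) {x<..} = measure (distr M borel (T 0)) {x<..}"
    by (simp only: T_ident[of n])
  then show ?thesis by (simp add: measure_distr H_def vimage_def Int_def conj_commute)
qed

text \<open>Both the condition and the threshold are functions of the first n pairs, of which
  \<open>T n\<close> is independent, so \<open>T n\<close> can be integrated out first. Taking the
  condition true gives the tail of \<open>Z n\<close>; taking it to be a large earlier
  \<open>Z m\<close> gives the joint tail.\<close>

lemma prob_block:
  assumes \<phi>[measurable]: "\<phi> \<in> borel_measurable (\<Pi>\<^sub>M i\<in>{..<n}. borel \<Otimes>\<^sub>M borel)"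
    and C[measurable]: "Measurable.pred (\<Pi>\<^sub>M i\<in>{..<n}. borel \<Otimes>\<^sub>M borel) C"
    and U: "U = (\<lambda>\<omega>. \<lambda>i\<in>{..<n}. (T i \<omega>, Y i \<omega>))"
  shows "\<P>(\<omega> in M. C (U \<omega>) \<and> T n \<omega> > \<phi> (U \<omega>)) = (\<integral>\<omega>. indicator {\<omega>. C (U \<omega>)} \<omega> * H (\<phi> (U \<omega>)) \<partial>M)"
proof -
  let ?P = "\<Pi>\<^sub>M i\<in>{..<n}. (borel \<Otimes>\<^sub>M borel :: (real \<times> real) measure)"
  let ?R = "\<Pi>\<^sub>M i\<in>{n}. (borel \<Otimes>\<^sub>M borel :: (real \<times> real) measure)"
  define V where "V \<omega> = (\<lambda>i\<in>{n}. (T i \<omega>, Y i \<omega>))" for \<omega>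
  have U_meas[measurable]: "U \<in> M \<rightarrow>\<^sub>M ?P"
    unfolding U using pair_measurable by (intro measurable_restrict) auto
  have "indep_var ?P (\<lambda>\<omega>. \<lambda>i\<in>{..<n}. (T i \<omega>, Y i \<omega>)) (\<Pi>\<^sub>M i\<in>{n}. borel \<Otimes>\<^sub>M borel) (\<lambda>\<omega>. \<lambda>i\<in>{n}. (T i \<omega>, Y i \<omega>))"
    by (rule indep_var_restrict[OF indep]) auto
  then have ind: "indep_var ?P U ?R V" by (simp add: U V_def[abs_def])
  have V_meas[measurable]: "V \<in> M \<rightarrow>\<^sub>M ?R" by (rule indep_var_rv2[OF ind])
  have prod: "prob ((U -` A \<inter> space M) \<inter> (V -` B \<inter> space M)) = prob (U -` A \<inter> space M) * prob (V -` B \<inter> space M)"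
    if "A \<in> sets ?P" "B \<in> sets ?R" for A B
  proof -
    have "(U -` A \<inter> space M) \<inter> (V -` B \<inter> space M) = (\<lambda>x. (U x, V x)) -` (A \<times> B) \<inter> space M" by auto
    then show ?thesis using indep_varD[OF ind that] by simp
  qed
  have [measurable]: "(\<lambda>g. fst (g n)) \<in> borel_measurable ?R"
    using measurable_component_singleton[of n "{n}" "\<lambda>_. borel \<Otimes>\<^sub>M borel :: (real \<times> real) measure"]
      measurable_compose[OF _ measurable_fst] by auto
  have Vn: "fst (V \<omega> n) = T n \<omega>" for \<omega> by (simp add: V_def)
  define f :: "(nat \<Rightarrow> real \<times> real) \<times> (nat \<Rightarrow> real \<times> real) \<Rightarrow> ennreal"
    where "f z = (indicator {z. C (fst z) \<and> fst (snd z n) > \<phi> (fst z)} z :: ennreal)" for z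
  have f[measurable]: "f \<in> borel_measurable (?P \<Otimes>\<^sub>M ?R)"
  proof -
    have [measurable]: "(\<lambda>z. fst (snd z n)) \<in> borel_measurable (?P \<Otimes>\<^sub>M ?R)"
      by (rule measurable_compose[OF measurable_snd]) measurable
    show ?thesis unfolding f_def[abs_def] by measurable
  qed
  have "ennreal \<P>(\<omega> in M. C (U \<omega>) \<and> T n \<omega> > \<phi> (U \<omega>)) = (\<integral>\<^sup>+\<omega>. indicator {\<omega>\<in>space M. C (U \<omega>) \<and> T n \<omega> > \<phi> (U \<omega>)} \<omega> \<partial>M)"
    by (simp add: emeasure_eq_measure)
  also have "\<dots> = (\<integral>\<^sup>+\<omega>. f (U \<omega>, V \<omega>) \<partial>M)"
    by (intro nn_integral_cong) (auto simp: f_def Vn indicator_def)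
  also have "\<dots> = (\<integral>\<^sup>+\<omega>. \<integral>\<^sup>+\<omega>'. f (U \<omega>, V \<omega>') \<partial>M \<partial>M)"
    by (rule nn_integral_indep[OF U_meas V_meas prod f])
  also have "\<dots> = (\<integral>\<^sup>+\<omega>. ennreal (indicator {\<omega>. C (U \<omega>)} \<omega> * H (\<phi> (U \<omega>))) \<partial>M)"
  proof (intro nn_integral_cong)
    fix \<omega>
    have "(\<integral>\<^sup>+\<omega>'. f (U \<omega>, V \<omega>') \<partial>M) = (\<integral>\<^sup>+\<omega>'. indicator {\<omega>. C (U \<omega>)} \<omega> * indicator {\<omega>'\<in>space M. T n \<omega>' > \<phi> (U \<omega>)} \<omega>' \<partial>M)"
      by (intro nn_integral_cong) (auto simp: f_def Vn indicator_def)
    also have "\<dots> = indicator {\<omega>. C (U \<omega>)} \<omega> * ennreal (H (\<phi> (U \<omega>)))"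
      by (simp add: nn_integral_cmult emeasure_eq_measure prob_T_gt)
    finally show "(\<integral>\<^sup>+\<omega>'. f (U \<omega>, V \<omega>') \<partial>M) = ennreal (indicator {\<omega>. C (U \<omega>)} \<omega> * H (\<phi> (U \<omega>)))"
      by (simp add: indicator_def)
  qed
  also have "\<dots> = ennreal (\<integral>\<omega>. indicator {\<omega>. C (U \<omega>)} \<omega> * H (\<phi> (U \<omega>)) \<partial>M)"
    using H_bounds by (intro nn_integral_eq_integral integrable_const_bound[where B=1])
      (auto simp: indicator_def)
  finally show ?thesis
    by (subst (asm) ennreal_inj) (auto intro!: integral_nonneg_AE simp: H_bounds)
qed

lemma prob_Z_gt:
  assumes "c > 0"
  shows "\<P>(\<omega> in M. Z n \<omega> > c * x) = (\<integral>\<omega>. H (x / (W n \<omega> / c)) \<partial>M)"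
proof -
  define \<phi> where "\<phi> b = x / ((\<Prod>k<n. snd (b k)) / c)" for b :: "nat \<Rightarrow> real \<times> real"
  have [measurable]: "\<phi> \<in> borel_measurable (\<Pi>\<^sub>M i\<in>{..<n}. borel \<Otimes>\<^sub>M borel)"
    unfolding \<phi>_def by measurable
  have \<phi>_eq: "\<phi> (\<lambda>i\<in>{..<n}. (T i \<omega>, Y i \<omega>)) = x / (W n \<omega> / c)" for \<omega>
    by (simp add: \<phi>_def W_def)
  have "\<P>(\<omega> in M. Z n \<omega> > c * x) = \<P>(\<omega> in M. True \<and> T n \<omega> > x / (W n \<omega> / c))"
    using W_pos assms by (intro arg_cong[where f=prob]) (auto simp: Z_def field_simps)
  also have "\<dots> = (\<integral>\<omega>. H (x / (W n \<omega> / c)) \<partial>M)"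
    using prob_block[of \<phi> n "\<lambda>_. True", OF _ _ refl] by (simp add: \<phi>_eq)
  finally show ?thesis .
qed

lemma prob_Z_gt_both:
  assumes "c > 0" "m < n"
  shows "\<P>(\<omega> in M. Z m \<omega> > c * x \<and> Z n \<omega> > c * x) = (\<integral>\<omega>. indicator {\<omega>. Z m \<omega> > c * x} \<omega> * H (x / (W n \<omega> / c)) \<partial>M)"
proof -
  define \<phi> where "\<phi> b = x / ((\<Prod>k<n. snd (b k)) / c)" for b :: "nat \<Rightarrow> real \<times> real"
  define C where "C b \<longleftrightarrow> fst (b m) * (\<Prod>k<m. snd (b k)) > c * x" for b :: "nat \<Rightarrow> real \<times> real"
  have [measurable]: "\<phi> \<in> borel_measurable (\<Pi>\<^sub>M i\<in>{..<n}. borel \<Otimes>\<^sub>M borel)"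
    unfolding \<phi>_def by measurable
  have m: "m \<in> {..<n}" "\<And>k. k < m \<Longrightarrow> k \<in> {..<n}" using assms by auto
  let ?P = "\<Pi>\<^sub>M i\<in>{..<n}. (borel \<Otimes>\<^sub>M borel :: (real \<times> real) measure)"
  have comp: "(\<lambda>b. fst (b k)) \<in> borel_measurable ?P" "(\<lambda>b. snd (b k)) \<in> borel_measurable ?P" if "k < n" for k
    using measurable_component_singleton[of k "{..<n}" "\<lambda>_. borel \<Otimes>\<^sub>M borel :: (real \<times> real) measure"] that
      measurable_compose[OF _ measurable_fst] measurable_compose[OF _ measurable_snd]
    by auto
  have [measurable]: "Measurable.pred ?P C"
    unfolding C_def using m
    by (intro borel_measurable_pred_less borel_measurable_times borel_measurable_prod borel_measurable_const comp) auto
  have \<phi>_eq: "\<phi> (\<lambda>i\<in>{..<n}. (T i \<omega>, Y i \<omega>)) = x / (W n \<omega> / c)" for \<omega>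
    by (simp add: \<phi>_def W_def)
  have C_eq: "C (\<lambda>i\<in>{..<n}. (T i \<omega>, Y i \<omega>)) \<longleftrightarrow> Z m \<omega> > c * x" for \<omega>
    using m by (simp add: C_def W_def Z_def)
  have "\<P>(\<omega> in M. Z m \<omega> > c * x \<and> Z n \<omega> > c * x) = \<P>(\<omega> in M. Z m \<omega> > c * x \<and> T n \<omega> > x / (W n \<omega> / c))"
    using W_pos assms by (intro arg_cong[where f=prob]) (auto simp: Z_def[of n] field_simps)
  also have "\<dots> = (\<integral>\<omega>. indicator {\<omega>. Z m \<omega> > c * x} \<omega> * H (x / (W n \<omega> / c)) \<partial>M)"
    using prob_block[of \<phi> n C, OF _ _ refl] by (simp add: \<phi>_eq C_eq)
  finally show ?thesis .
qed

lemma W_scaled_integrable: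
  assumes "c > 0" "0 < s" "s \<le> p"
  shows "integrable M (\<lambda>\<omega>. (W n \<omega> / c) powr s)"
    "(\<integral>\<omega>. (W n \<omega> / c) powr s \<partial>M) = \<rho> s ^ n * c powr (- s)"
proof -
  have eq: "(W n \<omega> / c) powr s = W n \<omega> powr s * c powr (- s)" if "\<omega> \<in> space M" for \<omega>
    using W_pos[OF that, of n] assms by (simp add: powr_divide powr_minus field_simps)
  show "integrable M (\<lambda>\<omega>. (W n \<omega> / c) powr s)"
    using W_powr_integral(1)[OF assms(2,3)] by (subst Bochner_Integration.integrable_cong[OF refl eq]) auto
  show "(\<integral>\<omega>. (W n \<omega> / c) powr s \<partial>M) = \<rho> s ^ n * c powr (- s)"
    using W_powr_integral(2)[OF assms(2,3)] by (subst Bochner_Integration.integral_cong[OF refl eq]) auto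
qed

text \<open>Given \<open>W n\<close>, the tail ratio tends to
  \<open>(W n / c) powr \<alpha>\<close>. Potter's bound with the exponents p and \<alpha>/2 on
  either side of \<alpha> dominates it, and both moments of \<open>W n\<close> are finite.\<close>

lemma Z_tail_limit:
  assumes c: "c > 0"
  shows "((\<lambda>x. \<P>(\<omega> in M. Z n \<omega> > c * x) / H x) \<longlongrightarrow> \<rho> \<alpha> ^ n * c powr (- \<alpha>)) at_top"
proof -
  obtain C x0 where C: "C > 0" "x0 > 0"
    "\<And>x w. x \<ge> x0 \<Longrightarrow> w > 0 \<Longrightarrow> H (x / w) \<le> C * H x * (w powr p + w powr (\<alpha>/2))"
    using rv_tail_potter[OF H_rv, of "\<alpha>/2" p] \<alpha>p by auto
  let ?w = "\<lambda>\<omega>. C * ((W n \<omega> / c) powr p + (W n \<omega> / c) powr (\<alpha>/2))"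
  have "((\<lambda>x. \<integral>\<omega>. H (x / (W n \<omega> / c)) / H x \<partial>M) \<longlongrightarrow> (\<integral>\<omega>. (W n \<omega> / c) powr \<alpha> \<partial>M)) at_top"
  proof (rule integral_dominated_convergence_at_top[where w="?w"])
    show "integrable M ?w"
      using c \<alpha>p by (intro integrable_mult_right Bochner_Integration.integrable_add W_scaled_integrable) auto
    show "AE \<omega> in M. ((\<lambda>x. H (x / (W n \<omega> / c)) / H x) \<longlongrightarrow> (W n \<omega> / c) powr \<alpha>) at_top"
    proof (intro AE_I2)
      fix \<omega> assume "\<omega> \<in> space M"
      then have pos: "W n \<omega> / c > 0" using W_pos c by simp
      then have "((\<lambda>x. H (1 / (W n \<omega> / c) * x) / H x) \<longlongrightarrow> (1 / (W n \<omega> / c)) powr (- \<alpha>)) at_top"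
        using H_rv unfolding rv_tail_def by (metis zero_less_divide_1_iff)
      moreover have "(1 / (W n \<omega> / c)) powr (- \<alpha>) = (W n \<omega> / c) powr \<alpha>"
        using pos by (simp only: powr_divide powr_minus) simp
      ultimately show "((\<lambda>x. H (x / (W n \<omega> / c)) / H x) \<longlongrightarrow> (W n \<omega> / c) powr \<alpha>) at_top" by (simp add: mult.commute)
    qed
    show "\<forall>\<^sub>F x in at_top. AE \<omega> in M. norm (H (x / (W n \<omega> / c)) / H x) \<le> ?w \<omega>"
    proof (rule eventually_at_top_linorderI[of x0], intro AE_I2)
      fix x \<omega> assume "x0 \<le> x" "\<omega> \<in> space M"
      then have "H (x / (W n \<omega> / c)) \<le> C * H x * ((W n \<omega> / c) powr p + (W n \<omega> / c) powr (\<alpha>/2))"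
        using W_pos c by (intro C) auto
      then show "norm (H (x / (W n \<omega> / c)) / H x) \<le> ?w \<omega>"
        using H_pos[of x] H_bounds by (simp add: divide_le_eq mult_ac)
    qed
  qed simp_all
  then show ?thesis using W_scaled_integrable(2)[of c \<alpha> n] c \<alpha>p by (simp add: prob_Z_gt)
qed

text \<open>The large value of \<open>T n\<close> alone contributes the order \<open>H x\<close>.
  The indicator of a large \<open>Z m\<close> tends to 0 pointwise because \<open>Z m\<close> is
  finite, under the same dominating function as for a single tail.\<close>

lemma Z_joint_tail_limit:
  assumes c: "c > 0" and mn: "m < n"
  shows "((\<lambda>x. \<P>(\<omega> in M. Z m \<omega> > c * x \<and> Z n \<omega> > c * x) / H x) \<longlongrightarrow> 0) at_top"
proof -
  obtain C x0 where C: "C > 0" "x0 > 0"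
    "\<And>x w. x \<ge> x0 \<Longrightarrow> w > 0 \<Longrightarrow> H (x / w) \<le> C * H x * (w powr p + w powr (\<alpha>/2))"
    using rv_tail_potter[OF H_rv, of "\<alpha>/2" p] \<alpha>p by auto
  let ?w = "\<lambda>\<omega>. C * ((W n \<omega> / c) powr p + (W n \<omega> / c) powr (\<alpha>/2))"
  let ?f = "\<lambda>x \<omega>. indicator {\<omega>. Z m \<omega> > c * x} \<omega> * H (x / (W n \<omega> / c)) / H x"
  have "((\<lambda>x. \<integral>\<omega>. ?f x \<omega> \<partial>M) \<longlongrightarrow> (\<integral>\<omega>. 0 \<partial>M)) at_top"
  proof (rule integral_dominated_convergence_at_top[where w="?w"])
    show "integrable M ?w"
      using c \<alpha>p by (intro integrable_mult_right Bochner_Integration.integrable_add W_scaled_integrable) auto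
    show "AE \<omega> in M. ((\<lambda>x. ?f x \<omega>) \<longlongrightarrow> 0) at_top"
    proof (intro AE_I2 tendsto_eventually)
      fix \<omega> show "\<forall>\<^sub>F x in at_top. ?f x \<omega> = 0"
        using c by (intro eventually_at_top_linorderI[of "Z m \<omega> / c"]) (auto simp: indicator_def field_simps)
    qed
    show "\<forall>\<^sub>F x in at_top. AE \<omega> in M. norm (?f x \<omega>) \<le> ?w \<omega>"
    proof (rule eventually_at_top_linorderI[of x0], intro AE_I2)
      fix x \<omega> assume "x0 \<le> x" "\<omega> \<in> space M"
      then have "H (x / (W n \<omega> / c)) \<le> C * H x * ((W n \<omega> / c) powr p + (W n \<omega> / c) powr (\<alpha>/2))"
        using W_pos c by (intro C) auto
      then have "H (x / (W n \<omega> / c)) / H x \<le> ?w \<omega>"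
        using H_pos[of x] by (simp add: divide_le_eq mult_ac)
      moreover have "norm (?f x \<omega>) \<le> H (x / (W n \<omega> / c)) / H x"
        using H_pos[of x] H_bounds by (auto simp: indicator_def)
      ultimately show "norm (?f x \<omega>) \<le> ?w \<omega>" by linarith
    qed
  qed simp_all
  then show ?thesis using c mn by (simp add: prob_Z_gt_both)
qed

lemma prob_Z_gt_bound:
  obtains C x0 where "C > 0" "x0 > 0"
    "\<And>x n c. x \<ge> x0 \<Longrightarrow> c > 0 \<Longrightarrow>
       \<P>(\<omega> in M. Z n \<omega> > c * x) \<le> C * H x * (\<rho> p ^ n * c powr (- p) + \<rho> (\<alpha>/2) ^ n * c powr (- (\<alpha>/2)))"
proof -
  obtain C x0 where C: "C > 0" "x0 > 0"
    "\<And>x w. x \<ge> x0 \<Longrightarrow> w > 0 \<Longrightarrow> H (x / w) \<le> C * H x * (w powr p + w powr (\<alpha>/2))"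
    using rv_tail_potter[OF H_rv, of "\<alpha>/2" p] \<alpha>p by auto
  have "\<P>(\<omega> in M. Z n \<omega> > c * x) \<le> C * H x * (\<rho> p ^ n * c powr (- p) + \<rho> (\<alpha>/2) ^ n * c powr (- (\<alpha>/2)))"
    if x: "x \<ge> x0" and c: "c > 0" for x n c
  proof -
    have i: "integrable M (\<lambda>\<omega>. (W n \<omega> / c) powr p + (W n \<omega> / c) powr (\<alpha>/2))"
      using c \<alpha>p by (intro Bochner_Integration.integrable_add W_scaled_integrable) auto
    have "\<P>(\<omega> in M. Z n \<omega> > c * x) = (\<integral>\<omega>. H (x / (W n \<omega> / c)) \<partial>M)" using prob_Z_gt[OF c] .
    also have "\<dots> \<le> (\<integral>\<omega>. C * H x * ((W n \<omega> / c) powr p + (W n \<omega> / c) powr (\<alpha>/2)) \<partial>M)"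
    proof (rule integral_mono)
      show "integrable M (\<lambda>\<omega>. H (x / (W n \<omega> / c)))"
        using H_bounds by (intro integrable_const_bound[where B=1]) auto
      show "integrable M (\<lambda>\<omega>. C * H x * ((W n \<omega> / c) powr p + (W n \<omega> / c) powr (\<alpha>/2)))"
        using i by (rule integrable_mult_right)
      show "H (x / (W n \<omega> / c)) \<le> C * H x * ((W n \<omega> / c) powr p + (W n \<omega> / c) powr (\<alpha>/2))"
        if "\<omega> \<in> space M" for \<omega>
        using that W_pos c x by (intro C(3)) auto
    qed
    also have "\<dots> = C * H x * (\<rho> p ^ n * c powr (- p) + \<rho> (\<alpha>/2) ^ n * c powr (- (\<alpha>/2)))"
      using c \<alpha>p W_scaled_integrable[of c p n] W_scaled_integrable[of c "\<alpha>/2" n] by simp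
    finally show ?thesis .
  qed
  then show ?thesis using that C(1,2) by blast
qed

text \<open>The thresholds may decay like r^n provided that r is close enough to 1 for the moments
  \<rho>^n to beat the powers of r^(-n) that Potter's bound produces.\<close>

lemma remainder_negligible:
  assumes \<delta>: "\<delta> > 0" and \<epsilon>: "\<epsilon> > 0"
  obtains r N where "0 < r" "r < 1" "\<forall>\<^sub>F x in at_top. \<P>(\<omega> in M. \<exists>n\<ge>N. Z n \<omega> > \<delta> * (1 - r) * r ^ n * x) \<le> \<epsilon> * H x"
proof -
  define A where "A = max (\<rho> p) (\<rho> (\<alpha>/2))"
  \<comment> \<open>Chosen so that r^p is the midpoint of \<open>A\<close> and 1. As r < 1, also r^q
    >= r^p, so both quotients in \<open>rat\<close> stay below 1.\<close>
  define r where "r = ((1 + A) / 2) powr (1 / p)"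
  define q where "q = \<alpha> / 2"
  have q: "0 < q" "q < p" "q \<le> p" using \<alpha>p by (auto simp: q_def)
  have p: "p > 0" using \<alpha>p by simp
  have \<rho>: "\<rho> p < 1" "\<rho> q < 1" "0 \<le> \<rho> p" "0 \<le> \<rho> q"
    using \<rho>_integrable_less_one[of p] \<rho>_integrable_less_one[of q] q p by auto
  have A: "0 \<le> A" "A < 1" "\<rho> p \<le> A" "\<rho> q \<le> A" using \<rho> by (auto simp: A_def q_def)
  have rp: "r powr p = (1 + A) / 2" using A p by (simp add: r_def powr_powr)
  have r: "0 < r" "r < 1"
  proof -
    show "0 < r" using A by (simp add: r_def)
    have "r < 1 powr (1 / p)" unfolding r_def using A p by (intro powr_less_mono2) auto
    then show "r < 1" by simp
  qed
  have rq: "r powr p \<le> r powr q" using r q by (intro powr_mono') auto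
  have rat: "0 \<le> \<rho> p / r powr p" "\<rho> p / r powr p < 1" "0 \<le> \<rho> q / r powr q" "\<rho> q / r powr q < 1"
    using A rp rq r \<rho> by (auto simp: divide_less_eq)
  obtain C x0 where C: "C > 0" "x0 > 0" "\<And>x n c. x \<ge> x0 \<Longrightarrow> c > 0 \<Longrightarrow>
       \<P>(\<omega> in M. Z n \<omega> > c * x) \<le> C * H x * (\<rho> p ^ n * c powr (- p) + \<rho> q ^ n * c powr (- q))"
    by (rule prob_Z_gt_bound[folded q_def]) blast
  define d where "d = \<delta> * (1 - r)"
  have d: "d > 0" using \<delta> r by (simp add: d_def)
  define t where "t n = C * (d powr (- p) * (\<rho> p / r powr p) ^ n + d powr (- q) * (\<rho> q / r powr q) ^ n)" for n
  have t_sum: "summable t" unfolding t_def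
    using rat by (intro summable_mult summable_add summable_geometric) auto
  have rn: "(r ^ n) powr s = (r powr s) ^ n" for n s
    using r by (induction n) (auto simp: powr_mult)
  have pw: "(d * r ^ n) powr (- s) = d powr (- s) / (r powr s) ^ n" for n s
    by (simp add: powr_mult powr_minus rn field_simps)
  have bound: "\<P>(\<omega> in M. Z n \<omega> > d * r ^ n * x) \<le> H x * t n" if "x \<ge> x0" for x n
  proof -
    have "\<P>(\<omega> in M. Z n \<omega> > d * r ^ n * x) \<le> C * H x * (\<rho> p ^ n * (d * r ^ n) powr (- p) + \<rho> q ^ n * (d * r ^ n) powr (- q))"
      using that d r by (intro C(3)) auto
    also have "\<dots> = H x * t n" unfolding t_def pw by (simp add: power_divide field_simps)
    finally show ?thesis .
  qed
  have "(\<lambda>N. \<Sum>n. t (n + N)) \<longlonglongrightarrow> 0" by (rule suminf_exist_split2[OF t_sum])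
  then have "\<forall>\<^sub>F N in sequentially. (\<Sum>n. t (n + N)) < \<epsilon>"
    using \<epsilon> by (rule order_tendstoD(2))
  then obtain N where N: "(\<Sum>n. t (n + N)) < \<epsilon>"
    by (auto simp: eventually_sequentially)
  have "\<forall>\<^sub>F x in at_top. \<P>(\<omega> in M. \<exists>n\<ge>N. Z n \<omega> > \<delta> * (1 - r) * r ^ n * x) \<le> \<epsilon> * H x"
  proof (rule eventually_at_top_linorderI[of x0])
    fix x assume x: "x0 \<le> x"
    define B where "B n = {\<omega>\<in>space M. Z (n + N) \<omega> > d * r ^ (n + N) * x}" for n
    have ts: "summable (\<lambda>n. H x * t (n + N))" using t_sum by (intro summable_mult) (simp add: summable_iff_shift)
    have Bm: "B n \<in> events" for n unfolding B_def by measurable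
    have Bs: "summable (\<lambda>n. prob (B n))"
      using bound[OF x] by (intro summable_comparison_test[OF _ ts]) (auto simp: B_def)
    have "{\<omega>\<in>space M. \<exists>n\<ge>N. Z n \<omega> > \<delta> * (1 - r) * r ^ n * x} = (\<Union>n. B n)"
    proof (intro set_eqI iffI)
      fix \<omega> assume "\<omega> \<in> {\<omega>\<in>space M. \<exists>n\<ge>N. Z n \<omega> > \<delta> * (1 - r) * r ^ n * x}"
      then obtain n where "\<omega> \<in> space M" "n \<ge> N" "Z n \<omega> > d * r ^ n * x" by (auto simp: d_def)
      then have "\<omega> \<in> B (n - N)" by (simp add: B_def)
      then show "\<omega> \<in> (\<Union>n. B n)" by blast
    next
      fix \<omega> assume "\<omega> \<in> (\<Union>n. B n)"
      then obtain n where "\<omega> \<in> space M" "Z (n + N) \<omega> > d * r ^ (n + N) * x" by (auto simp: B_def)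
      then show "\<omega> \<in> {\<omega>\<in>space M. \<exists>n\<ge>N. Z n \<omega> > \<delta> * (1 - r) * r ^ n * x}"
        unfolding d_def using le_add2 by blast
    qed
    then have "\<P>(\<omega> in M. \<exists>n\<ge>N. Z n \<omega> > \<delta> * (1 - r) * r ^ n * x) \<le> (\<Sum>n. prob (B n))"
      using finite_measure_subadditive_countably[OF _ Bs] Bm by auto
    also have "\<dots> \<le> (\<Sum>n. H x * t (n + N))"
      using bound[OF x] by (intro suminf_le Bs ts) (auto simp: B_def)
    also have "\<dots> = H x * (\<Sum>n. t (n + N))" using t_sum by (intro suminf_mult) (simp add: summable_iff_shift)
    also have "\<dots> \<le> \<epsilon> * H x" using N H_pos[of x] by (simp add: mult.commute)
    finally show "\<P>(\<omega> in M. \<exists>n\<ge>N. Z n \<omega> > \<delta> * (1 - r) * r ^ n * x) \<le> \<epsilon> * H x" .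
  qed
  then show ?thesis using that r by blast
qed

text \<open>\<open>S\<close> will be the gauge of D, which is not itself a series but lies between
  the largest term and the sum. The two bounds have the same tail constant, the sum of the powers of
  \<open>\<rho> \<alpha>\<close>, because a large sum is caused by one large term.\<close>

theorem tail_of_sum:
  assumes S[measurable]: "S \<in> borel_measurable M"
    and sand: "AE \<omega> in M. summable (\<lambda>n. Z n \<omega>) \<and> (\<forall>n. Z n \<omega> \<le> S \<omega>) \<and> S \<omega> \<le> (\<Sum>n. Z n \<omega>)"
  shows "((\<lambda>x. \<P>(\<omega> in M. S \<omega> > x) / H x) \<longlongrightarrow> 1 / (1 - \<rho> \<alpha>)) at_top"
proof (rule order_tendstoI)
  let ?L = "1 / (1 - \<rho> \<alpha>)"
  have \<rho>: "0 \<le> \<rho> \<alpha>" "\<rho> \<alpha> < 1" using \<rho>_integrable_less_one[of \<alpha>] \<alpha>p by auto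
  have geo: "(\<lambda>n. \<rho> \<alpha> ^ n) sums ?L" using \<rho> by (intro geometric_sums) auto
  {
    fix l assume "l < ?L"
    with geo have "\<forall>\<^sub>F N in sequentially. l < (\<Sum>n<N. \<rho> \<alpha> ^ n)"
      unfolding sums_def by (rule order_tendstoD(1))
    then obtain N where N: "l < (\<Sum>n<N. \<rho> \<alpha> ^ n)" by (auto simp: eventually_sequentially)
    let ?A = "\<lambda>x n. {\<omega>\<in>space M. Z n \<omega> > 1 * x}"
    have "((\<lambda>x. (\<Sum>n<N. prob (?A x n) / H x) - (\<Sum>n<N. \<Sum>m<n. \<P>(\<omega> in M. Z m \<omega> > 1 * x \<and> Z n \<omega> > 1 * x) / H x))
        \<longlongrightarrow> (\<Sum>n<N. \<rho> \<alpha> ^ n * 1 powr (- \<alpha>)) - (\<Sum>n<N. \<Sum>m<n. 0)) at_top"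
      by (intro tendsto_diff tendsto_sum Z_tail_limit Z_joint_tail_limit) auto
    then have "\<forall>\<^sub>F x in at_top. l < (\<Sum>n<N. prob (?A x n) / H x) - (\<Sum>n<N. \<Sum>m<n. \<P>(\<omega> in M. Z m \<omega> > 1 * x \<and> Z n \<omega> > 1 * x) / H x)"
      using N by (intro order_tendstoD(1)) auto
    then show "\<forall>\<^sub>F x in at_top. l < \<P>(\<omega> in M. S \<omega> > x) / H x"
    proof eventually_elim
      case (elim x)
      have "(\<Sum>n<N. prob (?A x n)) - (\<Sum>n<N. \<Sum>m<n. \<P>(\<omega> in M. Z m \<omega> > 1 * x \<and> Z n \<omega> > 1 * x)) \<le> prob (\<Union>n<N. ?A x n)"
        using bonferroni_lower[of "?A x" N] by (simp add: Collect_conj_eq[symmetric] Int_def conj_ac cong: conj_cong)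
      also have "\<dots> \<le> \<P>(\<omega> in M. S \<omega> > x)"
      proof (rule finite_measure_mono_AE)
        show "AE \<omega> in M. \<omega> \<in> (\<Union>n<N. ?A x n) \<longrightarrow> \<omega> \<in> {\<omega>\<in>space M. S \<omega> > x}"
          using sand by eventually_elim (auto intro: less_le_trans)
      qed simp
      finally have "((\<Sum>n<N. prob (?A x n)) - (\<Sum>n<N. \<Sum>m<n. \<P>(\<omega> in M. Z m \<omega> > 1 * x \<and> Z n \<omega> > 1 * x))) / H x
          \<le> \<P>(\<omega> in M. S \<omega> > x) / H x"
        using H_pos[of x] by (intro divide_right_mono) auto
      with elim show ?case by (simp add: diff_divide_distrib sum_divide_distrib)
    qed
  }
  {
    fix u assume u: "?L < u"
    have "((\<lambda>c. ?L * c powr (- \<alpha>)) \<longlongrightarrow> ?L * 1 powr (- \<alpha>)) (at_left 1)"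
      by (intro tendsto_intros) auto
    then have "\<forall>\<^sub>F c in at_left 1. ?L * c powr (- \<alpha>) < u"
      using u by (intro order_tendstoD(2)) auto
    then obtain b where b: "b < 1" "\<And>c. b < c \<Longrightarrow> c < 1 \<Longrightarrow> ?L * c powr (- \<alpha>) < u"
      by (auto simp: eventually_at_left_field)
    \<comment> \<open>Just below 1, so that the loss \<open>c powr (- \<alpha>)\<close> keeps the
      limit under u; \<open>max b 0\<close> makes c positive. What is left of 1 is split into two
      shares \<delta>, one for the other early terms and one for the remainder.\<close>
    define c where "c = (max b 0 + 1) / 2"
    have c: "0 < c" "c < 1" "?L * c powr (- \<alpha>) < u" using b by (auto simp: c_def)
    define \<delta> where "\<delta> = (1 - c) / 2"
    define \<epsilon> where "\<epsilon> = u - ?L * c powr (- \<alpha>)"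
    have \<delta>: "\<delta> > 0" "c + 2 * \<delta> = 1" and \<epsilon>: "\<epsilon> > 0" using c by (simp_all add: \<delta>_def \<epsilon>_def field_simps)
    obtain r N where r: "0 < r" "r < 1"
      and N: "\<forall>\<^sub>F x in at_top. \<P>(\<omega> in M. \<exists>n\<ge>N. Z n \<omega> > \<delta> * (1 - r) * r ^ n * x) \<le> \<epsilon> / 2 * H x"
      using remainder_negligible[OF \<delta>(1), of "\<epsilon> / 2"] \<epsilon> by auto
    \<comment> \<open>For N = 0 the double sum is empty; the value 1 only keeps d positive, where
      \<open>\<delta> / N\<close> would be 0.\<close>
    define d where "d = (if N = 0 then 1 else \<delta> / N)"
    have d: "d > 0" using \<delta> by (simp add: d_def)
    let ?f = "\<lambda>x. (\<Sum>n<N. \<P>(\<omega> in M. Z n \<omega> > c * x) / H x) + (\<Sum>n<N. \<Sum>m<n. \<P>(\<omega> in M. Z m \<omega> > d * x \<and> Z n \<omega> > d * x) / H x)"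
    have "(?f \<longlongrightarrow> (\<Sum>n<N. \<rho> \<alpha> ^ n * c powr (- \<alpha>)) + (\<Sum>n<N. \<Sum>m<n. 0)) at_top"
      using c d by (intro tendsto_add tendsto_sum Z_tail_limit Z_joint_tail_limit) auto
    moreover have "(\<Sum>n<N. \<rho> \<alpha> ^ n * c powr (- \<alpha>)) + (\<Sum>n<N. \<Sum>m<n. 0) < u - \<epsilon> / 2"
    proof -
      have "(\<Sum>n<N. \<rho> \<alpha> ^ n) \<le> ?L"
        using sum_le_suminf[OF sums_summable[OF geo], of "{..<N}"] \<rho> sums_unique[OF geo] by simp
      then have "(\<Sum>n<N. \<rho> \<alpha> ^ n * c powr (- \<alpha>)) \<le> ?L * c powr (- \<alpha>)"
        by (simp add: sum_distrib_right[symmetric] mult_right_mono del: times_divide_eq_left)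
      moreover have "(\<Sum>n<N. \<Sum>m<n. 0 :: real) = 0" by simp
      ultimately show ?thesis using \<epsilon> unfolding \<epsilon>_def by argo
    qed
    ultimately have "\<forall>\<^sub>F x in at_top. ?f x < u - \<epsilon> / 2" by (rule order_tendstoD(2))
    then show "\<forall>\<^sub>F x in at_top. \<P>(\<omega> in M. S \<omega> > x) / H x < u"
      using N eventually_gt_at_top[of 0]
    proof eventually_elim
      case (elim x)
      let ?B = "\<lambda>n. {\<omega>\<in>space M. Z n \<omega> > c * x}"
      let ?C = "\<lambda>m n. {\<omega>\<in>space M. Z m \<omega> > d * x \<and> Z n \<omega> > d * x}"
      let ?R = "{\<omega>\<in>space M. \<exists>n\<ge>N. Z n \<omega> > \<delta> * (1 - r) * r ^ n * x}"
      have "\<P>(\<omega> in M. S \<omega> > x) \<le> prob ((\<Union>n<N. ?B n) \<union> (\<Union>n<N. \<Union>m<n. ?C m n) \<union> ?R)"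
      proof (rule finite_measure_mono_AE)
        show "AE \<omega> in M. \<omega> \<in> {\<omega>\<in>space M. S \<omega> > x} \<longrightarrow> \<omega> \<in> (\<Union>n<N. ?B n) \<union> (\<Union>n<N. \<Union>m<n. ?C m n) \<union> ?R"
          using sand AE_space
        proof eventually_elim
          case (elim \<omega>)
          show ?case
          proof
            assume "\<omega> \<in> {\<omega>\<in>space M. S \<omega> > x}"
            then have "x < (\<Sum>n. Z n \<omega>)" using elim by auto
            with single_big_jump[of "\<lambda>n. Z n \<omega>" x c \<delta> r N] elim Z_nonneg c \<delta> r \<open>0 < x\<close>
            have "(\<exists>n<N. Z n \<omega> > c * x) \<or> (\<exists>n<N. \<exists>m<n. Z m \<omega> > \<delta> / N * x \<and> Z n \<omega> > \<delta> / N * x) \<or>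
                (\<exists>n\<ge>N. Z n \<omega> > \<delta> * (1 - r) * r ^ n * x)" by auto
            then show "\<omega> \<in> (\<Union>n<N. ?B n) \<union> (\<Union>n<N. \<Union>m<n. ?C m n) \<union> ?R"
              using elim by (auto simp: d_def)
          qed
        qed
      qed simp
      also have "\<dots> \<le> prob (\<Union>n<N. ?B n) + prob (\<Union>n<N. \<Union>m<n. ?C m n) + prob ?R"
        by (intro order.trans[OF measure_Un_le] add_mono order.refl measure_Un_le) auto
      also have "\<dots> \<le> (\<Sum>n<N. prob (?B n)) + (\<Sum>n<N. \<Sum>m<n. prob (?C m n)) + \<epsilon> / 2 * H x"
        using elim
        by (intro add_mono measure_UNION_le order.trans[OF measure_UNION_le] sum_mono) auto
      finally have "\<P>(\<omega> in M. S \<omega> > x) / H x \<le> ((\<Sum>n<N. prob (?B n)) + (\<Sum>n<N. \<Sum>m<n. prob (?C m n)) + \<epsilon> / 2 * H x) / H x"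
        using H_pos[of x] by (intro divide_right_mono) auto
      also have "\<dots> = ?f x + \<epsilon> / 2"
        using H_pos[of x] by (simp add: add_divide_distrib sum_divide_distrib)
      finally show ?case using elim by linarith
    qed
  }
qed

end

section \<open>Breiman's lemma for dependent factors\<close>

text \<open>For s >= 0, the least multiple of 1/(n+1) strictly above s. It has countably many
  values, all positive and rational, and approaches s from the right. It discretises random levels
  here and evaluates right-continuous paths later.\<close>

definition right_grid :: "nat \<Rightarrow> real \<Rightarrow> real" where
  "right_grid n s = (real (nat \<lfloor>real (Suc n) * s\<rfloor>) + 1) / real (Suc n)"

lemma right_grid_bounds:
  assumes "0 \<le> s"
  shows "s < right_grid n s" "right_grid n s \<le> s + 1 / Suc n"
proof -
  have "real (nat \<lfloor>real (Suc n) * s\<rfloor>) = of_int \<lfloor>real (Suc n) * s\<rfloor>" using assms by simp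
  moreover have "of_int \<lfloor>real (Suc n) * s\<rfloor> \<le> real (Suc n) * s" "real (Suc n) * s < of_int \<lfloor>real (Suc n) * s\<rfloor> + 1" by linarith+
  ultimately show "s < right_grid n s" "right_grid n s \<le> s + 1 / Suc n"
    by (simp_all add: right_grid_def field_simps del: of_nat_Suc)
qed

lemma right_grid_pos: "0 < right_grid n s"
  by (simp add: right_grid_def add_pos_pos add_nonneg_pos)

lemma right_grid_tendsto:
  assumes "0 \<le> s"
  shows "(\<lambda>n. right_grid n s) \<longlonglongrightarrow> s" "filterlim (\<lambda>n. right_grid n s) (at_right s) sequentially"
proof -
  show *: "(\<lambda>n. right_grid n s) \<longlonglongrightarrow> s"
  proof (rule tendsto_sandwich[of "\<lambda>_. s" _ _ "\<lambda>n. s + 1 / Suc n"])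
    show "(\<lambda>n. s + 1 / Suc n) \<longlonglongrightarrow> s"
      using tendsto_add[OF tendsto_const LIMSEQ_inverse_real_of_nat, of s] by (simp add: inverse_eq_divide)
  qed (use right_grid_bounds[OF assms] in \<open>auto intro!: always_eventually intro: less_imp_le\<close>)
  show "filterlim (\<lambda>n. right_grid n s) (at_right s) sequentially"
    using * right_grid_bounds[OF assms]
    by (intro tendsto_imp_filterlim_at_right) (auto intro!: always_eventually)
qed

context prob_space begin

text \<open>One \<open>e\<close> and one threshold \<open>x1\<close> serve all Borel sets B at once.
  This uniformity is what allows the fixed level t to be replaced by a level that depends on
  \<open>Y\<close>.\<close>

definition tail_factorization :: "('a \<Rightarrow> real) \<Rightarrow> ('a \<Rightarrow> real) \<Rightarrow> (real \<Rightarrow> real) \<Rightarrow> real \<Rightarrow> real \<Rightarrow> bool" where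
  "tail_factorization V Y k e x1 \<longleftrightarrow> (\<forall>t\<ge>x1. \<forall>B\<in>sets borel.
     (1 - e) * (\<P>(\<omega> in M. V \<omega> > t) * (\<integral>\<omega>. indicator B (Y \<omega>) * k (Y \<omega>) \<partial>M)) \<le> \<P>(\<omega> in M. V \<omega> > t \<and> Y \<omega> \<in> B) \<and>
     \<P>(\<omega> in M. V \<omega> > t \<and> Y \<omega> \<in> B) \<le> (1 + e) * (\<P>(\<omega> in M. V \<omega> > t) * (\<integral>\<omega>. indicator B (Y \<omega>) * k (Y \<omega>) \<partial>M)))"

context
  fixes V Y :: "'a \<Rightarrow> real" and k :: "real \<Rightarrow> real" and F :: "real \<Rightarrow> real"
  assumes V[measurable]: "V \<in> borel_measurable M" and Y[measurable]: "Y \<in> borel_measurable M"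
    and k[measurable]: "k \<in> borel_measurable borel" and k_nonneg: "\<And>y. 0 \<le> k y"
    and k_int: "integrable M (\<lambda>\<omega>. k (Y \<omega>))"
    and F: "\<And>x. F x = \<P>(\<omega> in M. V \<omega> > x)"
begin

lemma survival_measurable: "F \<in> borel_measurable borel"
proof -
  have "mono (\<lambda>x. - F x)" unfolding F by (auto intro!: monoI finite_measure_mono)
  from borel_measurable_uminus[OF borel_measurable_mono[OF this]] show ?thesis by simp
qed

lemma survival_bounds: "0 \<le> F x" "F x \<le> 1" unfolding F by auto

lemma survival_integrable:
  assumes "\<tau> \<in> borel_measurable borel" "B \<in> sets borel"
  shows "integrable M (\<lambda>\<omega>. indicator B (Y \<omega>) * F (\<tau> (Y \<omega>)) * k (Y \<omega>))"
proof (rule Bochner_Integration.integrable_bound[OF k_int])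
  note [measurable] = assms survival_measurable
  show "(\<lambda>\<omega>. indicator B (Y \<omega>) * F (\<tau> (Y \<omega>)) * k (Y \<omega>)) \<in> borel_measurable M" by measurable
  show "AE \<omega> in M. norm (indicator B (Y \<omega>) * F (\<tau> (Y \<omega>)) * k (Y \<omega>)) \<le> norm (k (Y \<omega>))"
    using survival_bounds k_nonneg by (auto simp: indicator_def abs_mult intro!: mult_left_le_one_le)
qed

lemma countable_level_expansion:
  fixes g :: "nat \<Rightarrow> real" and j :: "real \<Rightarrow> nat"
  assumes j: "j \<in> borel \<rightarrow>\<^sub>M count_space UNIV" and B: "B \<in> sets borel"
  shows "emeasure M {\<omega>\<in>space M. V \<omega> > g (j (Y \<omega>)) \<and> Y \<omega> \<in> B} =
      (\<Sum>i. emeasure M {\<omega>\<in>space M. V \<omega> > g i \<and> Y \<omega> \<in> B \<inter> j -` {i}})" (is ?A)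
    and "(\<integral>\<^sup>+\<omega>. ennreal (indicator B (Y \<omega>) * F (g (j (Y \<omega>))) * k (Y \<omega>)) \<partial>M) =
      (\<Sum>i. ennreal (F (g i) * (\<integral>\<omega>. indicator (B \<inter> j -` {i}) (Y \<omega>) * k (Y \<omega>) \<partial>M)))" (is ?B)
proof -
  note [measurable] = survival_measurable
  note [measurable] = j B
  have jm[measurable]: "j -` {i} \<in> sets borel" for i
    using measurable_sets[OF j, of "{i}"] by simp
  have eq: "{\<omega>\<in>space M. V \<omega> > g (j (Y \<omega>)) \<and> Y \<omega> \<in> B} = (\<Union>i. {\<omega>\<in>space M. V \<omega> > g i \<and> Y \<omega> \<in> B \<inter> j -` {i}})"
    by auto
  show ?A unfolding eq
    by (rule suminf_emeasure[symmetric]) (auto simp: disjoint_family_on_def image_subset_iff)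
  have i: "integrable M (\<lambda>\<omega>. indicator (B \<inter> j -` {i}) (Y \<omega>) * k (Y \<omega>))" for i
    by (rule Bochner_Integration.integrable_bound[OF k_int]) (auto simp: indicator_def)
  have "(\<integral>\<^sup>+\<omega>. ennreal (indicator B (Y \<omega>) * F (g (j (Y \<omega>))) * k (Y \<omega>)) \<partial>M)
     = (\<integral>\<^sup>+\<omega>. (\<Sum>i. ennreal (F (g i) * (indicator (B \<inter> j -` {i}) (Y \<omega>) * k (Y \<omega>)))) \<partial>M)"
  proof (intro nn_integral_cong)
    fix \<omega>
    have "(\<lambda>i. ennreal (F (g i) * (indicator (B \<inter> j -` {i}) (Y \<omega>) * k (Y \<omega>)))) sums
        (\<Sum>i\<in>{j (Y \<omega>)}. ennreal (F (g i) * (indicator (B \<inter> j -` {i}) (Y \<omega>) * k (Y \<omega>))))"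
      by (rule sums_finite) (auto simp: indicator_def)
    then show "ennreal (indicator B (Y \<omega>) * F (g (j (Y \<omega>))) * k (Y \<omega>)) = (\<Sum>i. ennreal (F (g i) * (indicator (B \<inter> j -` {i}) (Y \<omega>) * k (Y \<omega>))))"
      by (simp add: sums_iff indicator_def)
  qed
  also have "\<dots> = (\<Sum>i. \<integral>\<^sup>+\<omega>. ennreal (F (g i) * (indicator (B \<inter> j -` {i}) (Y \<omega>) * k (Y \<omega>))) \<partial>M)"
    by (rule nn_integral_suminf) measurable
  also have "(\<lambda>i. \<integral>\<^sup>+\<omega>. ennreal (F (g i) * (indicator (B \<inter> j -` {i}) (Y \<omega>) * k (Y \<omega>))) \<partial>M)
    = (\<lambda>i. ennreal (F (g i) * (\<integral>\<omega>. indicator (B \<inter> j -` {i}) (Y \<omega>) * k (Y \<omega>) \<partial>M)))"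
  proof
    fix n
    show "(\<integral>\<^sup>+\<omega>. ennreal (F (g n) * (indicator (B \<inter> j -` {n}) (Y \<omega>) * k (Y \<omega>))) \<partial>M)
      = ennreal (F (g n) * (\<integral>\<omega>. indicator (B \<inter> j -` {n}) (Y \<omega>) * k (Y \<omega>) \<partial>M))"
      using i[of n] survival_bounds k_nonneg
      by (subst nn_integral_eq_integral) (auto simp: indicator_def)
  qed
  finally show ?B .
qed

text \<open>Since the grid levels decrease to the true level strictly from above, the indicators of
  exceedance converge at every value of \<open>V\<close>, including the level itself; atoms of
  \<open>V\<close> do no harm.\<close>

lemma survival_limit:
  fixes \<tau> :: "real \<Rightarrow> real"
  assumes \<tau>: "\<tau> \<in> borel_measurable borel" "\<And>y. y \<in> B \<Longrightarrow> 0 \<le> \<tau> y" and B: "B \<in> sets borel"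
  shows "(\<lambda>n. \<P>(\<omega> in M. V \<omega> > right_grid n (\<tau> (Y \<omega>)) \<and> Y \<omega> \<in> B)) \<longlonglongrightarrow> \<P>(\<omega> in M. V \<omega> > \<tau> (Y \<omega>) \<and> Y \<omega> \<in> B)" (is ?A)
    and "(\<lambda>n. \<integral>\<omega>. indicator B (Y \<omega>) * F (right_grid n (\<tau> (Y \<omega>))) * k (Y \<omega>) \<partial>M) \<longlonglongrightarrow>
      (\<integral>\<omega>. indicator B (Y \<omega>) * F (\<tau> (Y \<omega>)) * k (Y \<omega>) \<partial>M)" (is ?B)
proof -
  note [measurable] = survival_measurable \<tau>(1) B
  define d where "d n y = right_grid n (\<tau> y)" for n y
  have d_meas[measurable]: "d n \<in> borel_measurable borel" for n unfolding d_def right_grid_def by measurable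
  note d_bounds = right_grid_bounds(1)[OF \<tau>(2), folded d_def]
  note d_lim = right_grid_tendsto(1)[OF \<tau>(2), folded d_def]
  have ind_lim: "(\<lambda>n. indicator {v. v > d n y} v :: real) \<longlonglongrightarrow> indicator {v. v > \<tau> y} v" if "y \<in> B" for y v
  proof (cases "v > \<tau> y")
    case True
    have "\<forall>\<^sub>F n in sequentially. d n y < v" using order_tendstoD(2)[OF d_lim[OF that] True] .
    then show ?thesis using True by (intro tendsto_eventually) (auto elim: eventually_mono)
  next
    case False
    then have "\<not> d n y < v" for n using d_bounds[OF that, of n] by linarith
    then show ?thesis using False by simp
  qed
  have "(\<lambda>n. \<integral>\<omega>. indicator B (Y \<omega>) * indicator {v. v > d n (Y \<omega>)} (V \<omega>) \<partial>M) \<longlonglongrightarrow>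
      (\<integral>\<omega>. indicator B (Y \<omega>) * indicator {v. v > \<tau> (Y \<omega>)} (V \<omega>) \<partial>M :: real)"
  proof (rule integral_dominated_convergence[where w="\<lambda>_. 1"])
    show "AE \<omega> in M. (\<lambda>n. indicator B (Y \<omega>) * indicator {v. v > d n (Y \<omega>)} (V \<omega>) :: real) \<longlonglongrightarrow> indicator B (Y \<omega>) * indicator {v. v > \<tau> (Y \<omega>)} (V \<omega>)"
    proof (intro AE_I2)
      fix \<omega>
      show "(\<lambda>n. indicator B (Y \<omega>) * indicator {v. v > d n (Y \<omega>)} (V \<omega>) :: real) \<longlonglongrightarrow> indicator B (Y \<omega>) * indicator {v. v > \<tau> (Y \<omega>)} (V \<omega>)"
        by (cases "Y \<omega> \<in> B") (auto intro!: tendsto_mult ind_lim)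
    qed
    show "(\<lambda>\<omega>. indicator B (Y \<omega>) * indicator {v. v > \<tau> (Y \<omega>)} (V \<omega>) :: real) \<in> borel_measurable M"
      unfolding indicator_def by measurable
    show "(\<lambda>\<omega>. indicator B (Y \<omega>) * indicator {v. v > d n (Y \<omega>)} (V \<omega>) :: real) \<in> borel_measurable M" for n
      unfolding indicator_def by measurable
  qed (auto simp: indicator_def)
  moreover have "(\<integral>\<omega>. indicator B (Y \<omega>) * indicator {v. v > f (Y \<omega>)} (V \<omega>) \<partial>M) = \<P>(\<omega> in M. V \<omega> > f (Y \<omega>) \<and> Y \<omega> \<in> B)"
    if "f \<in> borel_measurable borel" for f
  proof -
    note [measurable] = that
    have "(\<integral>\<omega>. indicator B (Y \<omega>) * indicator {v. v > f (Y \<omega>)} (V \<omega>) \<partial>M) =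
        (\<integral>\<omega>. indicator {\<omega>\<in>space M. V \<omega> > f (Y \<omega>) \<and> Y \<omega> \<in> B} \<omega> \<partial>M :: real)"
      by (intro Bochner_Integration.integral_cong) (auto simp: indicator_def)
    then show ?thesis by simp
  qed
  ultimately show ?A unfolding d_def[symmetric] using \<tau> d_meas by simp
  have F_lim: "(\<lambda>n. F (d n y)) \<longlonglongrightarrow> F (\<tau> y)" if "y \<in> B" for y
  proof -
    have "(\<lambda>n. \<integral>\<omega>. indicator {v. v > d n y} (V \<omega>) \<partial>M) \<longlonglongrightarrow> (\<integral>\<omega>. indicator {v. v > \<tau> y} (V \<omega>) \<partial>M :: real)"
    proof (rule integral_dominated_convergence[where w="\<lambda>_. 1"])
      show "AE \<omega> in M. (\<lambda>n. indicator {v. v > d n y} (V \<omega>)) \<longlonglongrightarrow> (indicator {v. v > \<tau> y} (V \<omega>) :: real)"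
        using that by (intro AE_I2 ind_lim)
    qed (auto simp: indicator_def)
    moreover have "(\<integral>\<omega>. indicator {v. v > x} (V \<omega>) \<partial>M) = F x" for x
    proof -
      have "(\<integral>\<omega>. indicator {v. v > x} (V \<omega>) \<partial>M) = (\<integral>\<omega>. indicator {\<omega>\<in>space M. V \<omega> > x} \<omega> \<partial>M :: real)"
        by (intro Bochner_Integration.integral_cong) (auto simp: indicator_def)
      then show ?thesis by (simp add: F)
    qed
    ultimately show ?thesis by simp
  qed
  show ?B unfolding d_def[symmetric]
  proof (rule integral_dominated_convergence[where w="\<lambda>\<omega>. k (Y \<omega>)"])
    show "AE \<omega> in M. (\<lambda>n. indicator B (Y \<omega>) * F (d n (Y \<omega>)) * k (Y \<omega>)) \<longlonglongrightarrow> indicator B (Y \<omega>) * F (\<tau> (Y \<omega>)) * k (Y \<omega>)"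
    proof (intro AE_I2)
      fix \<omega> show "(\<lambda>n. indicator B (Y \<omega>) * F (d n (Y \<omega>)) * k (Y \<omega>)) \<longlonglongrightarrow> indicator B (Y \<omega>) * F (\<tau> (Y \<omega>)) * k (Y \<omega>)"
        by (cases "Y \<omega> \<in> B") (auto intro!: tendsto_mult F_lim)
    qed
    show "AE \<omega> in M. norm (indicator B (Y \<omega>) * F (d n (Y \<omega>)) * k (Y \<omega>)) \<le> k (Y \<omega>)" for n
      using survival_bounds k_nonneg by (auto simp: indicator_def abs_mult intro!: mult_left_le_one_le)
  qed (auto intro!: k_int)
qed

text \<open>On the grid the level takes countably many values. Each cell of constant level is
  handled by \<open>tail_factorization\<close>, the factors 1 - e and 1 + e are common to all cells,
  so the bounds add up, and the grid is then refined.\<close>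

lemma random_level_bounds:
  assumes fac: "tail_factorization V Y k e x1" and e: "0 \<le> e" "e \<le> 1" and x1: "0 \<le> x1"
    and \<tau>: "\<tau> \<in> borel_measurable borel" "\<And>y. y \<in> B \<Longrightarrow> x1 \<le> \<tau> y" and B: "B \<in> sets borel"
  defines "J \<equiv> \<integral>\<omega>. indicator B (Y \<omega>) * F (\<tau> (Y \<omega>)) * k (Y \<omega>) \<partial>M"
  shows "(1 - e) * J \<le> \<P>(\<omega> in M. V \<omega> > \<tau> (Y \<omega>) \<and> Y \<omega> \<in> B)"
    and "\<P>(\<omega> in M. V \<omega> > \<tau> (Y \<omega>) \<and> Y \<omega> \<in> B) \<le> (1 + e) * J"
proof -
  note [measurable] = survival_measurable \<tau>(1) B
  define j where "j n y = nat \<lfloor>real (Suc n) * \<tau> y\<rfloor>" for n y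
  define g where "g n i = (real i + 1) / Suc n" for n i
  have j[measurable]: "j n \<in> borel \<rightarrow>\<^sub>M count_space UNIV" for n unfolding j_def by measurable
  have jm[measurable]: "j n -` {i} \<in> sets borel" for n i
    using measurable_sets[OF j, of "{i}"] by simp
  have grid: "right_grid n (\<tau> y) = g n (j n y)" for n y by (simp add: right_grid_def g_def j_def)
  have nn: "0 \<le> \<tau> y" if "y \<in> B" for y using \<tau>(2)[OF that] x1 by simp
  note lims = survival_limit[OF \<tau>(1) nn B, unfolded grid, folded J_def]
  have g_ge: "x1 \<le> g n i" if "y \<in> B" "j n y = i" for n i y
    using right_grid_bounds(1)[OF nn[OF that(1)], of n] \<tau>(2)[OF that(1)] that grid[of n y] by simp
  define p where "p n = \<P>(\<omega> in M. V \<omega> > g n (j n (Y \<omega>)) \<and> Y \<omega> \<in> B)" for n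
  define q where "q n = (\<integral>\<omega>. indicator B (Y \<omega>) * F (g n (j n (Y \<omega>))) * k (Y \<omega>) \<partial>M)" for n
  have step: "(1 - e) * q n \<le> p n \<and> p n \<le> (1 + e) * q n" for n
  proof -
    define a where "a i = emeasure M {\<omega>\<in>space M. V \<omega> > g n i \<and> Y \<omega> \<in> B \<inter> j n -` {i}}" for i
    define b where "b i = ennreal (F (g n i) * (\<integral>\<omega>. indicator (B \<inter> j n -` {i}) (Y \<omega>) * k (Y \<omega>) \<partial>M))" for i
    have q0: "0 \<le> q n" unfolding q_def using survival_bounds k_nonneg by (intro integral_nonneg_AE) auto
    have pa: "ennreal (p n) = (\<Sum>i. a i)"
      using countable_level_expansion(1)[OF j B, of "g n" n] by (simp add: p_def a_def emeasure_eq_measure)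
    have "ennreal (q n) = (\<integral>\<^sup>+\<omega>. ennreal (indicator B (Y \<omega>) * F (g n (j n (Y \<omega>))) * k (Y \<omega>)) \<partial>M)"
      unfolding q_def using survival_integrable[of "\<lambda>y. g n (j n y)" B] B survival_bounds k_nonneg
      by (intro nn_integral_eq_integral[symmetric]) auto
    also have "\<dots> = (\<Sum>i. b i)" unfolding b_def by (rule countable_level_expansion(2)[OF j B])
    finally have qb: "ennreal (q n) = (\<Sum>i. b i)" .
    have le: "ennreal (1 - e) * b i \<le> a i \<and> a i \<le> ennreal (1 + e) * b i" for i
    \<comment> \<open>An empty cell may belong to a level below \<open>x1\<close>, where the
      factorization says nothing; there both sides vanish.\<close>
    proof (cases "B \<inter> j n -` {i} = {}")
      case False
      then have "x1 \<le> g n i" using g_ge by auto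
      moreover have "B \<inter> j n -` {i} \<in> sets borel" by simp
      ultimately have "(1 - e) * (F (g n i) * (\<integral>\<omega>. indicator (B \<inter> j n -` {i}) (Y \<omega>) * k (Y \<omega>) \<partial>M))
            \<le> \<P>(\<omega> in M. V \<omega> > g n i \<and> Y \<omega> \<in> B \<inter> j n -` {i}) \<and>
          \<P>(\<omega> in M. V \<omega> > g n i \<and> Y \<omega> \<in> B \<inter> j n -` {i})
            \<le> (1 + e) * (F (g n i) * (\<integral>\<omega>. indicator (B \<inter> j n -` {i}) (Y \<omega>) * k (Y \<omega>) \<partial>M))"
        using fac unfolding tail_factorization_def F[symmetric] by blast
      then show ?thesis
        using e unfolding a_def b_def emeasure_eq_measure
        by (subst (1 2) ennreal_mult'[symmetric]) (auto intro!: ennreal_leI)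
    qed (simp add: a_def b_def)
    have "(\<Sum>i. ennreal (1 - e) * b i) \<le> (\<Sum>i. a i)" "(\<Sum>i. a i) \<le> (\<Sum>i. ennreal (1 + e) * b i)"
      using le by (intro suminf_le summableI, blast)+
    then have "ennreal ((1 - e) * q n) \<le> ennreal (p n)" "ennreal (p n) \<le> ennreal ((1 + e) * q n)"
      using e q0 by (simp_all add: pa[symmetric] qb[symmetric] ennreal_mult)
    then show ?thesis using e q0 by (simp add: p_def)
  qed
  have lp: "p \<longlonglongrightarrow> \<P>(\<omega> in M. V \<omega> > \<tau> (Y \<omega>) \<and> Y \<omega> \<in> B)" unfolding p_def by (rule lims(1))
  have lq: "(\<lambda>n. c * q n) \<longlonglongrightarrow> c * J" for c
    unfolding q_def by (intro tendsto_mult tendsto_const lims(2))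
  show "(1 - e) * J \<le> \<P>(\<omega> in M. V \<omega> > \<tau> (Y \<omega>) \<and> Y \<omega> \<in> B)"
    by (rule LIMSEQ_le[OF lq lp]) (use step in auto)
  show "\<P>(\<omega> in M. V \<omega> > \<tau> (Y \<omega>) \<and> Y \<omega> \<in> B) \<le> (1 + e) * J"
    by (rule LIMSEQ_le[OF lp lq]) (use step in auto)
qed

end

text \<open>Splitting at \<open>Y = x / x1\<close> makes the random level \<open>x / Y\<close> at
  least \<open>x1\<close> on the main part, where \<open>random_level_bounds\<close> turns the
  dependent pair into an integral over \<open>Y\<close> alone. Its limit follows from Potter's
  bounds; the rest is a large value of \<open>Y\<close>, which is too rare to matter.\<close>

theorem breiman_dependent:
  fixes V Y :: "'a \<Rightarrow> real" and k F :: "real \<Rightarrow> real"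
  assumes V[measurable]: "V \<in> borel_measurable M" and Y[measurable]: "Y \<in> borel_measurable M"
    and Y_pos: "\<And>\<omega>. \<omega> \<in> space M \<Longrightarrow> 0 < Y \<omega>"
    and k[measurable]: "k \<in> borel_measurable borel" and k_nonneg: "\<And>y. 0 \<le> k y"
    and k_bound: "AE \<omega> in M. k (Y \<omega>) \<le> K"
    and F: "\<And>x. F x = \<P>(\<omega> in M. V \<omega> > x)" and rv: "rv_tail \<alpha> F" and \<alpha>p: "0 < \<alpha>" "\<alpha> < p"
    and moment: "integrable M (\<lambda>\<omega>. Y \<omega> powr p)"
    and cond: "\<And>e. 0 < e \<Longrightarrow> e < 1 \<Longrightarrow> \<exists>x1. tail_factorization V Y k e x1"
  shows "((\<lambda>x. \<P>(\<omega> in M. V \<omega> * Y \<omega> > x) / F x) \<longlongrightarrow> (\<integral>\<omega>. Y \<omega> powr \<alpha> * k (Y \<omega>) \<partial>M)) at_top"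
proof -
  define L where "L = (\<integral>\<omega>. Y \<omega> powr \<alpha> * k (Y \<omega>) \<partial>M)"
  have L: "0 \<le> L" unfolding L_def using k_nonneg by (intro integral_nonneg_AE) auto
  have K: "0 \<le> K"
  proof -
    have "AE \<omega> in M. 0 \<le> K" using k_bound by eventually_elim (use k_nonneg order_trans in blast)
    then show ?thesis by simp
  qed
  have k_int: "integrable M (\<lambda>\<omega>. k (Y \<omega>))"
  proof (rule integrable_const_bound[where B=K])
    show "AE \<omega> in M. norm (k (Y \<omega>)) \<le> K"
      using k_bound by eventually_elim (use k_nonneg in simp)
  qed simp
  note S = survival_measurable[OF V Y k k_nonneg k_int F]
  note [measurable] = S
  have Fpos: "F x > 0" for x using rv_tail_pos[OF rv] .
  obtain C x0 where C: "C > 0" "x0 > 0"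
    "\<And>x w. x \<ge> x0 \<Longrightarrow> w > 0 \<Longrightarrow> F (x / w) \<le> C * F x * (w powr p + w powr (\<alpha>/2))"
    using rv_tail_potter[OF rv, of "\<alpha>/2" p] \<alpha>p by auto
  have moment2: "integrable M (\<lambda>\<omega>. Y \<omega> powr (\<alpha>/2))"
  proof (rule Bochner_Integration.integrable_bound[of M "\<lambda>\<omega>. 1 + Y \<omega> powr p"])
    have "y powr (\<alpha>/2) \<le> 1 + y powr p" if "y > 0" for y :: real
      using that \<alpha>p powr_mono[of "\<alpha>/2" p y] powr_le1[of "\<alpha>/2" y] powr_ge_zero[of y p]
      by (cases "y \<le> 1") linarith+
    then show "AE \<omega> in M. norm (Y \<omega> powr (\<alpha>/2)) \<le> norm (1 + Y \<omega> powr p)"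
      using Y_pos by (intro AE_I2) (simp add: add_nonneg_nonneg)
  qed (use moment in auto)
  define I where "I x1 x = (\<integral>\<omega>. indicator {0<..x / x1} (Y \<omega>) * F (x / Y \<omega>) * k (Y \<omega>) \<partial>M) / F x" for x1 x
  have I_lim: "(I x1 \<longlongrightarrow> L) at_top" if x1: "x1 > 0" for x1
  proof -
    let ?w = "\<lambda>\<omega>. C * K * (Y \<omega> powr p + Y \<omega> powr (\<alpha>/2))"
    have "((\<lambda>x. \<integral>\<omega>. indicator {0<..x / x1} (Y \<omega>) * F (x / Y \<omega>) * k (Y \<omega>) / F x \<partial>M) \<longlongrightarrow> L) at_top"
      unfolding L_def
    proof (rule integral_dominated_convergence_at_top[where w="?w"])
      show "AE \<omega> in M. ((\<lambda>x. indicator {0<..x / x1} (Y \<omega>) * F (x / Y \<omega>) * k (Y \<omega>) / F x) \<longlongrightarrow> Y \<omega> powr \<alpha> * k (Y \<omega>)) at_top"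
      proof (intro AE_I2)
        fix \<omega> assume "\<omega> \<in> space M"
        then have pos: "Y \<omega> > 0" by (rule Y_pos)
        then have "((\<lambda>x. F (1 / Y \<omega> * x) / F x) \<longlongrightarrow> (1 / Y \<omega>) powr (- \<alpha>)) at_top"
          using rv unfolding rv_tail_def by (metis zero_less_divide_1_iff)
        moreover have "(1 / Y \<omega>) powr (- \<alpha>) = Y \<omega> powr \<alpha>"
          using pos by (simp only: powr_divide powr_minus) simp
        ultimately have "((\<lambda>x. F (x / Y \<omega>) / F x * k (Y \<omega>)) \<longlongrightarrow> Y \<omega> powr \<alpha> * k (Y \<omega>)) at_top"
          by (intro tendsto_mult tendsto_const) simp
        moreover have "\<forall>\<^sub>F x in at_top. F (x / Y \<omega>) / F x * k (Y \<omega>) = indicator {0<..x / x1} (Y \<omega>) * F (x / Y \<omega>) * k (Y \<omega>) / F x"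
          using pos x1 by (intro eventually_at_top_linorderI[of "Y \<omega> * x1"]) (auto simp: indicator_def field_simps)
        ultimately show "((\<lambda>x. indicator {0<..x / x1} (Y \<omega>) * F (x / Y \<omega>) * k (Y \<omega>) / F x) \<longlongrightarrow> Y \<omega> powr \<alpha> * k (Y \<omega>)) at_top"
          by (rule Lim_transform_eventually)
      qed
      show "\<forall>\<^sub>F x in at_top. AE \<omega> in M. norm (indicator {0<..x / x1} (Y \<omega>) * F (x / Y \<omega>) * k (Y \<omega>) / F x) \<le> ?w \<omega>"
      proof (rule eventually_at_top_linorderI[of x0])
        fix x assume x: "x0 \<le> x"
        show "AE \<omega> in M. norm (indicator {0<..x / x1} (Y \<omega>) * F (x / Y \<omega>) * k (Y \<omega>) / F x) \<le> ?w \<omega>"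
          using k_bound AE_space
        proof eventually_elim
          case (elim \<omega>)
          have "F (x / Y \<omega>) / F x \<le> C * (Y \<omega> powr p + Y \<omega> powr (\<alpha>/2))"
            using C(3)[OF x Y_pos[OF elim(2)]] Fpos[of x] by (simp add: divide_le_eq mult_ac)
          then have "F (x / Y \<omega>) / F x * k (Y \<omega>) \<le> C * (Y \<omega> powr p + Y \<omega> powr (\<alpha>/2)) * K"
            using elim k_nonneg C(1) by (intro mult_mono) auto
          moreover have "norm (indicator {0<..x / x1} (Y \<omega>) * F (x / Y \<omega>) * k (Y \<omega>) / F x) \<le> F (x / Y \<omega>) / F x * k (Y \<omega>)"
            using Fpos[of x] Fpos[of "x / Y \<omega>"] k_nonneg[of "Y \<omega>"] by (auto simp: indicator_def abs_mult)
          ultimately show ?case by (simp add: mult_ac)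
        qed
      qed
      show "integrable M ?w" using moment moment2 by (intro integrable_mult_right Bochner_Integration.integrable_add)
    qed measurable
    then show ?thesis by (simp add: I_def[abs_def])
  qed
  \<comment> \<open>Markov's inequality with the truncated p-th moment, which tends to 0, gives
    o(x^(-p)); the tail of \<open>V\<close> is at least a constant times x^(-p).\<close>
  have rem: "((\<lambda>x. \<P>(\<omega> in M. Y \<omega> > x / x1) / F x) \<longlongrightarrow> 0) at_top" if x1: "x1 > 0" for x1
  proof -
    obtain c y0 where c: "c > 0" "y0 > 0" "\<And>x. x \<ge> y0 \<Longrightarrow> c * x powr (- p) \<le> F x"
      using rv_tail_polynomial_lower[OF rv \<alpha>p] by metis
    have "((\<lambda>x. \<integral>\<omega>. indicator {x / x1<..} (Y \<omega>) * Y \<omega> powr p \<partial>M) \<longlongrightarrow> (\<integral>\<omega>. 0 \<partial>M)) at_top"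
    proof (rule integral_dominated_convergence_at_top[where w="\<lambda>\<omega>. Y \<omega> powr p"])
      show "AE \<omega> in M. ((\<lambda>x. indicator {x / x1<..} (Y \<omega>) * Y \<omega> powr p) \<longlongrightarrow> 0) at_top"
      proof (intro AE_I2 tendsto_eventually)
        fix \<omega> show "\<forall>\<^sub>F x in at_top. indicator {x / x1<..} (Y \<omega>) * Y \<omega> powr p = 0"
          using x1 by (intro eventually_at_top_linorderI[of "Y \<omega> * x1"]) (auto simp: indicator_def field_simps)
      qed
    qed (use moment in \<open>auto simp: indicator_def\<close>)
    then have lim: "((\<lambda>x. (x1 powr p / c) * (\<integral>\<omega>. indicator {x / x1<..} (Y \<omega>) * Y \<omega> powr p \<partial>M)) \<longlongrightarrow> (x1 powr p / c) * 0) at_top"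
      by (intro tendsto_mult tendsto_const) simp
    show ?thesis
    proof (rule Lim_null_comparison[OF eventually_at_top_linorderI[of y0] lim[unfolded mult_zero_right]])
      fix x assume x: "y0 \<le> x"
      then have xp: "x > 0" using c by simp
      let ?J = "\<integral>\<omega>. indicator {x / x1<..} (Y \<omega>) * Y \<omega> powr p \<partial>M"
      have i: "integrable M (\<lambda>\<omega>. indicator {x / x1<..} (Y \<omega>) * Y \<omega> powr p)"
        by (rule Bochner_Integration.integrable_bound[OF moment]) (auto simp: indicator_def)
      have "\<P>(\<omega> in M. Y \<omega> > x / x1) = (\<integral>\<omega>. indicator {\<omega>\<in>space M. Y \<omega> > x / x1} \<omega> \<partial>M)" by simp
      also have "\<dots> \<le> (\<integral>\<omega>. (x1 / x) powr p * (indicator {x / x1<..} (Y \<omega>) * Y \<omega> powr p) \<partial>M)"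
      proof (rule integral_mono)
        fix \<omega> assume "\<omega> \<in> space M"
        then have "1 \<le> (x1 / x) powr p * Y \<omega> powr p" if "Y \<omega> > x / x1"
          using that xp x1 \<alpha>p Y_pos[of \<omega>] by (subst powr_mult[symmetric]) (auto intro!: ge_one_powr_ge_zero simp: field_simps)
        then show "indicator {\<omega>\<in>space M. Y \<omega> > x / x1} \<omega> \<le> (x1 / x) powr p * (indicator {x / x1<..} (Y \<omega>) * Y \<omega> powr p)"
          by (auto simp: indicator_def)
      qed (use i in \<open>auto intro!: integrable_real_indicator simp: emeasure_eq_measure\<close>)
      also have "\<dots> = x1 powr p * x powr (- p) * ?J"
        using x1 xp by (simp add: powr_divide powr_minus_divide)
      finally have 1: "\<P>(\<omega> in M. Y \<omega> > x / x1) \<le> x1 powr p * x powr (- p) * ?J" .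
      have J: "0 \<le> ?J" by (intro integral_nonneg_AE) auto
      have "c * \<P>(\<omega> in M. Y \<omega> > x / x1) \<le> (c * x powr (- p)) * (x1 powr p * ?J)"
        using mult_left_mono[OF 1, of c] c by (simp add: mult_ac)
      also have "\<dots> \<le> F x * (x1 powr p * ?J)"
        using c(3)[OF x] J by (intro mult_right_mono) auto
      finally have "\<P>(\<omega> in M. Y \<omega> > x / x1) / F x \<le> x1 powr p / c * ?J"
        using c Fpos[of x] by (simp add: field_simps)
      then show "norm (\<P>(\<omega> in M. Y \<omega> > x / x1) / F x) \<le> x1 powr p / c * ?J"
        using Fpos[of x] by simp
    qed
  qed
  have low: "\<forall>\<^sub>F x in at_top. (1 - e) * I x1 x \<le> \<P>(\<omega> in M. V \<omega> * Y \<omega> > x) / F x"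
    and up: "\<forall>\<^sub>F x in at_top. \<P>(\<omega> in M. V \<omega> * Y \<omega> > x) / F x \<le> (1 + e) * I x1 x + \<P>(\<omega> in M. Y \<omega> > x / x1) / F x"
    if x1: "x1 > 0" and e: "0 < e" "e < 1" and near: "tail_factorization V Y k e x1" for x1 e
  proof -
    have A: "(1 - e) * (I x1 x * F x) \<le> \<P>(\<omega> in M. V \<omega> * Y \<omega> > x) \<and>
        \<P>(\<omega> in M. V \<omega> * Y \<omega> > x) \<le> (1 + e) * (I x1 x * F x) + \<P>(\<omega> in M. Y \<omega> > x / x1)" if x: "0 < x" for x
    proof -
      let ?B = "{0<..x / x1}"
      have \<tau>: "x1 \<le> x / y" if "y \<in> ?B" for y using that x1 x by (simp add: field_simps)
      have "(1 - e) * (I x1 x * F x) \<le> \<P>(\<omega> in M. V \<omega> > x / Y \<omega> \<and> Y \<omega> \<in> ?B)"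
        using random_level_bounds(1)[OF V Y k k_nonneg k_int F near, of "\<lambda>y. x / y" ?B] \<tau> e x1 Fpos[of x]
        by (simp add: I_def)
      also have "\<dots> \<le> \<P>(\<omega> in M. V \<omega> * Y \<omega> > x)"
        by (intro finite_measure_mono) (auto simp: field_simps)
      finally have 1: "(1 - e) * (I x1 x * F x) \<le> \<P>(\<omega> in M. V \<omega> * Y \<omega> > x)" .
      have "\<P>(\<omega> in M. V \<omega> * Y \<omega> > x) \<le> prob ({\<omega>\<in>space M. V \<omega> > x / Y \<omega> \<and> Y \<omega> \<in> ?B} \<union> {\<omega>\<in>space M. Y \<omega> > x / x1})"
        using Y_pos by (intro finite_measure_mono) (auto simp: field_simps)
      also have "\<dots> \<le> \<P>(\<omega> in M. V \<omega> > x / Y \<omega> \<and> Y \<omega> \<in> ?B) + \<P>(\<omega> in M. Y \<omega> > x / x1)"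
        by (intro measure_Un_le) auto
      also have "\<P>(\<omega> in M. V \<omega> > x / Y \<omega> \<and> Y \<omega> \<in> ?B) \<le> (1 + e) * (I x1 x * F x)"
        using random_level_bounds(2)[OF V Y k k_nonneg k_int F near, of "\<lambda>y. x / y" ?B] \<tau> e x1 Fpos[of x]
        by (simp add: I_def)
      finally show ?thesis using 1 by simp
    qed
    have A': "(1 - e) * I x1 x \<le> \<P>(\<omega> in M. V \<omega> * Y \<omega> > x) / F x \<and>
        \<P>(\<omega> in M. V \<omega> * Y \<omega> > x) / F x \<le> (1 + e) * I x1 x + \<P>(\<omega> in M. Y \<omega> > x / x1) / F x" if x: "0 < x" for x
      using A[OF x] Fpos[of x] by (simp add: pos_le_divide_eq pos_divide_le_eq distrib_right mult.assoc)
    show "\<forall>\<^sub>F x in at_top. (1 - e) * I x1 x \<le> \<P>(\<omega> in M. V \<omega> * Y \<omega> > x) / F x"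
      using eventually_gt_at_top[of 0] by eventually_elim (use A' in blast)
    show "\<forall>\<^sub>F x in at_top. \<P>(\<omega> in M. V \<omega> * Y \<omega> > x) / F x \<le> (1 + e) * I x1 x + \<P>(\<omega> in M. Y \<omega> > x / x1) / F x"
      using eventually_gt_at_top[of 0] by eventually_elim (use A' in blast)
  qed
  have cond': "\<exists>x1>0. tail_factorization V Y k e x1" if e: "0 < e" "e < 1" for e
  proof -
    from cond[OF e] obtain x1 where "tail_factorization V Y k e x1" ..
    then have "tail_factorization V Y k e (max x1 1)" unfolding tail_factorization_def by simp
    then show ?thesis by (intro exI[of _ "max x1 1"]) simp
  qed
  show ?thesis unfolding L_def[symmetric]
  proof (rule order_tendstoI)
    fix l assume l: "l < L"
    \<comment> \<open>Makes \<open>e * L\<close> at most half the gap between l and L;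
      \<open>L + 1\<close> in the denominator covers L = 0.\<close>
    define e where "e = min (1/2) ((L - l) / (2 * (L + 1)))"
    have e: "0 < e" "e < 1" using l L by (auto simp: e_def)
    have "e * L \<le> (L - l) / (2 * (L + 1)) * L" using L by (intro mult_right_mono) (auto simp: e_def)
    also have "\<dots> \<le> (L - l) / 2" using l L by (simp add: field_simps mult_left_mono)
    finally have el: "l < (1 - e) * L" using l by (simp add: algebra_simps)
    obtain x1 where x1: "x1 > 0" "tail_factorization V Y k e x1" using cond'[OF e] by blast
    have t: "((\<lambda>x. (1 - e) * I x1 x) \<longlongrightarrow> (1 - e) * L) at_top"
      by (intro tendsto_intros I_lim x1)
    have b: "\<forall>\<^sub>F x in at_top. (1 - e) * I x1 x \<le> \<P>(\<omega> in M. V \<omega> * Y \<omega> > x) / F x"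
      by (rule low[OF x1(1) e x1(2)])
    show "\<forall>\<^sub>F x in at_top. l < \<P>(\<omega> in M. V \<omega> * Y \<omega> > x) / F x"
      using order_tendstoD(1)[OF t el] b
      by eventually_elim linarith
  next
    fix u assume u: "L < u"
    define e where "e = min (1/2) ((u - L) / (2 * (L + 1)))"
    have e: "0 < e" "e < 1" using u L by (auto simp: e_def)
    have "e * L \<le> (u - L) / (2 * (L + 1)) * L" using L by (intro mult_right_mono) (auto simp: e_def)
    also have "\<dots> \<le> (u - L) / 2" using u L by (simp add: field_simps mult_left_mono)
    finally have eu: "(1 + e) * L + 0 < u" using u by (simp add: algebra_simps)
    obtain x1 where x1: "x1 > 0" "tail_factorization V Y k e x1" using cond'[OF e] by blast
    have t: "((\<lambda>x. (1 + e) * I x1 x + \<P>(\<omega> in M. Y \<omega> > x / x1) / F x) \<longlongrightarrow> (1 + e) * L + 0) at_top"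
      by (intro tendsto_intros I_lim rem x1)
    have b: "\<forall>\<^sub>F x in at_top. \<P>(\<omega> in M. V \<omega> * Y \<omega> > x) / F x \<le> (1 + e) * I x1 x + \<P>(\<omega> in M. Y \<omega> > x / x1) / F x"
      by (rule up[OF x1(1) e x1(2)])
    show "\<forall>\<^sub>F x in at_top. \<P>(\<omega> in M. V \<omega> * Y \<omega> > x) / F x < u"
      using order_tendstoD(2)[OF t eu] b
      by eventually_elim linarith
  qed
qed

end

section \<open>The gauge of a rare set\<close>

context
  fixes A :: "(real ^ 'd) set"
  assumes A: "A \<in> rare_sets"
begin

lemma mem_dilate_iff: "0 < u \<Longrightarrow> v \<in> dilate u B \<longleftrightarrow> (1 / u) *\<^sub>R v \<in> B" for B :: "(real ^ 'd) set"
  by (auto simp: image_iff intro!: bexI[of _ "(1 / u) *\<^sub>R v"])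

lemma rare_set_ball: obtains r where "r > 0" "\<And>v. v \<in> A \<Longrightarrow> r \<le> norm v"
proof -
  have "0 \<in> - closure A" "open (- closure A)" using A by (auto simp: rare_sets_def)
  then obtain r where r: "r > 0" "ball 0 r \<subseteq> - closure A" by (meson openE)
  have "r \<le> norm v" if "v \<in> A" for v
    using r(2) closure_subset[of A] that by (force simp: not_le subset_iff)
  then show ?thesis using that r by blast
qed

lemma dilate_bounded:
  obtains r where "r > 0" "\<And>u v. 0 < u \<Longrightarrow> v \<in> dilate u A \<Longrightarrow> u \<le> norm v / r"
proof -
  obtain r where r: "r > 0" "\<And>v. v \<in> A \<Longrightarrow> r \<le> norm v" using rare_set_ball by blast
  have "u \<le> norm v / r" if "0 < u" "v \<in> dilate u A" for u v
    using r(2)[of "(1 / u) *\<^sub>R v"] that r(1) by (simp add: mem_dilate_iff field_simps)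
  then show ?thesis using that r by blast
qed

text \<open>The complement of A is convex and contains 0, hence star-shaped about 0: shrinking a
  point of it towards 0 cannot lead into A.\<close>

lemma dilate_downward:
  assumes "0 < u'" "u' \<le> u" "v \<in> dilate u A"
  shows "v \<in> dilate u' A"
proof (rule ccontr)
  assume "v \<notin> dilate u' A"
  then have 1: "(1 / u') *\<^sub>R v \<in> - A" using assms by (simp add: mem_dilate_iff)
  have 0: "0 \<in> - A" using A closure_subset by (auto simp: rare_sets_def)
  have "convex (- A)" using A by (simp add: rare_sets_def)
  then have "(u' / u) *\<^sub>R ((1 / u') *\<^sub>R v) + (1 - u' / u) *\<^sub>R 0 \<in> - A"
    using 0 1 assms by (intro convexD) (auto simp: field_simps)
  then show False using assms by (simp add: mem_dilate_iff)
qed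

text \<open>Openness of A leaves room for a slightly larger factor, so the supremum defining the
  gauge is never attained.\<close>

lemma dilate_upward:
  assumes "0 < u" "v \<in> dilate u A"
  obtains u' where "u < u'" "v \<in> dilate u' A"
proof -
  have 1: "(1 / u) *\<^sub>R v \<in> A" "open A" using assms A by (auto simp: mem_dilate_iff rare_sets_def)
  have "((\<lambda>w. (1 / w) *\<^sub>R v) \<longlongrightarrow> (1 / u) *\<^sub>R v) (at_right u)"
    using assms by (intro tendsto_intros) auto
  then have "\<forall>\<^sub>F w in at_right u. (1 / w) *\<^sub>R v \<in> A" using 1 topological_tendstoD by blast
  then obtain b where "u < b" "\<And>w. u < w \<Longrightarrow> w < b \<Longrightarrow> (1 / w) *\<^sub>R v \<in> A"
    by (auto simp: eventually_at_right_field)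
  moreover from \<open>u < b\<close> have "u < (u + b) / 2" "(u + b) / 2 < b" by auto
  ultimately have "(1 / ((u + b) / 2)) *\<^sub>R v \<in> A" "u < (u + b) / 2" by blast+
  then show ?thesis using that[of "(u + b) / 2"] assms by (simp add: mem_dilate_iff)
qed

lemma gauge_sup_bdd: "bdd_above (insert 0 {u. 0 < u \<and> v \<in> dilate u A})"
proof -
  obtain r where r: "r > 0" "\<And>u v. 0 < u \<Longrightarrow> v \<in> dilate u A \<Longrightarrow> u \<le> norm v / r" using dilate_bounded by blast
  show ?thesis using r by (intro bdd_aboveI[of _ "norm v / r"]) auto
qed

lemma gauge_sup_nonneg: "0 \<le> gauge_sup A v"
  unfolding gauge_sup_def by (intro cSup_upper gauge_sup_bdd) auto

text \<open>The admissible factors form an interval without greatest element, which accounts for the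
  strict inequality. Through this equivalence membership of a random vector in x A becomes a
  one-dimensional tail event.\<close>

lemma less_gauge_sup_iff:
  assumes "0 < u"
  shows "u < gauge_sup A v \<longleftrightarrow> v \<in> dilate u A"
proof
  assume "u < gauge_sup A v"
  then obtain u' where "u' \<in> insert 0 {u. 0 < u \<and> v \<in> dilate u A}" "u < u'"
    unfolding gauge_sup_def using less_cSup_iff[OF _ gauge_sup_bdd] by blast
  then show "v \<in> dilate u A" using assms dilate_downward[of u u' v] by auto
next
  assume "v \<in> dilate u A"
  then obtain u' where u': "u < u'" "v \<in> dilate u' A" using dilate_upward assms by blast
  then have "u' \<le> gauge_sup A v"
    unfolding gauge_sup_def using assms by (intro cSup_upper gauge_sup_bdd) auto
  with u' show "u < gauge_sup A v" by simp
qed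

lemma gauge_sup_leI:
  assumes "0 \<le> b" "\<And>u. 0 < u \<Longrightarrow> b < u \<Longrightarrow> v \<notin> dilate u A"
  shows "gauge_sup A v \<le> b"
proof (rule ccontr)
  assume "\<not> gauge_sup A v \<le> b"
  then obtain u where "b < u" "u < gauge_sup A v" by (meson dense not_le)
  then show False using assms less_gauge_sup_iff[of u v] by auto
qed

lemma gauge_sup_scale:
  assumes "0 < c"
  shows "gauge_sup A (c *\<^sub>R v) = c * gauge_sup A v"
proof -
  have le: "gauge_sup A (c *\<^sub>R v) \<le> c * gauge_sup A v" if "0 < c" for c v
  proof (rule gauge_sup_leI)
    fix u assume u: "0 < u" "c * gauge_sup A v < u"
    then have "\<not> u / c < gauge_sup A v" using that by (simp add: field_simps)
    then have "v \<notin> dilate (u / c) A" using less_gauge_sup_iff[of "u / c" v] u that by simp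
    then show "c *\<^sub>R v \<notin> dilate u A" using u that by (simp add: mem_dilate_iff)
  qed (use that gauge_sup_nonneg in simp)
  have "gauge_sup A v \<le> (1 / c) * gauge_sup A (c *\<^sub>R v)"
    using le[of "1 / c" "c *\<^sub>R v"] assms by simp
  then show ?thesis using le[OF assms, of v] assms by (simp add: field_simps)
qed

lemma gauge_sup_mono:
  assumes "\<And>j. v $ j \<le> w $ j"
  shows "gauge_sup A v \<le> gauge_sup A w"
proof (rule gauge_sup_leI)
  fix u assume u: "0 < u" "gauge_sup A w < u"
  then have w: "(1 / u) *\<^sub>R w \<notin> A" using less_gauge_sup_iff[of u w] mem_dilate_iff[of u w A] by auto
  have "increasing_set A" using A by (simp add: rare_sets_def)
  moreover have "(1 / u) *\<^sub>R w = (1 / u) *\<^sub>R v + (1 / u) *\<^sub>R (w - v)" by (simp add: algebra_simps)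
  moreover have "\<forall>j. 0 \<le> ((1 / u) *\<^sub>R (w - v)) $ j" using u assms by simp
  ultimately have "(1 / u) *\<^sub>R v \<notin> A" using w unfolding increasing_set_def by metis
  then show "v \<notin> dilate u A" using u by (simp add: mem_dilate_iff)
qed (rule gauge_sup_nonneg)

text \<open>The Minkowski functional argument for the convex set \<open>- A\<close>: with slack e/2
  the points v/a and w/b lie in it, and (v + w)/(a + b) is their convex combination with weights
  proportional to a and b.\<close>

lemma gauge_sup_add: "gauge_sup A (v + w) \<le> gauge_sup A v + gauge_sup A w"
proof (rule field_le_epsilon)
  fix e :: real assume e: "e > 0"
  define a where "a = gauge_sup A v + e / 2"
  define b where "b = gauge_sup A w + e / 2"
  have ab: "a > 0" "b > 0" "gauge_sup A v < a" "gauge_sup A w < b"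
    using e gauge_sup_nonneg[of v] gauge_sup_nonneg[of w] by (auto simp: a_def b_def)
  have "(1 / a) *\<^sub>R v \<in> - A" "(1 / b) *\<^sub>R w \<in> - A"
    using ab less_gauge_sup_iff[of a v] less_gauge_sup_iff[of b w] mem_dilate_iff[of a v A] mem_dilate_iff[of b w A] by auto
  moreover have "convex (- A)" using A by (simp add: rare_sets_def)
  ultimately have "(a / (a + b)) *\<^sub>R ((1 / a) *\<^sub>R v) + (b / (a + b)) *\<^sub>R ((1 / b) *\<^sub>R w) \<in> - A"
    using ab by (intro convexD) (auto simp flip: add_divide_distrib)
  then have "(1 / (a + b)) *\<^sub>R (v + w) \<notin> A" using ab by (simp add: scaleR_add_right)
  then have "\<not> a + b < gauge_sup A (v + w)"
    using ab less_gauge_sup_iff[of "a + b" "v + w"] mem_dilate_iff[of "a + b" "v + w" A] by auto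
  then show "gauge_sup A (v + w) \<le> gauge_sup A v + gauge_sup A w + e" by (simp add: a_def b_def)
qed

lemma gauge_sup_norm_bound:
  obtains r where "r > 0" "\<And>v. gauge_sup A v \<le> norm v / r"
proof -
  obtain r where r: "r > 0" "\<And>u v. 0 < u \<Longrightarrow> v \<in> dilate u A \<Longrightarrow> u \<le> norm v / r" using dilate_bounded by blast
  have "gauge_sup A v \<le> norm v / r" for v
    using r by (intro gauge_sup_leI) (auto simp: not_le[symmetric])
  then show ?thesis using that r by blast
qed

lemma gauge_sup_zero: "gauge_sup A 0 = 0"
proof -
  obtain r where "r > 0" "\<And>v. gauge_sup A v \<le> norm v / r" using gauge_sup_norm_bound by blast
  from this(2)[of 0] show ?thesis using gauge_sup_nonneg[of 0] by simp
qed

lemma continuous_gauge_sup: "continuous_on UNIV (gauge_sup A)"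
proof -
  obtain r where r: "r > 0" "\<And>v. gauge_sup A v \<le> norm v / r" using gauge_sup_norm_bound by blast
  \<comment> \<open>Subadditivity together with the norm bound makes the gauge Lipschitz.\<close>
  have 1: "gauge_sup A v - gauge_sup A w \<le> norm (v - w) / r" for v w
    using gauge_sup_add[of "v - w" w] r(2)[of "v - w"] by simp
  have "dist (gauge_sup A v) (gauge_sup A w) \<le> (1 / r) * dist v w" for v w
    using 1[of v w] 1[of w v] by (simp add: dist_real_def dist_norm norm_minus_commute abs_le_iff)
  then have "(1 / r)-lipschitz_on UNIV (gauge_sup A)"
    using r by (intro lipschitz_onI) auto
  then show ?thesis by (rule lipschitz_on_continuous_on)
qed

lemma gauge_sup_measurable: "gauge_sup A \<in> borel_measurable borel"
  by (rule borel_measurable_continuous_onI[OF continuous_gauge_sup])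

lemma gauge_sup_suminf:
  fixes z :: "nat \<Rightarrow> real ^ 'd"
  assumes "summable z" "summable (\<lambda>n. gauge_sup A (z n))"
  shows "gauge_sup A (\<Sum>n. z n) \<le> (\<Sum>n. gauge_sup A (z n))"
proof (rule LIMSEQ_le)
  show "(\<lambda>N. gauge_sup A (\<Sum>n<N. z n)) \<longlonglongrightarrow> gauge_sup A (\<Sum>n. z n)"
    using continuous_gauge_sup summable_LIMSEQ[OF assms(1)]
    by (metis UNIV_I continuous_on_eq_continuous_at isCont_tendsto_compose open_UNIV)
  show "(\<lambda>N. \<Sum>n<N. gauge_sup A (z n)) \<longlonglongrightarrow> (\<Sum>n. gauge_sup A (z n))"
    by (rule summable_LIMSEQ[OF assms(2)])
  have "gauge_sup A (\<Sum>n<N. z n) \<le> (\<Sum>n<N. gauge_sup A (z n))" for N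
  proof (induction N)
    case (Suc N)
    then show ?case using gauge_sup_add[of "\<Sum>n<N. z n" "z N"] by simp
  qed (simp add: gauge_sup_zero)
  then show "\<exists>N. \<forall>n\<ge>N. gauge_sup A (\<Sum>n<n. z n) \<le> (\<Sum>n<n. gauge_sup A (z n))" by blast
qed

end

section \<open>Multivariate regular variation on rare sets\<close>

lemma regularly_varying_rv_tail:
  assumes "regularly_varying \<alpha> G"
  shows "rv_tail \<alpha> (tail G)"
proof -
  interpret real_distribution G using assms by (simp add: regularly_varying_def)
  show ?thesis
    using assms cdf_nondecreasing cdf_nonneg cdf_bounded_prob
    by (auto simp: regularly_varying_def rv_tail_def tail_def antimono_def)
qed

lemma compact_UNIV_ennreal_vec: "compact (UNIV :: (ennreal ^ 'd) set)"
proof -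
  have "compact_space (euclidean :: ennreal topology)"
    by (simp add: compact_space_def compact_UNIV)
  then have "compact_space (product_topology (\<lambda>i::'d. euclidean :: ennreal topology) UNIV)"
    by (simp add: compact_space_product_topology)
  then have "compact (UNIV :: ('d \<Rightarrow> ennreal) set)"
    unfolding euclidean_product_topology by (simp add: compact_space_def)
  moreover have "continuous_on UNIV (\<lambda>f::'d \<Rightarrow> ennreal. \<chi> i. f i)"
    by (intro continuous_on_vec_lambda) simp
  ultimately have "compact ((\<lambda>f::'d \<Rightarrow> ennreal. \<chi> i. f i) ` UNIV)"
    by (rule compact_continuous_image[rotated])
  moreover have "(\<lambda>f::'d \<Rightarrow> ennreal. \<chi> i. f i) ` UNIV = UNIV"
    by (rule surjI[of _ vec_nth]) simp
  ultimately show ?thesis by simp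
qed

text \<open>Makes the finiteness clause of \<open>radon_punctured\<close> available for every closed
  set that avoids 0, including sets that reach infinity.\<close>

lemma compact_ennreal_vec: "closed K \<Longrightarrow> compact K" for K :: "(ennreal ^ 'd) set"
  using compact_Int_closed[OF compact_UNIV_ennreal_vec] by simp

text \<open>The frontier of a level set of \<open>\<phi>\<close> lies in Z or in {\<phi> = u}, and
  the latter is null for all but countably many u because the mass of {\<phi> > u} is monotone in u.
  For those u regular variation applies, and rescaling x shows that the mass times u^\<alpha> is one
  constant L, the limit of P/tail G. Monotonicity extends the law L u^(-\<alpha>) to u = 1, which
  was not known to be a good level beforehand. \<open>Z\<close> collects the points where \<phi>
  need not be continuous; \<open>proper\<close> provides the strict inclusion in
  \<open>MRV\<close>.\<close>

lemma MRV_level_sets: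
  fixes \<phi> :: "ennreal ^ 'd \<Rightarrow> ennreal" and P :: "real \<Rightarrow> real"
  assumes mrv: "MRV \<alpha> \<mu> G F" and \<alpha>: "0 < \<alpha>"
    and Z: "closed Z" "0 \<notin> Z" "emeasure \<mu> Z = 0"
    and \<phi>: "continuous_on (- Z) \<phi>" "\<phi> 0 = 0"
    and proper: "\<And>u. 0 < u \<Longrightarrow> \<exists>w. w \<noteq> 0 \<and> (w \<in> Z \<or> \<phi> w \<le> ennreal u)"
    and P: "\<And>x u. 0 < x \<Longrightarrow> 0 < u \<Longrightarrow>
      measure F {v. orthant_embed v \<in> edilate x {w. w \<notin> Z \<and> ennreal u < \<phi> w}} = P (x * u)"
  shows "((\<lambda>x. P x / tail G x) \<longlongrightarrow> measure \<mu> {w. w \<notin> Z \<and> 1 < \<phi> w}) at_top"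
    and "(\<lambda>n. emeasure \<mu> {w. w \<notin> Z \<and> ennreal (real (Suc n)) < \<phi> w}) \<longlonglongrightarrow> 0"
proof -
  define B where "B u = {w. w \<notin> Z \<and> ennreal u < \<phi> w}" for u
  define m where "m u = measure \<mu> (B u)" for u
  have rvG: "rv_tail \<alpha> (tail G)" using mrv by (intro regularly_varying_rv_tail) (simp add: MRV_def)
  have Gpos: "tail G x > 0" for x using rv_tail_pos[OF rvG] .
  have sets_\<mu>: "S \<in> sets \<mu>" if "S \<in> sets borel" "0 \<notin> S" for S
  proof -
    have "S \<in> sets (restrict_space borel (- {0}))"
      using that by (auto simp: sets_restrict_space intro!: image_eqI[of _ _ S])
    then show ?thesis using mrv by (simp add: MRV_def radon_punctured_def)
  qed
  have openZ: "open (- Z)" using Z by auto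
  have Bopen: "open (B u)" for u
  proof -
    have "open ((- Z) \<inter> \<phi> -` {ennreal u<..})"
      by (rule continuous_open_preimage[OF \<phi>(1) openZ]) auto
    moreover have "(- Z) \<inter> \<phi> -` {ennreal u<..} = B u" by (auto simp: B_def)
    ultimately show ?thesis by simp
  qed
  have lowopen: "open {w. w \<notin> Z \<and> \<phi> w < ennreal u}" for u
  proof -
    have "open ((- Z) \<inter> \<phi> -` {..<ennreal u})"
      by (rule continuous_open_preimage[OF \<phi>(1) openZ]) auto
    moreover have "(- Z) \<inter> \<phi> -` {..<ennreal u} = {w. w \<notin> Z \<and> \<phi> w < ennreal u}" by auto
    ultimately show ?thesis by simp
  qed
  have clB: "closure (B u) \<subseteq> - {w. w \<notin> Z \<and> \<phi> w < ennreal u}" for u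
    by (rule closure_minimal) (use lowopen in \<open>auto simp: B_def closed_Compl\<close>)
  have zero_cl: "0 \<notin> closure (B u)" if "u > 0" for u
    using clB[of u] Z \<phi>(2) that by auto
  have zeroB: "0 \<notin> B u" if "u > 0" for u using zero_cl[OF that] closure_subset by blast
  have Bsets: "B u \<in> sets \<mu>" if "u > 0" for u using sets_\<mu> Bopen zeroB[OF that] by simp
  have cl_fin: "emeasure \<mu> (closure (B u)) < \<infinity>" if "u > 0" for u
    using mrv zero_cl[OF that] compact_ennreal_vec[of "closure (B u)"]
    by (simp add: MRV_def radon_punctured_def)
  have cl_sets: "closure (B u) \<in> sets \<mu>" if "u > 0" for u using sets_\<mu> zero_cl[OF that] by simp
  have Bfin: "emeasure \<mu> (B u) < \<infinity>" if "u > 0" for u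
    using emeasure_mono[OF closure_subset cl_sets[OF that]] cl_fin[OF that] by (rule le_less_trans)
  have Bmono: "B u \<subseteq> B u'" if "u' \<le> u" for u u'
    using ennreal_leI[OF that] by (auto simp: B_def)
  have m_anti: "m u \<le> m u'" if "0 < u'" "u' \<le> u" for u u'
    unfolding m_def using Bfin[OF that(1)] Bsets that
    by (intro measure_mono_fmeasurable Bmono) (auto simp: fmeasurable_def)
  have "countable {u\<in>{0<..}. \<not> isCont (\<lambda>u. - m u) u}"
    by (rule mono_on_ctble_discont_open) (auto intro!: mono_onI m_anti)
  then have ctbl: "countable {u\<in>{0<..}. \<not> isCont m u}"
    by (rule countable_subset[rotated]) (auto dest: continuous_minus)
  have frontier0: "emeasure \<mu> (frontier (B u)) = 0" if u: "u > 0" and cont: "isCont m u" for u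
  proof -
    \<comment> \<open>\<open>Eq\<close> lies in {\<phi> = u}, disjoint from \<open>B u\<close> but
      inside \<open>B u'\<close> for each positive u' < u, so its mass is at most
      \<open>m u' - m u\<close>, which vanishes as u' increases to a continuity point u.\<close>
    define Eq where "Eq = closure (B u) - B u - Z"
    have Eq_sets: "Eq \<in> sets \<mu>" unfolding Eq_def using zero_cl[OF u] Bopen Z by (intro sets_\<mu>) auto
    have Eq: "\<phi> w = ennreal u" if "w \<in> Eq" for w
      using that clB[of u] by (auto simp: Eq_def B_def not_less)
    have le: "measure \<mu> Eq \<le> m u' - m u" if "0 < u'" "u' < u" for u'
    proof -
      have "Eq \<inter> B u = {}" by (auto simp: Eq_def)
      moreover have "Eq \<subseteq> B u'"
      proof
        fix w assume w: "w \<in> Eq"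
        have "w \<notin> Z" using w by (simp add: Eq_def)
        then show "w \<in> B u'" using Eq[OF w] that by (simp add: B_def ennreal_less_iff)
      qed
      then have "Eq \<union> B u \<subseteq> B u'" using Bmono[of u' u] that by auto
      then have "measure \<mu> (Eq \<union> B u) \<le> m u'"
        unfolding m_def using Bfin[of u'] Bsets that Eq_sets u
        by (intro measure_mono_fmeasurable) (auto simp: fmeasurable_def)
      moreover have "Eq \<in> fmeasurable \<mu>"
        using \<open>Eq \<subseteq> B u'\<close> Eq_sets Bfin[of u'] Bsets[of u'] that
        by (intro fmeasurableI) (auto intro: le_less_trans emeasure_mono)
      ultimately show ?thesis
        using Bfin[OF u] Bsets[OF u] measure_Un3[of Eq \<mu> "B u"] by (simp add: m_def fmeasurable_def)
    qed
    have "(m \<longlongrightarrow> m u) (at_left u)"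
      using cont unfolding isCont_def by (rule tendsto_mono[OF at_le, rotated]) simp
    then have "((\<lambda>u'. m u' - m u) \<longlongrightarrow> m u - m u) (at_left u)" by (intro tendsto_diff tendsto_const)
    moreover have "\<forall>\<^sub>F u' in at_left u. measure \<mu> Eq \<le> m u' - m u"
      unfolding eventually_at_left_field using u le by (intro exI[of _ 0]) auto
    ultimately have "measure \<mu> Eq \<le> 0"
      using tendsto_lowerbound[of "\<lambda>u'. m u' - m u" "m u - m u" "at_left u"] by simp
    then have m0: "measure \<mu> Eq = 0" using measure_nonneg[of \<mu> Eq] by linarith
    have "emeasure \<mu> Eq < \<infinity>"
      using emeasure_mono[of Eq "closure (B u)" \<mu>] cl_fin[OF u] cl_sets[OF u] by (auto simp: Eq_def intro: le_less_trans)
    then have "emeasure \<mu> Eq = ennreal (measure \<mu> Eq)"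
      by (intro emeasure_eq_ennreal_measure) auto
    then have Eq0: "emeasure \<mu> Eq = 0" using m0 by simp
    have "frontier (B u) \<subseteq> Eq \<union> Z"
      using Bopen by (auto simp: Eq_def frontier_def interior_open)
    then have "emeasure \<mu> (frontier (B u)) \<le> emeasure \<mu> (Eq \<union> Z)"
      using Eq_sets Z sets_\<mu>[of Z] by (intro emeasure_mono) auto
    also have "\<dots> \<le> emeasure \<mu> Eq + emeasure \<mu> Z"
      using Eq_sets Z sets_\<mu>[of Z] by (intro emeasure_subadditive) auto
    finally show ?thesis using Eq0 Z(3) by simp
  qed
  have lim_good: "((\<lambda>x. P (x * u) / tail G x) \<longlongrightarrow> m u) at_top"
    if u: "u > 0" and cont: "isCont m u" for u
  proof -
    have "B u \<in> sets borel" using Bopen by simp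
    moreover have "B u \<subset> - {0}"
    proof -
      obtain w where "w \<noteq> 0" "w \<in> Z \<or> \<phi> w \<le> ennreal u" using proper[OF u] by auto
      then have "w \<notin> B u" by (auto simp: B_def)
      then show ?thesis using zeroB[OF u] \<open>w \<noteq> 0\<close> by auto
    qed
    ultimately have "((\<lambda>x. measure F {v. orthant_embed v \<in> edilate x (B u)} / tail G x) \<longlongrightarrow> measure \<mu> (B u)) at_top"
      using mrv zero_cl[OF u] frontier0[OF u cont] unfolding MRV_def by blast
    moreover have "\<forall>\<^sub>F x in at_top. measure F {v. orthant_embed v \<in> edilate x (B u)} / tail G x = P (x * u) / tail G x"
      using eventually_gt_at_top[of 0] by eventually_elim (use P u in \<open>simp add: B_def\<close>)
    ultimately show ?thesis unfolding m_def by (rule Lim_transform_eventually)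
  qed
  have lim1: "((\<lambda>y. P y / tail G y) \<longlongrightarrow> m u * u powr \<alpha>) at_top"
    if u: "u > 0" and cont: "isCont m u" for u
  proof -
    have f: "filterlim (\<lambda>y. y * (1 / u)) at_top at_top"
      using u by (intro filterlim_at_top_mult_tendsto_pos[OF tendsto_const] filterlim_ident) auto
    have "((\<lambda>y. P (y * (1 / u) * u) / tail G (y * (1 / u)) * (tail G (1 / u * y) / tail G y)) \<longlongrightarrow> m u * (1 / u) powr (- \<alpha>)) at_top"
    proof (intro tendsto_mult filterlim_compose[OF lim_good[OF u cont] f])
      show "((\<lambda>y. tail G (1 / u * y) / tail G y) \<longlongrightarrow> (1 / u) powr (- \<alpha>)) at_top"
        using rvG u unfolding rv_tail_def by (metis zero_less_divide_1_iff)
    qed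
    moreover have "(1 / u) powr (- \<alpha>) = u powr \<alpha>" using u by (simp add: powr_divide powr_minus)
    moreover have "P (y * (1 / u) * u) / tail G (y * (1 / u)) * (tail G (1 / u * y) / tail G y) = P y / tail G y" for y
      using u Gpos[of "y * (1 / u)"] by simp
    ultimately show ?thesis by (simp only:)
  qed
  have dense: "\<exists>u. a < u \<and> u < b \<and> isCont m u" if "0 < a" "a < b" for a b
  proof -
    have "{a<..<b} \<noteq> {}" using that by auto
    from open_minus_countable[OF ctbl this open_greaterThanLessThan]
    obtain u where "u \<in> {a<..<b}" "u \<notin> {u\<in>{0<..}. \<not> isCont m u}" by (elim bexE)
    then show ?thesis using that by (intro exI[of _ u]) auto
  qed
  from dense[of 1 2] obtain u0 where u0': "1 < u0 \<and> u0 < 2 \<and> isCont m u0" by fastforce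
  then have u0: "u0 > 0" "isCont m u0" by auto
  define L where "L = m u0 * u0 powr \<alpha>"
  have limL: "((\<lambda>y. P y / tail G y) \<longlongrightarrow> L) at_top" unfolding L_def by (rule lim1[OF u0])
  have mL: "m u = L * u powr (- \<alpha>)" if "u > 0" "isCont m u" for u
  proof -
    have "m u * u powr \<alpha> = L" using tendsto_unique[OF _ lim1[OF that] limL] by simp
    then show ?thesis using that by (auto simp: powr_minus field_simps)
  qed
  have m_nonneg: "0 \<le> m u" for u by (simp add: m_def)
  have L0: "0 \<le> L" unfolding L_def using m_nonneg by simp
  have m_le: "m b \<le> L * a powr (- \<alpha>)" and m_ge: "L * b powr (- \<alpha>) \<le> m a" if ab: "0 < a" "a < b" for a b
  proof -
    obtain u where u: "a < u" "u < b" "isCont m u" using dense[OF ab] by blast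
    have "m b \<le> m u" using u ab by (intro m_anti) auto
    also have "\<dots> = L * u powr (- \<alpha>)" using u ab by (intro mL) auto
    also have "\<dots> \<le> L * a powr (- \<alpha>)" using u ab \<alpha> L0 by (intro mult_left_mono powr_mono2') auto
    finally show "m b \<le> L * a powr (- \<alpha>)" .
    have "L * b powr (- \<alpha>) \<le> L * u powr (- \<alpha>)" using u ab \<alpha> L0 by (intro mult_left_mono powr_mono2') auto
    also have "\<dots> = m u" using u ab by (intro mL[symmetric]) auto
    also have "\<dots> \<le> m a" using u ab by (intro m_anti) auto
    finally show "L * b powr (- \<alpha>) \<le> m a" .
  qed
  \<comment> \<open>The upper bound uses that {\<phi> > 1} is the increasing union of the sets
    {\<phi> > 1 + 1/(n+1)}, each of mass at most L; the lower bound lets b decrease to 1.\<close>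
  have m1: "m 1 = L"
  proof (rule antisym)
    have "(\<lambda>n. m (1 + 1 / Suc n)) \<longlonglongrightarrow> measure \<mu> (\<Union>n. B (1 + 1 / Suc n))"
      unfolding m_def
    proof (rule Lim_measure_incseq)
      show "range (\<lambda>n. B (1 + 1 / real (Suc n))) \<subseteq> sets \<mu>"
        by (auto intro!: Bsets add_pos_nonneg)
      show "incseq (\<lambda>n. B (1 + 1 / real (Suc n)))"
        by (intro incseq_SucI Bmono) (simp add: frac_le)
      have "emeasure \<mu> (\<Union>n. B (1 + 1 / real (Suc n))) \<le> emeasure \<mu> (B 1)"
        using Bmono[of 1 "1 + 1 / real (Suc _)"] by (intro emeasure_mono Bsets UN_least) auto
      then show "emeasure \<mu> (\<Union>n. B (1 + 1 / real (Suc n))) \<noteq> \<infinity>" using Bfin[of 1] by auto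
    qed
    also have "(\<Union>n. B (1 + 1 / Suc n)) = B 1"
    proof (intro antisym UN_least Bmono)
      show "B 1 \<subseteq> (\<Union>n. B (1 + 1 / real (Suc n)))"
      proof
        fix w assume w: "w \<in> B 1"
        then have "ennreal 1 < \<phi> w" by (simp add: B_def)
        then obtain y where y: "1 < y" "ennreal y < \<phi> w"
          by (cases "\<phi> w") (use dense_order_class.dense in \<open>auto simp: ennreal_less_iff intro: that[of 2]\<close>)
        obtain n where "1 / real (Suc n) < y - 1" using nat_approx_posE[of "y - 1"] y by auto
        then have "ennreal (1 + 1 / real (Suc n)) \<le> ennreal y" by (intro ennreal_leI) simp
        then have "w \<in> B (1 + 1 / real (Suc n))" using w y by (auto simp: B_def)
        then show "w \<in> (\<Union>n. B (1 + 1 / real (Suc n)))" by blast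
      qed
    qed simp
    finally have "(\<lambda>n. m (1 + 1 / Suc n)) \<longlonglongrightarrow> m 1" by (simp add: m_def)
    moreover have "m (1 + 1 / Suc n) \<le> L" for n
      using m_le[of 1 "1 + 1 / Suc n"] by simp
    ultimately show "m 1 \<le> L" by (intro LIMSEQ_le_const2) auto
    have "((\<lambda>b. L * b powr (- \<alpha>)) \<longlongrightarrow> L * 1 powr (- \<alpha>)) (at_right 1)" by (intro tendsto_intros) auto
    moreover have "\<forall>\<^sub>F b in at_right 1. L * b powr (- \<alpha>) \<le> m 1"
      unfolding eventually_at_right_field using m_ge[of 1] by (intro exI[of _ 2]) auto
    ultimately show "L \<le> m 1"
      using tendsto_upperbound[of "\<lambda>b. L * b powr (- \<alpha>)" "L * 1 powr (- \<alpha>)" "at_right 1" "m 1"] by simp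
  qed
  show "((\<lambda>x. P x / tail G x) \<longlongrightarrow> measure \<mu> {w. w \<notin> Z \<and> 1 < \<phi> w}) at_top"
    using limL m1 by (simp add: m_def B_def)
  have "filterlim (\<lambda>n. 1 / 2 + real n) at_top sequentially"
    by (intro filterlim_tendsto_add_at_top[OF tendsto_const] filterlim_real_sequentially)
  \<comment> \<open>\<open>m_le\<close> needs a level strictly below n + 1; n + 1/2 is one, and it
    is positive already at n = 0.\<close>
  then have lim0: "(\<lambda>n. L * (1 / 2 + real n) powr (- \<alpha>)) \<longlonglongrightarrow> L * 0"
    using \<alpha> by (intro tendsto_mult tendsto_const tendsto_neg_powr) auto
  have "(\<lambda>n. m (real (Suc n))) \<longlonglongrightarrow> 0"
  proof (rule tendsto_sandwich[OF _ _ tendsto_const lim0[unfolded mult_zero_right]])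
    show "\<forall>\<^sub>F n in sequentially. m (real (Suc n)) \<le> L * (1 / 2 + real n) powr (- \<alpha>)"
      by (intro always_eventually allI m_le) auto
  qed (auto simp: m_nonneg)
  then have "(\<lambda>n. ennreal (m (real (Suc n)))) \<longlonglongrightarrow> ennreal 0" by (rule tendsto_ennrealI)
  moreover have "ennreal (m (real (Suc n))) = emeasure \<mu> (B (real (Suc n)))" for n
    unfolding m_def using Bfin[of "real (Suc n)"] by (intro emeasure_eq_ennreal_measure[symmetric]) (auto simp: less_top)
  ultimately show "(\<lambda>n. emeasure \<mu> {w. w \<notin> Z \<and> ennreal (real (Suc n)) < \<phi> w}) \<longlonglongrightarrow> 0"
    by (simp add: B_def)
qed

lemma orthant_embed_edilate:
  assumes x: "0 < x"
  shows "orthant_embed v \<in> edilate x S \<longleftrightarrow> orthant_embed ((1 / x) *\<^sub>R v) \<in> S"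
proof -
  have inv: "ennreal (1 / x) * (ennreal x * b) = b" "ennreal x * (ennreal (1 / x) * b) = b" for b
    using x by (simp_all add: mult.assoc[symmetric] flip: ennreal_mult')
  have e: "orthant_embed ((1 / x) *\<^sub>R v) = (\<chi> j. ennreal (1 / x) * orthant_embed v $ j)"
    using x by (simp add: orthant_embed_def vec_eq_iff ennreal_mult'[symmetric])
  show ?thesis
  proof
    assume "orthant_embed v \<in> edilate x S"
    then obtain b where "b \<in> S" "orthant_embed v = (\<chi> j. ennreal x * b $ j)" by (auto simp: edilate_def)
    then show "orthant_embed ((1 / x) *\<^sub>R v) \<in> S" by (simp add: e inv)
  next
    assume "orthant_embed ((1 / x) *\<^sub>R v) \<in> S"
    moreover have "orthant_embed v = (\<chi> j. ennreal x * orthant_embed ((1 / x) *\<^sub>R v) $ j)"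
      by (simp add: e inv vec_eq_iff)
    ultimately show "orthant_embed v \<in> edilate x S" unfolding edilate_def by (rule rev_image_eqI)
  qed
qed

text \<open>Level sets of a coordinate, with no exceptional set. That their mass vanishes at large
  levels shows that \<mu> does not charge the points with an infinite coordinate, which then serve
  as \<open>Z\<close> for the gauge. The first part later controls the norm of a claim.\<close>

lemma MRV_component:
  fixes \<mu> :: "(ennreal ^ 'd) measure"
  assumes mrv: "MRV \<alpha> \<mu> G F" and \<alpha>: "0 < \<alpha>"
  shows "((\<lambda>x. measure F {v. x < v $ j} / tail G x) \<longlongrightarrow> measure \<mu> {w. 1 < w $ j}) at_top"
    and "emeasure \<mu> {w. w $ j = \<top>} = 0"
proof -
  have cont: "continuous_on (- {}) (\<lambda>w::ennreal ^ 'd. w $ j)" by (intro continuous_intros)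
  have proper: "\<exists>w. w \<noteq> 0 \<and> (w \<in> {} \<or> (w::ennreal ^ 'd) $ j \<le> ennreal u)" if "0 < u" for u
    using that by (intro exI[of _ "\<chi> i. ennreal u"]) (auto simp: vec_eq_iff)
  have P: "measure F {v. orthant_embed v \<in> edilate x {w. w \<notin> {} \<and> ennreal u < w $ j}} = measure F {v. x * u < v $ j}"
    if "0 < x" "0 < u" for x u
    using that by (simp add: orthant_embed_edilate) (simp add: orthant_embed_def ennreal_less_iff field_simps)
  note lev = MRV_level_sets[OF mrv \<alpha> _ _ _ cont _ proper P, simplified]
  show "((\<lambda>x. measure F {v. x < v $ j} / tail G x) \<longlongrightarrow> measure \<mu> {w. 1 < w $ j}) at_top"
    by (rule lev(1))
  have "emeasure \<mu> {w. w $ j = \<top>} \<le> emeasure \<mu> {w. ennreal (real (Suc n)) < w $ j}" for n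
  proof (rule emeasure_mono)
    have "open {w::ennreal ^ 'd. ennreal (real (Suc n)) < w $ j}"
      by (intro open_Collect_less continuous_intros)
    then have "{w::ennreal ^ 'd. ennreal (real (Suc n)) < w $ j} \<in> sets (restrict_space borel (- {0}))"
      by (auto simp: sets_restrict_space intro!: image_eqI[of _ _ "{w. ennreal (real (Suc n)) < w $ j}"])
    then show "{w. ennreal (real (Suc n)) < w $ j} \<in> sets \<mu>"
      using mrv by (simp add: MRV_def radon_punctured_def)
  qed auto
  then have "emeasure \<mu> {w. w $ j = \<top>} \<le> 0"
    by (intro LIMSEQ_le_const[OF lev(2)]) (auto simp: add.commute)
  then show "emeasure \<mu> {w. w $ j = \<top>} = 0" by simp
qed

text \<open>The gauge lives on finite vectors. It is carried over by \<open>enn2real\<close>, which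
  sends infinite coordinates to 0 and may be discontinuous there; these points form the closed null
  set Z. What remains of {\<phi> > 1} is exactly the set measured by
  \<open>orthant_mass\<close>.\<close>

lemma MRV_rare_set:
  fixes X :: "'a \<Rightarrow> real ^ 'd" and \<mu> :: "(ennreal ^ 'd) measure"
  assumes mrv: "MRV \<alpha> \<mu> G (distr M borel X)" and \<alpha>: "0 < \<alpha>" and A: "A \<in> rare_sets"
    and X[measurable]: "X \<in> borel_measurable M" and X_nonneg: "\<And>\<omega> j. \<omega> \<in> space M \<Longrightarrow> 0 \<le> X \<omega> $ j"
  shows "((\<lambda>x. \<P>(\<omega> in M. x < gauge_sup A (X \<omega>)) / tail G x) \<longlongrightarrow> orthant_mass \<mu> A) at_top"
proof -
  note [measurable] = gauge_sup_measurable[OF A]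
  define Z where "Z = {w::ennreal ^ 'd. \<exists>j. w $ j = \<top>}"
  define q where "q w = (\<chi> j. enn2real (w $ j))" for w :: "ennreal ^ 'd"
  define \<phi> where "\<phi> w = ennreal (gauge_sup A (q w))" for w :: "ennreal ^ 'd"
  have Z_eq: "Z = (\<Union>j. {w. w $ j = \<top>})" by (auto simp: Z_def)
  have closed1: "closed {w::ennreal ^ 'd. w $ j = \<top>}" for j
    by (intro closed_Collect_eq continuous_intros)
  then have Z: "closed Z" unfolding Z_eq by (intro closed_UN) auto
  have Z0: "0 \<notin> Z" by (simp add: Z_def)
  have Zj: "{w::ennreal ^ 'd. w $ j = \<top>} \<in> sets \<mu>" for j
  proof -
    have "{w::ennreal ^ 'd. w $ j = \<top>} \<in> sets (restrict_space borel (- {0}))"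
      using closed1[of j] by (auto simp: sets_restrict_space intro!: image_eqI[of _ _ "{w. w $ j = \<top>}"])
    then show ?thesis using mrv by (simp add: MRV_def radon_punctured_def)
  qed
  have Z_null: "emeasure \<mu> Z = 0"
  proof -
    have "{w. w $ j = \<top>} \<in> null_sets \<mu>" for j
      using MRV_component(2)[OF mrv \<alpha>, of j] Zj by (auto simp: null_sets_def)
    then have "Z \<in> null_sets \<mu>" unfolding Z_eq by (intro null_sets_UN') auto
    then show ?thesis by (simp add: null_sets_def)
  qed
  have c1: "continuous_on (- Z) (\<lambda>w. enn2real (w $ j))" for j
    unfolding continuous_on_def
  proof
    fix w assume "w \<in> - Z"
    then have "w $ j = ennreal (enn2real (w $ j))" by (simp add: Z_def less_top)
    moreover have "((\<lambda>w. w $ j) \<longlongrightarrow> w $ j) (at w within - Z)" by (intro tendsto_intros)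
    ultimately show "((\<lambda>w. enn2real (w $ j)) \<longlongrightarrow> enn2real (w $ j)) (at w within - Z)"
      by (intro tendsto_enn2real) auto
  qed
  have \<phi>_cont: "continuous_on (- Z) \<phi>"
    unfolding \<phi>_def[abs_def]
    by (intro continuous_on_ennreal continuous_on_compose2[OF continuous_gauge_sup[OF A]])
       (auto simp: q_def[abs_def] intro!: continuous_on_vec_lambda c1)
  have \<phi>0: "\<phi> 0 = 0"
  proof -
    have "q 0 = 0" by (simp add: q_def vec_eq_iff)
    then show ?thesis by (simp add: \<phi>_def gauge_sup_zero[OF A])
  qed
  have proper: "\<exists>w. w \<noteq> 0 \<and> (w \<in> Z \<or> \<phi> w \<le> ennreal u)" if "0 < u" for u
    by (intro exI[of _ "\<chi> i. \<top>"]) (auto simp: vec_eq_iff Z_def)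
  \<comment> \<open>\<open>orthant_embed\<close> truncates negative coordinates to 0, so on all of
    R^d it can be inverted only up to the positive part; on the values of \<open>X\<close> this is
    the identity.\<close>
  define pos where "pos v = (\<chi> j. max 0 (v $ j))" for v :: "real ^ 'd"
  have q_embed: "q (orthant_embed v) = pos v" for v :: "real ^ 'd"
    by (auto simp: q_def orthant_embed_def pos_def vec_eq_iff max_def ennreal_neg)
  have embed_fin: "orthant_embed v \<notin> Z" for v :: "real ^ 'd" by (simp add: Z_def orthant_embed_def)
  have pos_scale: "pos (c *\<^sub>R v) = c *\<^sub>R pos v" if "0 < c" for c v
    using that by (auto simp: pos_def vec_eq_iff max_def zero_le_mult_iff)
  define P where "P y = measure (distr M borel X) {v. y < gauge_sup A (pos v)}" for y
  have P: "measure (distr M borel X) {v. orthant_embed v \<in> edilate x {w. w \<notin> Z \<and> ennreal u < \<phi> w}} = P (x * u)"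
    if "0 < x" "0 < u" for x u
  proof -
    have "orthant_embed v \<in> edilate x {w. w \<notin> Z \<and> ennreal u < \<phi> w} \<longleftrightarrow> x * u < gauge_sup A (pos v)" for v
      using that
      by (simp only: orthant_embed_edilate mem_Collect_eq embed_fin \<phi>_def q_embed ennreal_less_iff)
         (simp add: embed_fin ennreal_less_iff pos_scale gauge_sup_scale[OF A] field_simps)
    then show ?thesis by (simp add: P_def)
  qed
  have "continuous_on UNIV pos" unfolding pos_def[abs_def] by (intro continuous_intros)
  then have [measurable]: "pos \<in> borel_measurable borel" by (rule borel_measurable_continuous_onI)
  have P_eq: "P x = \<P>(\<omega> in M. x < gauge_sup A (X \<omega>))" for x
  proof -
    have "pos (X \<omega>) = X \<omega>" if "\<omega> \<in> space M" for \<omega>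
      using X_nonneg[OF that] by (simp add: pos_def vec_eq_iff max_def)
    then show ?thesis unfolding P_def by (subst measure_distr) (auto intro!: arg_cong[where f="measure M"])
  qed
  have set_eq: "{w. w \<notin> Z \<and> 1 < \<phi> w} = orthant_embed ` {v \<in> A. \<forall>j. 0 \<le> v $ j}"
  proof (intro set_eqI iffI)
    fix w assume w: "w \<in> {w. w \<notin> Z \<and> 1 < \<phi> w}"
    then have "1 < gauge_sup A (q w)"
      by (simp add: \<phi>_def)
    then have "q w \<in> A" using less_gauge_sup_iff[OF A, of 1 "q w"] by simp
    moreover have "orthant_embed (q w) = w" using w by (auto simp: orthant_embed_def q_def vec_eq_iff Z_def less_top)
    moreover have "0 \<le> q w $ j" for j by (simp add: q_def)
    ultimately show "w \<in> orthant_embed ` {v \<in> A. \<forall>j. 0 \<le> v $ j}"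
      by (intro image_eqI[of _ _ "q w"]) auto
  next
    fix w assume "w \<in> orthant_embed ` {v \<in> A. \<forall>j. 0 \<le> v $ j}"
    then obtain v where v: "w = orthant_embed v" "v \<in> A" "\<And>j. 0 \<le> v $ j" by auto
    have "pos v = v" using v by (simp add: pos_def vec_eq_iff max_def)
    moreover have "1 < gauge_sup A v" using less_gauge_sup_iff[OF A, of 1 v] v by simp
    ultimately show "w \<in> {w. w \<notin> Z \<and> 1 < \<phi> w}"
      using v embed_fin by (simp add: \<phi>_def q_embed)
  qed
  show ?thesis
    using MRV_level_sets(1)[OF mrv \<alpha> Z Z0 Z_null \<phi>_cont \<phi>0 proper P]
    by (simp add: P_eq set_eq orthant_mass_def)
qed

section \<open>Levy processes at independent random times\<close>

text \<open>A right-continuous path is recovered from its values at the points \<open>(k + 1) / (n + 1)\<close>, which makes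
  evaluation at a random time measurable with respect to the product \<open>\<sigma>\<close>-algebra of paths.\<close>

definition path_eval :: "real \<times> (real \<Rightarrow> real) \<Rightarrow> real" where
  "path_eval = (\<lambda>(s, f). lim (\<lambda>n. f (right_grid n s)))"

lemma path_eval_measurable[measurable]: "path_eval \<in> borel_measurable (borel \<Otimes>\<^sub>M (\<Pi>\<^sub>M t\<in>{0..}. borel))"
proof -
  have 1: "(\<lambda>z. snd z (right_grid n (fst z))) \<in> borel_measurable (borel \<Otimes>\<^sub>M (\<Pi>\<^sub>M t\<in>{0::real..}. borel :: real measure))" for n
  proof -
    have comp: "(\<lambda>z. snd z ((real i + 1) / real (Suc n))) \<in> borel_measurable (borel \<Otimes>\<^sub>M (\<Pi>\<^sub>M t\<in>{0::real..}. borel :: real measure))" for i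
      by (rule measurable_compose[OF measurable_snd measurable_component_singleton]) simp
    show ?thesis unfolding right_grid_def
      by (rule measurable_compose_countable[where f="\<lambda>i z. snd z ((real i + 1) / real (Suc n))", OF comp]) measurable
  qed
  show ?thesis unfolding path_eval_def case_prod_beta
    by (rule borel_measurable_lim_metric[OF 1])
qed

lemma path_eval_right_continuous:
  assumes "0 \<le> s" "(f \<longlongrightarrow> f s) (at_right s)"
  shows "path_eval (s, \<lambda>t\<in>{0..}. f t) = f s"
proof -
  have "(\<lambda>n. f (right_grid n s)) \<longlonglongrightarrow> f s"
    by (rule filterlim_compose[OF assms(2) right_grid_tendsto(2)[OF assms(1)]])
  moreover have "(\<lambda>t\<in>{0..}. f t) (right_grid n s) = f (right_grid n s)" for n
    using right_grid_pos[of n s] by simp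
  ultimately show ?thesis by (simp add: path_eval_def limI)
qed

locale levy = prob_space M for M :: "'a measure" +
  fixes R :: "real \<Rightarrow> 'a \<Rightarrow> real"
  assumes levy: "levy_process M R"
begin

definition path where "path \<omega> = (\<lambda>t\<in>{0..}. R t \<omega>)"

lemma R_measurable[measurable (raw)]: "0 \<le> t \<Longrightarrow> R t \<in> borel_measurable M"
  using levy by (simp add: levy_process_def)

lemma path_measurable[measurable]: "path \<in> M \<rightarrow>\<^sub>M (\<Pi>\<^sub>M t\<in>{0..}. borel)"
  unfolding path_def[abs_def] by (intro measurable_restrict R_measurable) auto

lemma R_zero: "AE \<omega> in M. R 0 \<omega> = 0"
  using levy by (simp add: levy_process_def)

lemma path_eval_R: "AE \<omega> in M. \<forall>s\<ge>0. path_eval (s, path \<omega>) = R s \<omega>"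
proof -
  have "AE \<omega> in M. cadlag (\<lambda>t. R t \<omega>)" using levy by (simp add: levy_process_def)
  then show ?thesis
    by eventually_elim (auto simp: path_def cadlag_def intro!: path_eval_right_continuous)
qed

text \<open>Valued in the extended half-line, so that multiplicativity in s can be used before
  finiteness is known.\<close>

definition laplace where "laplace p s = (\<integral>\<^sup>+\<omega>. ennreal (exp (- p * R s \<omega>)) \<partial>M)"

lemma laplace_zero: "laplace p 0 = 1"
proof -
  have "laplace p 0 = (\<integral>\<^sup>+\<omega>. 1 \<partial>M)"
    unfolding laplace_def using R_zero by (intro nn_integral_cong_AE) auto
  then show ?thesis by (simp add: emeasure_space_1)
qed

lemma laplace_add:
  assumes "0 \<le> s" "0 \<le> t"
  shows "laplace p (s + t) = laplace p s * laplace p t"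
proof -
  define tt where "tt i = (if i = 0 then 0 else if i = 1 then s else s + t)" for i :: nat
  have "0 \<le> tt 0" "mono tt" using assms by (auto simp: tt_def mono_def)
  then have "indep_vars (\<lambda>_. borel) (\<lambda>i \<omega>. R (tt (Suc i)) \<omega> - R (tt i) \<omega>) {..<2}"
    using levy unfolding levy_process_def by blast
  then have ind: "indep_vars (\<lambda>_. borel) (\<lambda>i \<omega>. ennreal (exp (- p * (R (tt (Suc i)) \<omega> - R (tt i) \<omega>)))) {..<2}"
    by (rule indep_vars_compose2) simp
  have two: "{..<2} = {0, 1::nat}" by auto
  have prod: "(\<Prod>i<2. ennreal (exp (- p * (R (tt (Suc i)) \<omega> - R (tt i) \<omega>)))) = ennreal (exp (- p * R (s + t) \<omega>))"
    if "R 0 \<omega> = 0" for \<omega>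
    using that by (simp add: two tt_def ennreal_mult[symmetric] exp_add[symmetric] algebra_simps)
  have "laplace p (s + t) = (\<integral>\<^sup>+\<omega>. (\<Prod>i<2. ennreal (exp (- p * (R (tt (Suc i)) \<omega> - R (tt i) \<omega>)))) \<partial>M)"
    unfolding laplace_def
    by (rule nn_integral_cong_AE) (use R_zero in eventually_elim, rule prod[symmetric])
  also have "\<dots> = (\<Prod>i<2. \<integral>\<^sup>+\<omega>. ennreal (exp (- p * (R (tt (Suc i)) \<omega> - R (tt i) \<omega>))) \<partial>M)"
    by (rule indep_vars_nn_integral[OF _ ind]) auto
  also have "\<dots> = (\<integral>\<^sup>+\<omega>. ennreal (exp (- p * (R s \<omega> - R 0 \<omega>))) \<partial>M) * (\<integral>\<^sup>+\<omega>. ennreal (exp (- p * (R (s + t) \<omega> - R s \<omega>))) \<partial>M)"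
    by (simp add: two tt_def)
  also have "(\<integral>\<^sup>+\<omega>. ennreal (exp (- p * (R s \<omega> - R 0 \<omega>))) \<partial>M) = laplace p s"
    unfolding laplace_def using R_zero by (intro nn_integral_cong_AE) auto
  also have "(\<integral>\<^sup>+\<omega>. ennreal (exp (- p * (R (s + t) \<omega> - R s \<omega>))) \<partial>M) = laplace p t"
  proof -
    have eq: "distr M borel (\<lambda>\<omega>. R (s + t) \<omega> - R s \<omega>) = distr M borel (R t)"
      using levy assms by (simp add: levy_process_def)
    have "(\<integral>\<^sup>+\<omega>. ennreal (exp (- p * (R (s + t) \<omega> - R s \<omega>))) \<partial>M) = (\<integral>\<^sup>+x. ennreal (exp (- p * x)) \<partial>distr M borel (\<lambda>\<omega>. R (s + t) \<omega> - R s \<omega>))"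
      using assms by (subst nn_integral_distr) auto
    also have "\<dots> = laplace p t"
      unfolding eq laplace_def using assms by (subst nn_integral_distr) auto
    finally show ?thesis .
  qed
  finally show ?thesis .
qed

lemma laplace_of_nat_mult:
  assumes "0 \<le> s"
  shows "laplace p (real k * s) = laplace p s ^ k"
proof (induction k)
  case (Suc k)
  have "laplace p (real (Suc k) * s) = laplace p (s + real k * s)" by (simp add: algebra_simps)
  also have "\<dots> = laplace p s * laplace p (real k * s)" using assms by (intro laplace_add) auto
  finally show ?case using Suc by simp
qed (simp add: laplace_zero)

text \<open>The n-th power of the value at j/n is the j-th power of the value at 1, so
  multiplicativity alone settles rational times.\<close>

lemma laplace_rational_less_one:
  assumes "laplace p 1 < 1" "0 < n" "0 < j"
  shows "laplace p (real j / real n) < 1"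
proof (rule ccontr)
  assume "\<not> laplace p (real j / real n) < 1"
  then have "1 \<le> laplace p (real j / real n) ^ n" by (simp add: one_le_power not_less)
  also have "\<dots> = laplace p (real j * 1)" using laplace_of_nat_mult[of "real j / real n" p n] assms by simp
  also have "\<dots> = laplace p 1 ^ j" by (rule laplace_of_nat_mult) simp
  also have "\<dots> \<le> laplace p 1 ^ 1"
    using assms by (cases j) (auto intro!: mult_left_le power_le_one simp: less_imp_le)
  finally show False using assms by simp
qed

text \<open>Right-continuous paths and Fatou's lemma along rational times decreasing to s. Passing
  to the limit loses the strict inequality; \<open>laplace_less_one\<close> restores it by splitting
  off a short rational time.\<close>

lemma laplace_le_one:
  assumes "laplace p 1 < 1" "0 \<le> s"
  shows "laplace p s \<le> 1"
proof -
  have "laplace p s = (\<integral>\<^sup>+\<omega>. liminf (\<lambda>n. ennreal (exp (- p * R (right_grid n s) \<omega>))) \<partial>M)"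
    unfolding laplace_def
  proof (rule nn_integral_cong_AE)
    have "AE \<omega> in M. cadlag (\<lambda>t. R t \<omega>)" using levy by (simp add: levy_process_def)
    then show "AE \<omega> in M. ennreal (exp (- p * R s \<omega>)) = liminf (\<lambda>n. ennreal (exp (- p * R (right_grid n s) \<omega>)))"
    proof eventually_elim
      case (elim \<omega>)
      then have "((\<lambda>t. R t \<omega>) \<longlongrightarrow> R s \<omega>) (at_right s)" using assms by (simp add: cadlag_def)
      then have "(\<lambda>n. R (right_grid n s) \<omega>) \<longlonglongrightarrow> R s \<omega>"
        by (rule filterlim_compose[OF _ right_grid_tendsto(2)[OF assms(2)]])
      then have "(\<lambda>n. ennreal (exp (- p * R (right_grid n s) \<omega>))) \<longlonglongrightarrow> ennreal (exp (- p * R s \<omega>))"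
        by (intro tendsto_intros)
      then show ?case by (rule lim_imp_Liminf[OF sequentially_bot, symmetric])
    qed
  qed
  also have "\<dots> \<le> liminf (\<lambda>n. laplace p (right_grid n s))"
    unfolding laplace_def using right_grid_pos[of _ s]
    by (intro nn_integral_liminf) (auto intro!: R_measurable simp: less_imp_le)
  also have "\<dots> \<le> 1"
  proof -
    have "laplace p (right_grid n s) < 1" for n
      using laplace_rational_less_one[OF assms(1), of "Suc n" "Suc (nat \<lfloor>real (Suc n) * s\<rfloor>)"]
      by (simp add: right_grid_def add.commute)
    then show ?thesis by (intro Liminf_le) (auto intro!: always_eventually less_imp_le)
  qed
  finally show ?thesis .
qed

lemma laplace_less_one:
  assumes "laplace p 1 < 1" "0 < s"
  shows "laplace p s < 1"
proof -
  obtain n where n: "n > 0" "1 / real n < s" using assms(2) by (metis nat_approx_posE of_nat_0_less_iff zero_less_Suc)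
  have "laplace p s = laplace p (1 / real n + (s - 1 / real n))" by simp
  also have "\<dots> = laplace p (1 / real n) * laplace p (s - 1 / real n)" using n by (intro laplace_add) auto
  also have "\<dots> \<le> laplace p (1 / real n) * 1" using n assms by (intro mult_left_mono laplace_le_one) auto
  also have "\<dots> < 1" using laplace_rational_less_one[OF assms(1) n(1), of 1] by simp
  finally show ?thesis .
qed

end

text \<open>\<open>X\<close> and the path may depend on each other; only the random time is
  independent of the pair. The product formula is spelled out because the two sides have different
  types.\<close>

locale levy_time = levy M R for M :: "'a measure" and R +
  fixes X :: "'a \<Rightarrow> 'b :: topological_space" and T :: "'a \<Rightarrow> real"
  assumes X[measurable]: "X \<in> borel_measurable M" and T[measurable]: "T \<in> borel_measurable M"
    and T_nonneg: "\<omega> \<in> space M \<Longrightarrow> 0 \<le> T \<omega>"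
    and independent: "C \<in> sets borel \<Longrightarrow> B \<in> sets (borel \<Otimes>\<^sub>M (\<Pi>\<^sub>M t\<in>{0..}. borel)) \<Longrightarrow>
      prob ((T -` C \<inter> space M) \<inter> ((\<lambda>\<omega>. (X \<omega>, path \<omega>)) -` B \<inter> space M)) =
      prob (T -` C \<inter> space M) * prob ((\<lambda>\<omega>. (X \<omega>, path \<omega>)) -` B \<inter> space M)"
begin

lemma R_T_eq: "AE \<omega> in M. path_eval (T \<omega>, path \<omega>) = R (T \<omega>) \<omega>"
  using path_eval_R AE_space by eventually_elim (simp add: T_nonneg)

lemma path_eval_path_measurable[measurable]: "(\<lambda>\<omega>. path_eval (s, path \<omega>)) \<in> borel_measurable M"
  by (rule measurable_compose[OF _ path_eval_measurable]) measurable

lemma section_measurable: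
  assumes F[measurable]: "F \<in> borel_measurable (borel \<Otimes>\<^sub>M borel)"
  shows "(\<lambda>s. \<integral>\<^sup>+\<omega>. F (X \<omega>, path_eval (s, path \<omega>)) \<partial>M) \<in> borel_measurable borel"
proof -
  have [measurable]: "(\<lambda>z. path_eval (fst z, path (snd z))) \<in> borel_measurable (borel \<Otimes>\<^sub>M M)"
    by (rule measurable_compose[OF _ path_eval_measurable]) measurable
  show ?thesis by measurable
qed

lemma section_eq: "0 \<le> s \<Longrightarrow> (\<integral>\<^sup>+\<omega>. F (X \<omega>, path_eval (s, path \<omega>)) \<partial>M) = (\<integral>\<^sup>+\<omega>. F (X \<omega>, R s \<omega>) \<partial>M)"
  using path_eval_R by (intro nn_integral_cong_AE) auto

text \<open>\<open>R\<close> is not assumed jointly measurable in time and outcome.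
  \<open>path_eval\<close> is measurable in time and path and almost surely agrees with
  \<open>R\<close> at all times simultaneously, so Fubini is applied to it.\<close>

lemma fubini_time:
  assumes F[measurable]: "F \<in> borel_measurable (borel \<Otimes>\<^sub>M borel)"
  shows "(\<integral>\<^sup>+\<omega>. F (X \<omega>, R (T \<omega>) \<omega>) \<partial>M) = (\<integral>\<^sup>+\<omega>. \<integral>\<^sup>+\<omega>'. F (X \<omega>', R (T \<omega>) \<omega>') \<partial>M \<partial>M)"
proof -
  define f where "f = (\<lambda>(s, x, r). F (x, path_eval (s, r)))"
  have f[measurable]: "f \<in> borel_measurable (borel \<Otimes>\<^sub>M (borel \<Otimes>\<^sub>M (\<Pi>\<^sub>M t\<in>{0..}. borel)))"
  proof -
    have [measurable]: "(\<lambda>z. path_eval (fst z, snd (snd z))) \<in> borel_measurable (borel \<Otimes>\<^sub>M ((borel :: 'b measure) \<Otimes>\<^sub>M (\<Pi>\<^sub>M t\<in>{0..}. borel)))"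
      by (rule measurable_compose[OF _ path_eval_measurable]) measurable
    show ?thesis unfolding f_def case_prod_beta by measurable
  qed
  have "(\<integral>\<^sup>+\<omega>. F (X \<omega>, R (T \<omega>) \<omega>) \<partial>M) = (\<integral>\<^sup>+\<omega>. f (T \<omega>, (X \<omega>, path \<omega>)) \<partial>M)"
    using R_T_eq by (intro nn_integral_cong_AE) (auto simp: f_def)
  also have "\<dots> = (\<integral>\<^sup>+\<omega>. \<integral>\<^sup>+\<omega>'. f (T \<omega>, (X \<omega>', path \<omega>')) \<partial>M \<partial>M)"
    by (rule nn_integral_indep[OF T _ _ f]) (measurable, rule independent)
  also have "\<dots> = (\<integral>\<^sup>+\<omega>. \<integral>\<^sup>+\<omega>'. F (X \<omega>', R (T \<omega>) \<omega>') \<partial>M \<partial>M)"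
  proof (rule nn_integral_cong)
    fix \<omega> assume "\<omega> \<in> space M"
    then show "(\<integral>\<^sup>+\<omega>'. f (T \<omega>, (X \<omega>', path \<omega>')) \<partial>M) = (\<integral>\<^sup>+\<omega>'. F (X \<omega>', R (T \<omega>) \<omega>') \<partial>M)"
      using section_eq[OF T_nonneg, of \<omega> F] by (simp add: f_def)
  qed
  finally show ?thesis .
qed

lemma exp_R_T_moment:
  "(\<integral>\<^sup>+\<omega>. ennreal (exp (- q * R (T \<omega>) \<omega>)) \<partial>M) = (\<integral>\<^sup>+\<omega>. laplace q (T \<omega>) \<partial>M)"
  using fubini_time[of "\<lambda>z. ennreal (exp (- q * snd z))"] by (simp add: laplace_def)

lemma laplace_measurable: "(\<lambda>\<omega>. laplace q (T \<omega>)) \<in> borel_measurable M"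
proof -
  have "(\<lambda>s. \<integral>\<^sup>+\<omega>. ennreal (exp (- q * path_eval (s, path \<omega>))) \<partial>M) \<in> borel_measurable borel"
    using section_measurable[of "\<lambda>z. ennreal (exp (- q * snd z))"] by simp
  from measurable_compose[OF T this]
  have "(\<lambda>\<omega>. \<integral>\<^sup>+\<omega>'. ennreal (exp (- q * path_eval (T \<omega>, path \<omega>'))) \<partial>M) \<in> borel_measurable M" .
  then show ?thesis
    using section_eq[of _ "\<lambda>z. ennreal (exp (- q * snd z))"] T_nonneg
    by (subst measurable_cong[where g="\<lambda>\<omega>. \<integral>\<^sup>+\<omega>'. ennreal (exp (- q * path_eval (T \<omega>, path \<omega>'))) \<partial>M"])
       (auto simp: laplace_def)
qed

text \<open>The Laplace transform is at most 1 at every time and strictly smaller at positive times;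
  mean 1 would force \<open>T = 0\<close> almost surely.\<close>

lemma exp_R_T_moment_less_one:
  assumes "laplace q 1 < 1" and pos: "prob {\<omega>\<in>space M. T \<omega> > 0} > 0"
  shows "(\<integral>\<^sup>+\<omega>. ennreal (exp (- q * R (T \<omega>) \<omega>)) \<partial>M) < 1"
proof -
  note [measurable] = laplace_measurable
  have le: "laplace q (T \<omega>) \<le> 1" if "\<omega> \<in> space M" for \<omega>
    using laplace_le_one[OF assms(1) T_nonneg[OF that]] .
  have "(\<integral>\<^sup>+\<omega>. laplace q (T \<omega>) \<partial>M) \<le> (\<integral>\<^sup>+\<omega>. 1 \<partial>M)"
    by (intro nn_integral_mono le)
  then have le1: "(\<integral>\<^sup>+\<omega>. laplace q (T \<omega>) \<partial>M) \<le> 1" by (simp add: emeasure_space_1)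
  have "(\<integral>\<^sup>+\<omega>. laplace q (T \<omega>) \<partial>M) \<noteq> 1"
  proof
    assume 1: "(\<integral>\<^sup>+\<omega>. laplace q (T \<omega>) \<partial>M) = 1"
    have "(\<integral>\<^sup>+\<omega>. 1 - laplace q (T \<omega>) \<partial>M) = (\<integral>\<^sup>+\<omega>. 1 \<partial>M) - (\<integral>\<^sup>+\<omega>. laplace q (T \<omega>) \<partial>M)"
      using 1 le by (intro nn_integral_diff) (auto intro!: AE_I2)
    then have "(\<integral>\<^sup>+\<omega>. 1 - laplace q (T \<omega>) \<partial>M) = 0" using 1 by (simp add: emeasure_space_1)
    then have "AE \<omega> in M. 1 - laplace q (T \<omega>) = 0" by (subst (asm) nn_integral_0_iff_AE) auto
    then have "AE \<omega> in M. \<not> T \<omega> > 0"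
      using AE_space
    proof eventually_elim
      case (elim \<omega>)
      then show ?case using laplace_less_one[OF assms(1), of "T \<omega>"] by (auto simp: diff_eq_0_iff_ennreal)
    qed
    then have "prob {\<omega>\<in>space M. T \<omega> > 0} = 0"
      by (subst prob_eq_0) (auto elim!: eventually_mono)
    then show False using pos by simp
  qed
  then show ?thesis unfolding exp_R_T_moment using le1 by (simp add: less_le)
qed

end

section \<open>From point conditioning to the joint law\<close>

lemma support_closed_null:
  assumes fin: "finite_measure Q" and sQ: "sets Q = sets borel"
  shows "closed (support Q)" "emeasure Q (- support Q) = 0"
proof -
  interpret finite_measure Q by fact
  define \<U> where "\<U> = {U. open U \<and> measure Q U = 0}"
  have eq: "- support Q = \<Union>\<U>"
    by (auto simp: support_def \<U>_def) (metis measure_nonneg order_le_less)+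
  then have "open (- support Q)" by (auto simp: \<U>_def)
  then show "closed (support Q)" by (simp add: closed_def)
  obtain \<V> where \<V>: "\<V> \<subseteq> \<U>" "countable \<V>" "\<Union>\<V> = \<Union>\<U>"
    using Lindelof[of \<U>] by (auto simp: \<U>_def)
  have "(\<Union>U\<in>\<V>. U) \<in> null_sets Q"
    using \<V> by (intro null_sets_UN') (auto simp: null_sets_def \<U>_def sQ emeasure_eq_measure)
  then show "emeasure Q (- support Q) = 0" using eq \<V> by (simp add: null_sets_def)
qed

lemma support_interval_pos:
  assumes "finite_measure Q" "sets Q = sets borel" "y \<in> support Q" "0 < a"
  shows "0 < measure Q {y - a..y + a}"
proof -
  interpret finite_measure Q by fact
  have "0 < measure Q {y - a<..<y + a}" using assms(3,4) by (auto simp: support_def)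
  also have "\<dots> \<le> measure Q {y - a..y + a}" using assms(2) by (intro finite_measure_mono) auto
  finally show ?thesis .
qed

lemma point_cond_prob_eq:
  assumes "charged M U V y s" "has_cond_prob M P U V y s c"
  shows "point_cond_prob M P U V y s = c"
proof -
  have "(THE c. has_cond_prob M P U V y s c) = c"
  proof (rule the_equality)
    show "has_cond_prob M P U V y s c" by (rule assms(2))
  next
    fix c' assume "has_cond_prob M P U V y s c'"
    then show "c' = c"
      using assms(2) unfolding has_cond_prob_def
      by (rule tendsto_unique[rotated]) (simp add: prod_filter_eq_bot)
  qed
  then show ?thesis using assms(1) by (simp add: point_cond_prob_def)
qed

context levy_time
begin

definition Y where "Y \<omega> = exp (- R (T \<omega>) \<omega>)"
definition slice where "slice s = distr M borel (\<lambda>\<omega>. exp (- R s \<omega>))"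
text \<open>For a fixed time s, the part of the law \<open>slice s\<close> carried by the event that
  \<open>X\<close> lies in D. It is dominated by \<open>slice s\<close>, and its symmetric
  derivative with respect to \<open>slice s\<close> is the conditional probability in hypothesis
  (2).\<close>

definition slice_on where "slice_on D s = distr (density M (\<lambda>\<omega>. indicator D (X \<omega>))) borel (\<lambda>\<omega>. exp (- R s \<omega>))"

lemma exp_R_measurable[measurable (raw)]: "0 \<le> s \<Longrightarrow> (\<lambda>\<omega>. exp (- R s \<omega>)) \<in> borel_measurable M"
  using R_measurable by measurable

lemma emeasure_slice:
  assumes "0 \<le> s" "B \<in> sets borel"
  shows "emeasure (slice s) B = emeasure M {\<omega>\<in>space M. exp (- R s \<omega>) \<in> B}"
  using assms unfolding slice_def by (subst emeasure_distr) (auto intro!: arg_cong[where f="emeasure M"])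

lemma measure_slice:
  assumes "0 \<le> s" "B \<in> sets borel"
  shows "measure (slice s) B = \<P>(\<omega> in M. exp (- R s \<omega>) \<in> B)"
  using emeasure_slice[OF assms] by (simp add: measure_def)

lemma emeasure_slice_on:
  assumes "0 \<le> s" "B \<in> sets borel" "D \<in> sets borel"
  shows "emeasure (slice_on D s) B = emeasure M {\<omega>\<in>space M. X \<omega> \<in> D \<and> exp (- R s \<omega>) \<in> B}"
proof -
  note [measurable] = assms(2,3) exp_R_measurable[OF assms(1)]
  have 1: "(\<lambda>\<omega>. exp (- R s \<omega>)) -` B \<inter> space M \<in> sets M" by measurable
  have "emeasure (slice_on D s) B = (\<integral>\<^sup>+\<omega>. indicator D (X \<omega>) * indicator ((\<lambda>\<omega>. exp (- R s \<omega>)) -` B \<inter> space M) \<omega> \<partial>M)"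
    using 1 unfolding slice_on_def
    by (subst emeasure_distr) (auto simp: emeasure_density)
  also have "\<dots> = (\<integral>\<^sup>+\<omega>. indicator {\<omega>\<in>space M. X \<omega> \<in> D \<and> exp (- R s \<omega>) \<in> B} \<omega> \<partial>M)"
    by (intro nn_integral_cong) (auto simp: indicator_def)
  finally show ?thesis by simp
qed

lemma measure_slice_on:
  assumes "0 \<le> s" "B \<in> sets borel" "D \<in> sets borel"
  shows "measure (slice_on D s) B = \<P>(\<omega> in M. X \<omega> \<in> D \<and> exp (- R s \<omega>) \<in> B)"
  using emeasure_slice_on[OF assms] by (simp add: measure_def)

lemma sets_slice: "sets (slice s) = sets borel" "sets (slice_on D s) = sets borel"
  by (simp_all add: slice_def slice_on_def)

lemma finite_slice:
  assumes "0 \<le> s"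
  shows "finite_measure (slice s)" "D \<in> sets borel \<Longrightarrow> finite_measure (slice_on D s)"
  using emeasure_slice[OF assms, of UNIV] emeasure_slice_on[OF assms, of UNIV D]
  by (auto intro!: finite_measureI simp: slice_def slice_on_def)

lemma independent_slice:
  assumes s: "0 \<le> s" and B: "B \<in> sets borel" and D: "D \<in> sets borel" and J: "J \<in> sets borel"
  shows "\<P>(\<omega> in M. X \<omega> \<in> D \<and> exp (- R s \<omega>) \<in> B \<and> T \<omega> \<in> J) = \<P>(\<omega> in M. X \<omega> \<in> D \<and> exp (- R s \<omega>) \<in> B) * \<P>(\<omega> in M. T \<omega> \<in> J)"
proof -
  note [measurable] = B D J
  let ?N = "borel \<Otimes>\<^sub>M (\<Pi>\<^sub>M t\<in>{0..}. borel) :: ('b \<times> (real \<Rightarrow> real)) measure"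
  have [measurable]: "(\<lambda>z. snd z s) \<in> borel_measurable ?N"
    using s by (intro measurable_compose[OF measurable_snd measurable_component_singleton]) auto
  define C where "C = {z\<in>space ?N. fst z \<in> D \<and> exp (- snd z s) \<in> B}"
  have C: "C \<in> sets ?N" unfolding C_def by measurable
  have sp: "(X \<omega>, path \<omega>) \<in> space ?N" if "\<omega> \<in> space M" for \<omega>
    using measurable_space[OF path_measurable that] by (simp add: space_pair_measure)
  have eq: "(\<lambda>\<omega>. (X \<omega>, path \<omega>)) -` C \<inter> space M = {\<omega>\<in>space M. X \<omega> \<in> D \<and> exp (- R s \<omega>) \<in> B}"
    using sp s by (auto simp: C_def path_def)
  have "{\<omega>\<in>space M. X \<omega> \<in> D \<and> exp (- R s \<omega>) \<in> B \<and> T \<omega> \<in> J} = (T -` J \<inter> space M) \<inter> ((\<lambda>\<omega>. (X \<omega>, path \<omega>)) -` C \<inter> space M)"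
    unfolding eq by auto
  then show ?thesis
    using independent[OF J C] unfolding eq by (simp add: vimage_def Int_def conj_commute mult.commute)
qed

text \<open>The time window is independent of \<open>X\<close> and of \<open>R s\<close>, so its
  probability cancels; neither side depends on b any more.\<close>

lemma cond_prob_slice:
  assumes s: "0 \<le> s" and D: "D \<in> sets borel" and ab: "0 < \<P>(\<omega> in M. T \<omega> \<in> {s - b..s + b})"
  shows "\<P>(\<omega> in M. X \<omega> \<in> D \<bar> exp (- R s \<omega>) \<in> {y - a..y + a} \<and> T \<omega> \<in> {s - b..s + b}) =
    measure (slice_on D s) {y - a..y + a} / measure (slice s) {y - a..y + a}"
  using independent_slice[OF s, of "{y - a..y + a}" D "{s - b..s + b}"]
    independent_slice[OF s, of "{y - a..y + a}" UNIV "{s - b..s + b}"] ab s D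
  by (simp add: cond_prob_def measure_slice measure_slice_on)

lemma charged_slice:
  assumes s: "0 \<le> s" and y: "y \<in> support (slice s)" and sT: "s \<in> support (distr M borel T)"
  shows "charged M (\<lambda>\<omega>. exp (- R s \<omega>)) T y s" "\<And>b. 0 < b \<Longrightarrow> 0 < \<P>(\<omega> in M. T \<omega> \<in> {s - b..s + b})"
proof -
  show T0: "0 < \<P>(\<omega> in M. T \<omega> \<in> {s - b..s + b})" if "0 < b" for b
  proof -
    have "finite_measure (distr M borel T)" by (intro finite_measure_distr) simp
    from support_interval_pos[OF this _ sT that] show ?thesis
      by (simp add: measure_distr vimage_def Int_def conj_commute)
  qed
  have "0 < \<P>(\<omega> in M. exp (- R s \<omega>) \<in> {y - a..y + a})" if "0 < a" for a
    using support_interval_pos[OF finite_slice(1)[OF s] sets_slice(1) y that] s by (simp add: measure_slice)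
  then show "charged M (\<lambda>\<omega>. exp (- R s \<omega>)) T y s"
    unfolding charged_def using independent_slice[OF s, of "{y - _..y + _}" UNIV "{s - _..s + _}"] T0
    by (simp del: atLeastAtMost_iff)
qed

lemma has_cond_prob_slice:
  assumes s: "0 \<le> s" and D: "D \<in> sets borel"
    and T0: "\<And>b. 0 < b \<Longrightarrow> 0 < \<P>(\<omega> in M. T \<omega> \<in> {s - b..s + b})"
    and c: "has_cond_prob M (\<lambda>\<omega>. X \<omega> \<in> D) (\<lambda>\<omega>. exp (- R s \<omega>)) T y s c"
  shows "((\<lambda>a. measure (slice_on D s) {y - a..y + a} / measure (slice s) {y - a..y + a}) \<longlongrightarrow> c) (at_right 0)"
proof -
  \<comment> \<open>The double limit is restricted to the diagonal b = a, which yields a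
    one-parameter symmetric derivative.\<close>
  have "filterlim (\<lambda>a::real. (a, a)) (at_right 0 \<times>\<^sub>F at_right 0) (at_right 0)"
    by (intro filterlim_Pair filterlim_ident)
  from filterlim_compose[OF c[unfolded has_cond_prob_def] this]
  have "((\<lambda>a. \<P>(\<omega> in M. X \<omega> \<in> D \<bar> exp (- R s \<omega>) \<in> {y - a..y + a} \<and> T \<omega> \<in> {s - a..s + a})) \<longlongrightarrow> c) (at_right 0)"
    by simp
  moreover have "\<forall>\<^sub>F a in at_right 0. \<P>(\<omega> in M. X \<omega> \<in> D \<bar> exp (- R s \<omega>) \<in> {y - a..y + a} \<and> T \<omega> \<in> {s - a..s + a}) =
      measure (slice_on D s) {y - a..y + a} / measure (slice s) {y - a..y + a}"
    using eventually_at_right_less[of 0] by eventually_elim (use cond_prob_slice[OF s D T0] in blast)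
  ultimately show ?thesis by (rule Lim_transform_eventually)
qed

lemma emeasure_joint:
  assumes "D \<in> sets borel" "B \<in> sets borel" and Y[measurable]: "Y \<in> borel_measurable M"
  shows "emeasure M {\<omega>\<in>space M. X \<omega> \<in> D \<and> Y \<omega> \<in> B} = (\<integral>\<^sup>+\<omega>. emeasure (slice_on D (T \<omega>)) B \<partial>M)"
proof -
  note [measurable] = assms
  define F :: "'b \<times> real \<Rightarrow> ennreal" where "F z = indicator D (fst z) * indicator B (exp (- snd z))" for z
  have F[measurable]: "F \<in> borel_measurable (borel \<Otimes>\<^sub>M borel)" unfolding F_def[abs_def] by measurable
  have "emeasure M {\<omega>\<in>space M. X \<omega> \<in> D \<and> Y \<omega> \<in> B} = (\<integral>\<^sup>+\<omega>. indicator {\<omega>\<in>space M. X \<omega> \<in> D \<and> Y \<omega> \<in> B} \<omega> \<partial>M)"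
    by simp
  also have "\<dots> = (\<integral>\<^sup>+\<omega>. F (X \<omega>, R (T \<omega>) \<omega>) \<partial>M)"
    by (intro nn_integral_cong) (auto simp: F_def Y_def indicator_def)
  also have "\<dots> = (\<integral>\<^sup>+\<omega>. \<integral>\<^sup>+\<omega>'. F (X \<omega>', R (T \<omega>) \<omega>') \<partial>M \<partial>M)"
    by (rule fubini_time[OF F])
  also have "\<dots> = (\<integral>\<^sup>+\<omega>. emeasure (slice_on D (T \<omega>)) B \<partial>M)"
  proof (rule nn_integral_cong)
    fix \<omega> assume \<omega>: "\<omega> \<in> space M"
    note [measurable] = exp_R_measurable[OF T_nonneg[OF \<omega>]]
    have "(\<integral>\<^sup>+\<omega>'. F (X \<omega>', R (T \<omega>) \<omega>') \<partial>M) = (\<integral>\<^sup>+\<omega>'. indicator {\<omega>'\<in>space M. X \<omega>' \<in> D \<and> exp (- R (T \<omega>) \<omega>') \<in> B} \<omega>' \<partial>M)"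
      by (intro nn_integral_cong) (auto simp: F_def indicator_def)
    then show "(\<integral>\<^sup>+\<omega>'. F (X \<omega>', R (T \<omega>) \<omega>') \<partial>M) = emeasure (slice_on D (T \<omega>)) B"
      using assms by (simp add: emeasure_slice_on[OF T_nonneg[OF \<omega>]])
  qed
  finally show ?thesis .
qed

lemma nn_integral_Y:
  assumes k[measurable]: "k \<in> borel_measurable borel"
  shows "(\<integral>\<^sup>+\<omega>. k (Y \<omega>) \<partial>M) = (\<integral>\<^sup>+\<omega>. (\<integral>\<^sup>+y. k y \<partial>slice (T \<omega>)) \<partial>M)"
proof -
  define F :: "'b \<times> real \<Rightarrow> ennreal" where "F z = k (exp (- snd z))" for z
  have F[measurable]: "F \<in> borel_measurable (borel \<Otimes>\<^sub>M borel)" unfolding F_def[abs_def] by measurable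
  have "(\<integral>\<^sup>+\<omega>. k (Y \<omega>) \<partial>M) = (\<integral>\<^sup>+\<omega>. F (X \<omega>, R (T \<omega>) \<omega>) \<partial>M)"
    by (simp add: F_def Y_def)
  also have "\<dots> = (\<integral>\<^sup>+\<omega>. \<integral>\<^sup>+\<omega>'. F (X \<omega>', R (T \<omega>) \<omega>') \<partial>M \<partial>M)"
    by (rule fubini_time[OF F])
  also have "\<dots> = (\<integral>\<^sup>+\<omega>. (\<integral>\<^sup>+y. k y \<partial>slice (T \<omega>)) \<partial>M)"
  proof (rule nn_integral_cong)
    fix \<omega> assume \<omega>: "\<omega> \<in> space M"
    note [measurable] = exp_R_measurable[OF T_nonneg[OF \<omega>]]
    show "(\<integral>\<^sup>+\<omega>'. F (X \<omega>', R (T \<omega>) \<omega>') \<partial>M) = (\<integral>\<^sup>+y. k y \<partial>slice (T \<omega>))"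
      unfolding slice_def by (subst nn_integral_distr) (auto simp: F_def)
  qed
  finally show ?thesis .
qed

lemma slice_null_measurable:
  assumes B: "B \<in> sets borel"
  shows "(\<lambda>\<omega>. emeasure (slice (T \<omega>)) B) \<in> borel_measurable M"
proof -
  note [measurable] = B
  have "(\<lambda>s. \<integral>\<^sup>+\<omega>. indicator B (exp (- path_eval (s, path \<omega>))) \<partial>M) \<in> borel_measurable borel"
    using section_measurable[of "\<lambda>z. indicator B (exp (- snd z))"] by simp
  from measurable_compose[OF T this]
  have "(\<lambda>\<omega>. \<integral>\<^sup>+\<omega>'. indicator B (exp (- path_eval (T \<omega>, path \<omega>'))) \<partial>M) \<in> borel_measurable M" .
  moreover have "emeasure (slice (T \<omega>)) B = (\<integral>\<^sup>+\<omega>'. indicator B (exp (- path_eval (T \<omega>, path \<omega>'))) \<partial>M)" if \<omega>: "\<omega> \<in> space M" for \<omega>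
  proof -
    note [measurable] = exp_R_measurable[OF T_nonneg[OF \<omega>]]
    have "emeasure (slice (T \<omega>)) B = (\<integral>\<^sup>+\<omega>'. indicator {\<omega>'\<in>space M. exp (- R (T \<omega>) \<omega>') \<in> B} \<omega>' \<partial>M)"
      using B by (simp add: emeasure_slice[OF T_nonneg[OF \<omega>]])
    also have "\<dots> = (\<integral>\<^sup>+\<omega>'. indicator B (exp (- R (T \<omega>) \<omega>')) \<partial>M)"
      by (intro nn_integral_cong) (auto simp: indicator_def)
    also have "\<dots> = (\<integral>\<^sup>+\<omega>'. indicator B (exp (- path_eval (T \<omega>, path \<omega>'))) \<partial>M)"
      using section_eq[OF T_nonneg[OF \<omega>], of "\<lambda>z. indicator B (exp (- snd z))"] by simp
    finally show ?thesis .
  qed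
  ultimately show ?thesis by (subst measurable_cong)
qed

text \<open>For almost every value s of the time, s lies in \<Lambda> and in the support of the
  time, so the conditioning is charged wherever \<open>slice s\<close> is supported, and
  \<open>slice s\<close> is carried by the support of the law of \<open>Y\<close>. The derivative
  bounds thus hold slice by slice, and integrating over the time gives the joint law.\<close>

lemma joint_law_bounds:
  assumes D: "D \<in> sets borel" and Y[measurable]: "Y \<in> borel_measurable M"
    and k[measurable]: "k1 \<in> borel_measurable borel" "k2 \<in> borel_measurable borel"
    and \<Lambda>: "AE \<omega> in M. T \<omega> \<in> \<Lambda>"
    and cp: "\<And>s y. s \<in> \<Lambda> \<Longrightarrow> y \<in> support (distr M borel Y) \<Longrightarrow> charged M (\<lambda>\<omega>. exp (- R s \<omega>)) T y s \<Longrightarrow>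
      \<exists>c. has_cond_prob M (\<lambda>\<omega>. X \<omega> \<in> D) (\<lambda>\<omega>. exp (- R s \<omega>)) T y s c \<and> k1 y \<le> c \<and> c \<le> k2 y"
    and B[measurable]: "B \<in> sets borel"
  shows "(\<integral>\<^sup>+\<omega>. ennreal (k1 (Y \<omega>)) * indicator B (Y \<omega>) \<partial>M) \<le> emeasure M {\<omega>\<in>space M. X \<omega> \<in> D \<and> Y \<omega> \<in> B}" (is ?lo)
    and "emeasure M {\<omega>\<in>space M. X \<omega> \<in> D \<and> Y \<omega> \<in> B} \<le> (\<integral>\<^sup>+\<omega>. ennreal (k2 (Y \<omega>)) * indicator B (Y \<omega>) \<partial>M)" (is ?up)
proof -
  define S where "S = support (distr M borel Y)"
  have fQ: "finite_measure (distr M borel Y)" by (intro finite_measure_distr) simp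
  have S: "closed S" "emeasure (distr M borel Y) (- S) = 0"
    using support_closed_null[OF fQ] by (auto simp: S_def)
  have Sb[measurable]: "- S \<in> sets borel" using S(1) by simp
  have "(\<integral>\<^sup>+\<omega>. emeasure (slice (T \<omega>)) (- S) \<partial>M) = (\<integral>\<^sup>+\<omega>. indicator (- S) (Y \<omega>) \<partial>M)"
    using nn_integral_Y[of "indicator (- S)"] by (simp add: sets_slice)
  also have "\<dots> = (\<integral>\<^sup>+y. indicator (- S) y \<partial>distr M borel Y)" by (subst nn_integral_distr) auto
  also have "\<dots> = 0" using S by simp
  finally have ae1: "AE \<omega> in M. emeasure (slice (T \<omega>)) (- S) = 0"
    by (subst (asm) nn_integral_0_iff_AE) (auto intro!: slice_null_measurable)
  have fT: "finite_measure (distr M borel T)" by (intro finite_measure_distr) simp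
  have ae2: "AE \<omega> in M. T \<omega> \<in> support (distr M borel T)"
  proof -
    note ST = support_closed_null[OF fT]
    have "AE t in distr M borel T. t \<in> support (distr M borel T)"
      using ST by (intro AE_I[of _ _ "- support (distr M borel T)"]) auto
    then show ?thesis using ST(1) by (subst (asm) AE_distr_iff) auto
  qed
  have key: "AE \<omega> in M. (\<integral>\<^sup>+y. ennreal (k1 y) * indicator B y \<partial>slice (T \<omega>)) \<le> emeasure (slice_on D (T \<omega>)) B \<and>
      emeasure (slice_on D (T \<omega>)) B \<le> (\<integral>\<^sup>+y. ennreal (k2 y) * indicator B y \<partial>slice (T \<omega>))"
    using ae1 ae2 \<Lambda> AE_space
  proof eventually_elim
    case (elim \<omega>)
    define s where "s = T \<omega>"
    have s: "0 \<le> s" "s \<in> \<Lambda>" "s \<in> support (distr M borel T)" "emeasure (slice s) (- S) = 0"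
      using elim T_nonneg by (auto simp: s_def)
    note fin = finite_slice(1)[OF s(1)] finite_slice(2)[OF s(1) D]
    note supp = support_closed_null[OF fin(1) sets_slice(1)]
    \<comment> \<open>The limits are assumed on the support of \<open>Y\<close>, while positive
      interval masses and charged conditioning need the support of the slice; both sets have full
      \<open>slice s\<close> measure.\<close>
    define S' where "S' = S \<inter> support (slice s)"
    have S'b: "S' \<in> sets borel" using S(1) supp(1) by (simp add: S'_def)
    have "emeasure (slice s) (- S') \<le> emeasure (slice s) (- S) + emeasure (slice s) (- support (slice s))"
      unfolding S'_def Compl_Int using S(1) supp(1) by (intro emeasure_subadditive) (auto simp: sets_slice)
    then have S'0: "emeasure (slice s) (- S') = 0" using s(4) supp(2) by simp
    have le: "emeasure (slice_on D s) C \<le> emeasure (slice s) C" if "C \<in> sets borel" for C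
    proof -
      note [measurable] = that exp_R_measurable[OF s(1)] D
      show ?thesis unfolding emeasure_slice[OF s(1) that] emeasure_slice_on[OF s(1) that D]
        by (intro emeasure_mono) auto
    qed
    have pos: "0 < measure (slice s) {y - a..y + a}" if "y \<in> S'" "0 < a" for y a
      using support_interval_pos[OF fin(1) sets_slice(1)] that by (simp add: S'_def)
    have lim: "\<exists>c. ((\<lambda>a. measure (slice_on D s) {y - a..y + a} / measure (slice s) {y - a..y + a}) \<longlongrightarrow> c) (at_right 0)
        \<and> k1 y \<le> c \<and> c \<le> k2 y" if "y \<in> S'" for y
    proof -
      have y: "y \<in> support (slice s)" "y \<in> support (distr M borel Y)" using that by (auto simp: S'_def S_def)
      note ch = charged_slice[OF s(1) y(1) s(3)]
      obtain c where "has_cond_prob M (\<lambda>\<omega>. X \<omega> \<in> D) (\<lambda>\<omega>. exp (- R s \<omega>)) T y s c" "k1 y \<le> c" "c \<le> k2 y"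
        using cp[OF s(2) y(2) ch(1)] by blast
      then show ?thesis using has_cond_prob_slice[OF s(1) D ch(2)] by blast
    qed
    from density_bounds_of_symmetric_derivative[OF fin sets_slice le k S'b S'0 pos lim B]
    show ?case by (simp add: s_def)
  qed
  have J: "emeasure M {\<omega>\<in>space M. X \<omega> \<in> D \<and> Y \<omega> \<in> B} = (\<integral>\<^sup>+\<omega>. emeasure (slice_on D (T \<omega>)) B \<partial>M)"
    by (rule emeasure_joint[OF D B Y])
  have "(\<integral>\<^sup>+\<omega>. ennreal (k1 (Y \<omega>)) * indicator B (Y \<omega>) \<partial>M) = (\<integral>\<^sup>+\<omega>. \<integral>\<^sup>+y. ennreal (k1 y) * indicator B y \<partial>slice (T \<omega>) \<partial>M)"
    by (rule nn_integral_Y) simp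
  also have "\<dots> \<le> (\<integral>\<^sup>+\<omega>. emeasure (slice_on D (T \<omega>)) B \<partial>M)"
    using key by (intro nn_integral_mono_AE) (auto elim: eventually_mono)
  finally show ?lo unfolding J .
  have "(\<integral>\<^sup>+\<omega>. emeasure (slice_on D (T \<omega>)) B \<partial>M) \<le> (\<integral>\<^sup>+\<omega>. \<integral>\<^sup>+y. ennreal (k2 y) * indicator B y \<partial>slice (T \<omega>) \<partial>M)"
    using key by (intro nn_integral_mono_AE) (auto elim: eventually_mono)
  also have "\<dots> = (\<integral>\<^sup>+\<omega>. ennreal (k2 (Y \<omega>)) * indicator B (Y \<omega>) \<partial>M)"
    by (rule nn_integral_Y[symmetric]) simp
  finally show ?up unfolding J .
qed

end

lemma uniform_conditional_tail_bounds:
  assumes ut: "uniform_conditional_tail M X R \<theta> A h \<Lambda> S"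
    and pos: "\<forall>\<^sub>F x in at_top. 0 < \<P>(\<omega> in M. X \<omega> \<in> dilate x A)"
    and h: "\<And>y. y \<in> S \<Longrightarrow> 0 < h y" and e: "0 < e" and "prob_space M"
  shows "\<forall>\<^sub>F x in at_top. \<forall>s\<in>\<Lambda>. \<forall>y\<in>S. charged M (\<lambda>\<omega>. exp (- R s \<omega>)) \<theta> y s \<longrightarrow>
    (\<exists>c. has_cond_prob M (\<lambda>\<omega>. X \<omega> \<in> dilate x A) (\<lambda>\<omega>. exp (- R s \<omega>)) \<theta> y s c \<and>
      (1 - e) * \<P>(\<omega> in M. X \<omega> \<in> dilate x A) * h y \<le> c \<and> c \<le> (1 + e) * \<P>(\<omega> in M. X \<omega> \<in> dilate x A) * h y)"
proof -
  interpret prob_space M by fact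
  define dev where "dev x s y = \<bar>point_cond_prob M (\<lambda>\<omega>. X \<omega> \<in> dilate x A) (\<lambda>\<omega>. exp (- R s \<omega>)) \<theta> y s /
                 ((if charged M (\<lambda>\<omega>. exp (- R s \<omega>)) \<theta> y s then h y else 1) *
                   \<P>(\<omega> in M. X \<omega> \<in> dilate x A)) - 1\<bar>" for x s y
  have lim: "((\<lambda>x. SUP s\<in>\<Lambda>. SUP y\<in>S. ereal (dev x s y)) \<longlongrightarrow> 0) at_top"
    and ex: "\<forall>\<^sub>F x in at_top. \<forall>s\<in>\<Lambda>. \<forall>y\<in>S. charged M (\<lambda>\<omega>. exp (- R s \<omega>)) \<theta> y s \<longrightarrow>
        (\<exists>c. has_cond_prob M (\<lambda>\<omega>. X \<omega> \<in> dilate x A) (\<lambda>\<omega>. exp (- R s \<omega>)) \<theta> y s c)"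
    using ut unfolding uniform_conditional_tail_def dev_def by auto
  have "\<forall>\<^sub>F x in at_top. (SUP s\<in>\<Lambda>. SUP y\<in>S. ereal (dev x s y)) < ereal e"
    using e by (intro order_tendstoD(2)[OF lim]) simp
  then show ?thesis
    using ex pos
  proof eventually_elim
    case (elim x)
    show ?case
    proof (intro ballI impI)
      fix s y assume s: "s \<in> \<Lambda>" and y: "y \<in> S" and ch: "charged M (\<lambda>\<omega>. exp (- R s \<omega>)) \<theta> y s"
      obtain c where c: "has_cond_prob M (\<lambda>\<omega>. X \<omega> \<in> dilate x A) (\<lambda>\<omega>. exp (- R s \<omega>)) \<theta> y s c"
        using elim(2) s y ch by blast
      define F where "F = \<P>(\<omega> in M. X \<omega> \<in> dilate x A)"
      have F: "0 < F" "0 < h y * F" using elim(3) h[OF y] by (auto simp: F_def)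
      have "ereal (dev x s y) \<le> (SUP s\<in>\<Lambda>. SUP y\<in>S. ereal (dev x s y))"
        by (rule order.trans[OF SUP_upper[OF y] SUP_upper[OF s]])
      then have "dev x s y < e" using elim(1) by (metis ereal_less_eq(3) le_less_trans less_ereal.simps(1))
      moreover have "dev x s y = \<bar>c / (h y * F) - 1\<bar>"
        unfolding dev_def using ch point_cond_prob_eq[OF ch c] by (simp add: F_def)
      ultimately have "\<bar>c / (h y * F) - 1\<bar> < e" by simp
      then have "1 - e \<le> c / (h y * F) \<and> c / (h y * F) \<le> 1 + e"
        unfolding abs_diff_less_iff by simp
      then have "(1 - e) * F * h y \<le> c \<and> c \<le> (1 + e) * F * h y"
        using F(2) by (simp add: pos_le_divide_eq pos_divide_le_eq mult_ac)
      then show "\<exists>c. has_cond_prob M (\<lambda>\<omega>. X \<omega> \<in> dilate x A) (\<lambda>\<omega>. exp (- R s \<omega>)) \<theta> y s c \<and>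
          (1 - e) * \<P>(\<omega> in M. X \<omega> \<in> dilate x A) * h y \<le> c \<and> c \<le> (1 + e) * \<P>(\<omega> in M. X \<omega> \<in> dilate x A) * h y"
        using c unfolding F_def[symmetric] by blast
    qed
  qed
qed

text \<open>The pointwise limits enter \<open>joint_law_bounds\<close> with constant multiples of
  \<open>k\<close> as bounds. The result is first kept as nonnegative integrals, because
  integrability of \<open>k (Y \<omega>)\<close> and an almost sure bound are themselves
  consequences: at one fixed level t, a multiple of k is a density dominated by the law of
  \<open>Y\<close>.\<close>

lemma conditional_tail_condition:
  fixes M :: "'a measure" and X :: "'a \<Rightarrow> real ^ 'd" and k h :: "real \<Rightarrow> real"
  assumes lt: "levy_time M R X T" and A: "A \<in> rare_sets"
    and ut: "uniform_conditional_tail M X R T A h \<Lambda> (support (distr M borel Y))"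
    and Y_eq: "Y = (\<lambda>\<omega>. exp (- R (T \<omega>) \<omega>))" and Y[measurable]: "Y \<in> borel_measurable M"
    and \<Lambda>: "AE \<omega> in M. T \<omega> \<in> \<Lambda>"
    and k[measurable]: "k \<in> borel_measurable borel" "\<And>y. 0 \<le> k y"
    and hk: "\<And>y. 0 \<le> y \<Longrightarrow> 0 < h y \<and> k y = h y"
    and F: "\<And>t. F t = \<P>(\<omega> in M. t < gauge_sup A (X \<omega>))" and F_pos: "\<And>t. 0 < F t"
  obtains K where "AE \<omega> in M. k (Y \<omega>) \<le> K"
    "\<And>e. 0 < e \<Longrightarrow> e < 1 \<Longrightarrow> \<exists>x1. prob_space.tail_factorization M (\<lambda>\<omega>. gauge_sup A (X \<omega>)) Y k e x1"
proof -
  interpret levy_time M R X T by fact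
  have YY: "levy_time.Y R T = Y" by (intro ext) (simp add: levy_time.Y_def[OF lt] Y_eq)
  have mem: "X \<omega> \<in> dilate t A \<longleftrightarrow> t < gauge_sup A (X \<omega>)" if "0 < t" for t \<omega>
    using less_gauge_sup_iff[OF A that] by blast
  have D: "dilate t A \<in> sets borel" for t
  proof (cases "t = 0")
    case True
    then have "dilate t A \<subseteq> {0}" by auto
    then have "finite (dilate t A)" by (rule finite_subset) simp
    then show ?thesis by (intro borel_closed finite_imp_closed)
  next
    case False
    have "open A" using A by (simp add: rare_sets_def)
    then show ?thesis using False open_scaling[of t A] by simp
  qed
  have Snn: "0 \<le> y" if "y \<in> support (distr M borel Y)" for y
  proof (rule ccontr)
    assume "\<not> 0 \<le> y"
    then have "measure (distr M borel Y) {..<0} > 0" using that by (simp add: support_def)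
    moreover have "measure (distr M borel Y) {..<0} = 0"
    proof -
      have "Y -` {..<0} \<inter> space M = {}" by (auto simp: Y_eq)
      then show ?thesis by (subst measure_distr) simp_all
    qed
    ultimately show False by simp
  qed
  have bounds: "\<forall>\<^sub>F t in at_top. 0 < t \<and> (\<forall>B\<in>sets borel.
       (\<integral>\<^sup>+\<omega>. ennreal ((1 - e) * F t * k (Y \<omega>)) * indicator B (Y \<omega>) \<partial>M) \<le> emeasure M {\<omega>\<in>space M. t < gauge_sup A (X \<omega>) \<and> Y \<omega> \<in> B} \<and>
       emeasure M {\<omega>\<in>space M. t < gauge_sup A (X \<omega>) \<and> Y \<omega> \<in> B} \<le> (\<integral>\<^sup>+\<omega>. ennreal ((1 + e) * F t * k (Y \<omega>)) * indicator B (Y \<omega>) \<partial>M))"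
    if e: "0 < e" for e
  proof -
    have Fd: "\<P>(\<omega> in M. X \<omega> \<in> dilate t A) = F t" if "0 < t" for t using mem[OF that] by (simp add: F)
    have "\<forall>\<^sub>F x in at_top. 0 < \<P>(\<omega> in M. X \<omega> \<in> dilate x A)"
      using eventually_gt_at_top[of 0] by eventually_elim (simp add: Fd F_pos)
    from uniform_conditional_tail_bounds[OF ut this _ e prob_space_axioms] Snn hk
    have "\<forall>\<^sub>F x in at_top. \<forall>s\<in>\<Lambda>. \<forall>y\<in>support (distr M borel Y). charged M (\<lambda>\<omega>. exp (- R s \<omega>)) T y s \<longrightarrow>
      (\<exists>c. has_cond_prob M (\<lambda>\<omega>. X \<omega> \<in> dilate x A) (\<lambda>\<omega>. exp (- R s \<omega>)) T y s c \<and>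
      (1 - e) * \<P>(\<omega> in M. X \<omega> \<in> dilate x A) * h y \<le> c \<and> c \<le> (1 + e) * \<P>(\<omega> in M. X \<omega> \<in> dilate x A) * h y)"
      by blast
    then show ?thesis
      using eventually_gt_at_top[of 0]
    proof eventually_elim
      case (elim t)
      have cp: "\<exists>c. has_cond_prob M (\<lambda>\<omega>. X \<omega> \<in> dilate t A) (\<lambda>\<omega>. exp (- R s \<omega>)) T y s c \<and>
          (1 - e) * F t * k y \<le> c \<and> c \<le> (1 + e) * F t * k y"
        if "s \<in> \<Lambda>" "y \<in> support (distr M borel Y)" "charged M (\<lambda>\<omega>. exp (- R s \<omega>)) T y s" for s y
        using elim(1) that hk[OF Snn[OF that(2)]] unfolding Fd[OF elim(2)] by simp
      show ?case
        using elim(2) joint_law_bounds[OF D[of t] _ _ _ \<Lambda>, unfolded YY, OF Y _ _ cp] mem[OF elim(2)]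
        by simp
    qed
  qed
  have int: "integrable M (\<lambda>\<omega>. k (Y \<omega>))" and bd: "\<exists>K. AE \<omega> in M. k (Y \<omega>) \<le> K"
  proof -
    \<comment> \<open>Any e < 1 would do; e = 1/2 leaves the positive factor \<open>F t / 2\<close>,
      called q below.\<close>
    obtain t where t: "\<And>B. B \<in> sets borel \<Longrightarrow> (\<integral>\<^sup>+\<omega>. ennreal ((1 - 1/2) * F t * k (Y \<omega>)) * indicator B (Y \<omega>) \<partial>M)
        \<le> emeasure M {\<omega>\<in>space M. t < gauge_sup A (X \<omega>) \<and> Y \<omega> \<in> B}"
      using eventually_happens'[OF trivial_limit_at_top_linorder bounds[of "1/2"]] by auto
    define q where "q = F t / 2"
    have q: "0 < q" using F_pos[of t] by (simp add: q_def)
    have t': "(\<integral>\<^sup>+\<omega>. ennreal (q * k (Y \<omega>)) * indicator B (Y \<omega>) \<partial>M) \<le> emeasure M {\<omega>\<in>space M. Y \<omega> \<in> B}"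
      if [measurable]: "B \<in> sets borel" for B
    proof -
      have "(\<integral>\<^sup>+\<omega>. ennreal (q * k (Y \<omega>)) * indicator B (Y \<omega>) \<partial>M) \<le> emeasure M {\<omega>\<in>space M. t < gauge_sup A (X \<omega>) \<and> Y \<omega> \<in> B}"
        using t[OF that] by (simp add: q_def)
      also have "\<dots> \<le> emeasure M {\<omega>\<in>space M. Y \<omega> \<in> B}" by (intro emeasure_mono) auto
      finally show ?thesis .
    qed
    have "integrable M (\<lambda>\<omega>. q * k (Y \<omega>))"
    proof (rule integrableI_nonneg)
      have "(\<integral>\<^sup>+\<omega>. ennreal (q * k (Y \<omega>)) \<partial>M) \<le> emeasure M {\<omega>\<in>space M. Y \<omega> \<in> UNIV}"
        using t'[of UNIV] by simp
      then show "(\<integral>\<^sup>+\<omega>. ennreal (q * k (Y \<omega>)) \<partial>M) < \<infinity>"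
        by (simp add: emeasure_space_1) (metis ennreal_one_less_top le_less_trans)
    qed (use k q in auto)
    then have iq: "integrable M (\<lambda>\<omega>. q * k (Y \<omega>))" .
    then show int: "integrable M (\<lambda>\<omega>. k (Y \<omega>))" using q by simp
    \<comment> \<open>On B the factor \<open>q * k\<close> exceeds 1, while its integral over B is
      at most the probability of B; hence B is null and 1/q is an almost sure bound.\<close>
    define B where "B = {y. 1 / q < k y}"
    have [measurable]: "B \<in> sets borel" unfolding B_def by measurable
    have "ennreal (\<integral>\<omega>. q * k (Y \<omega>) * indicator B (Y \<omega>) \<partial>M) = (\<integral>\<^sup>+\<omega>. ennreal (q * k (Y \<omega>) * indicator B (Y \<omega>)) \<partial>M)"
      using q k by (intro nn_integral_eq_integral[symmetric] Bochner_Integration.integrable_bound[OF iq])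
        (auto simp: indicator_def)
    also have "\<dots> = (\<integral>\<^sup>+\<omega>. ennreal (q * k (Y \<omega>)) * indicator B (Y \<omega>) \<partial>M)"
      by (intro nn_integral_cong) (auto simp: indicator_def)
    also have "\<dots> \<le> emeasure M {\<omega>\<in>space M. Y \<omega> \<in> B}" by (rule t') simp
    also have "\<dots> = ennreal (\<integral>\<omega>. indicator {\<omega>\<in>space M. Y \<omega> \<in> B} \<omega> \<partial>M)" by (simp add: emeasure_eq_measure)
    also have "(\<integral>\<omega>. indicator {\<omega>\<in>space M. Y \<omega> \<in> B} \<omega> \<partial>M) = (\<integral>\<omega>. indicator B (Y \<omega>) \<partial>M :: real)"
      by (intro Bochner_Integration.integral_cong) (auto simp: indicator_def)
    finally have le: "(\<integral>\<omega>. q * k (Y \<omega>) * indicator B (Y \<omega>) \<partial>M) \<le> (\<integral>\<omega>. indicator B (Y \<omega>) \<partial>M)"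
      by (subst (asm) ennreal_le_iff) (auto intro!: integral_nonneg_AE)
    have i1: "integrable M (\<lambda>\<omega>. q * k (Y \<omega>) * indicator B (Y \<omega>))"
      using q k by (intro Bochner_Integration.integrable_bound[OF iq]) (auto simp: indicator_def)
    have i2: "integrable M (\<lambda>\<omega>. indicator B (Y \<omega>) :: real)"
      by (intro integrable_const_bound[where B=1]) (auto simp: indicator_def)
    have nn: "0 \<le> q * k (Y \<omega>) * indicator B (Y \<omega>) - indicator B (Y \<omega>)" for \<omega>
      using q by (auto simp: indicator_def B_def field_simps)
    have "(\<integral>\<omega>. q * k (Y \<omega>) * indicator B (Y \<omega>) - indicator B (Y \<omega>) \<partial>M) = 0"
    proof (rule antisym)
      show "(\<integral>\<omega>. q * k (Y \<omega>) * indicator B (Y \<omega>) - indicator B (Y \<omega>) \<partial>M) \<le> 0"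
        using le i1 i2 by simp
      show "0 \<le> (\<integral>\<omega>. q * k (Y \<omega>) * indicator B (Y \<omega>) - indicator B (Y \<omega>) \<partial>M)"
        using nn by (intro integral_nonneg_AE) auto
    qed
    then have "AE \<omega> in M. q * k (Y \<omega>) * indicator B (Y \<omega>) - indicator B (Y \<omega>) = 0"
      using integral_nonneg_eq_0_iff_AE[of M "\<lambda>\<omega>. q * k (Y \<omega>) * indicator B (Y \<omega>) - indicator B (Y \<omega>)"] i1 i2 nn by simp
    then have "AE \<omega> in M. k (Y \<omega>) \<le> 1 / q"
    proof eventually_elim
      case (elim \<omega>)
      then show ?case using q by (auto simp: indicator_def B_def field_simps split: if_splits)
    qed
    then show "\<exists>K. AE \<omega> in M. k (Y \<omega>) \<le> K" by blast
  qed
  have cond: "\<exists>x1. tail_factorization (\<lambda>\<omega>. gauge_sup A (X \<omega>)) Y k e x1"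
    if e: "0 < e" "e < 1" for e
  proof -
    obtain x1 where x1: "\<And>t B. x1 \<le> t \<Longrightarrow> B \<in> sets borel \<Longrightarrow>
       (\<integral>\<^sup>+\<omega>. ennreal ((1 - e) * F t * k (Y \<omega>)) * indicator B (Y \<omega>) \<partial>M) \<le> emeasure M {\<omega>\<in>space M. t < gauge_sup A (X \<omega>) \<and> Y \<omega> \<in> B} \<and>
       emeasure M {\<omega>\<in>space M. t < gauge_sup A (X \<omega>) \<and> Y \<omega> \<in> B} \<le> (\<integral>\<^sup>+\<omega>. ennreal ((1 + e) * F t * k (Y \<omega>)) * indicator B (Y \<omega>) \<partial>M)"
      using bounds[OF e(1)] unfolding eventually_at_top_linorder by blast
    have conv: "(\<integral>\<^sup>+\<omega>. ennreal (c * F t * k (Y \<omega>)) * indicator B (Y \<omega>) \<partial>M) = ennreal (c * (F t * (\<integral>\<omega>. indicator B (Y \<omega>) * k (Y \<omega>) \<partial>M)))"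
      if [measurable]: "B \<in> sets borel" and c: "0 \<le> c" for c t B
    proof -
      have i: "integrable M (\<lambda>\<omega>. indicator B (Y \<omega>) * k (Y \<omega>))"
        by (rule Bochner_Integration.integrable_bound[OF int]) (auto simp: indicator_def)
      have "(\<integral>\<^sup>+\<omega>. ennreal (c * F t * k (Y \<omega>)) * indicator B (Y \<omega>) \<partial>M) = (\<integral>\<^sup>+\<omega>. ennreal (c * F t * (indicator B (Y \<omega>) * k (Y \<omega>))) \<partial>M)"
        by (intro nn_integral_cong) (auto simp: indicator_def)
      also have "\<dots> = ennreal (\<integral>\<omega>. c * F t * (indicator B (Y \<omega>) * k (Y \<omega>)) \<partial>M)"
        using i c F_pos[of t] k(2) by (intro nn_integral_eq_integral integrable_mult_right) (auto simp: indicator_def)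
      finally show ?thesis by (simp add: mult.assoc)
    qed
    have pos: "0 \<le> (\<integral>\<omega>. indicator B (Y \<omega>) * k (Y \<omega>) \<partial>M)" for B
      using k(2) by (intro integral_nonneg_AE) (auto simp: indicator_def)
    show ?thesis
      unfolding tail_factorization_def F[symmetric]
    proof (intro exI[of _ x1] allI impI ballI)
      fix t and B :: "real set" assume t: "x1 \<le> t" and B: "B \<in> sets borel"
      show "(1 - e) * (F t * (\<integral>\<omega>. indicator B (Y \<omega>) * k (Y \<omega>) \<partial>M)) \<le> \<P>(\<omega> in M. gauge_sup A (X \<omega>) > t \<and> Y \<omega> \<in> B) \<and>
         \<P>(\<omega> in M. gauge_sup A (X \<omega>) > t \<and> Y \<omega> \<in> B) \<le> (1 + e) * (F t * (\<integral>\<omega>. indicator B (Y \<omega>) * k (Y \<omega>) \<partial>M))"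
        using x1[OF t B] e F_pos[of t] pos[of B] conv[OF B, of "1 - e" t] conv[OF B, of "1 + e" t]
        by (simp add: emeasure_eq_measure)
    qed
  qed
  show ?thesis using bd cond that by blast
qed

section \<open>The renewal measure\<close>

text \<open>The zero set of the distribution function is a lower set. Its rational points and its
  greatest element, if there is one, are countable and cofinal in it, and each bounds a null
  half-line. Applied to the first arrival, this places it in \<Lambda> almost surely.\<close>

lemma (in real_distribution) AE_cdf_pos: "AE x in M. 0 < cdf M x"
proof -
  define N where "N = {x. cdf M x = 0}"
  have down: "y \<in> N" if "x \<in> N" "y \<le> x" for x y
    using cdf_nondecreasing[OF that(2)] cdf_nonneg[of y] that(1) by (simp add: N_def)
  define D where "D = (\<rat> \<inter> N) \<union> {x\<in>N. \<forall>y\<in>N. y \<le> x}"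
  \<comment> \<open>The set is empty or a singleton; \<open>Max\<close> merely names its element in
    the second case.\<close>
  have "{x\<in>N. \<forall>y\<in>N. y \<le> x} \<subseteq> {Max {x\<in>N. \<forall>y\<in>N. y \<le> x}}"
  proof
    fix x assume x: "x \<in> {x\<in>N. \<forall>y\<in>N. y \<le> x}"
    then have "{x\<in>N. \<forall>y\<in>N. y \<le> x} = {x}" by (auto intro: antisym)
    then show "x \<in> {Max {x\<in>N. \<forall>y\<in>N. y \<le> x}}" by simp
  qed
  then have D: "countable D"
    unfolding D_def by (intro countable_Un countable_Int1 countable_rat) (auto intro: countable_subset)
  have N_sub: "N \<subseteq> (\<Union>d\<in>D. {..d})"
  proof
    fix x assume x: "x \<in> N"
    show "x \<in> (\<Union>d\<in>D. {..d})"
    proof (cases "\<forall>y\<in>N. y \<le> x")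
      case False
      then obtain y where "y \<in> N" "x < y" by (auto simp: not_le)
      then obtain q where "q \<in> \<rat>" "x < q" "q < y" using Rats_dense_in_real by blast
      then have "q \<in> D" using down[OF \<open>y \<in> N\<close>] by (auto simp: D_def)
      then show ?thesis using \<open>x < q\<close> by (intro UN_I[of q]) auto
    qed (use x in \<open>auto simp: D_def\<close>)
  qed
  have "{..d} \<in> null_sets M" if "d \<in> D" for d
    using that by (auto simp: D_def N_def cdf_def null_sets_def emeasure_eq_measure)
  then have "(\<Union>d\<in>D. {..d}) \<in> null_sets M" using D by (intro null_sets_UN') auto
  then show ?thesis
    using N_sub cdf_nonneg by (intro AE_I'[of "\<Union>d\<in>D. {..d}"]) (auto simp: N_def less_le)
qed

context prob_space
begin

context
  fixes \<tau> :: "nat \<Rightarrow> 'a \<Rightarrow> real"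
  assumes \<tau>[measurable]: "\<And>i. \<tau> i \<in> borel_measurable M"
    and fin: "\<And>t. summable (\<lambda>i. \<P>(\<omega> in M. \<tau> (Suc i) \<omega> \<le> t))"
begin

lemma renewal_jointly_measurable:
  "(\<lambda>z. \<tau> (Suc (fst z)) (snd z)) \<in> borel_measurable (count_space UNIV \<Otimes>\<^sub>M M)"
  by (rule measurable_compose_countable[where f="\<lambda>i z. \<tau> (Suc i) (snd z)"]) auto

text \<open>The image of counting measure times M under the arrival times is the sum of their laws;
  in this form, integrals against it become series over the arrivals.\<close>

lemma renewal_nn_integral:
  assumes m[measurable]: "m \<in> borel_measurable borel"
  shows "(\<integral>\<^sup>+s. m s \<partial>distr (count_space UNIV \<Otimes>\<^sub>M M) borel (\<lambda>z. \<tau> (Suc (fst z)) (snd z))) = (\<Sum>i. \<integral>\<^sup>+\<omega>. m (\<tau> (Suc i) \<omega>) \<partial>M)"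
proof -
  note [measurable] = renewal_jointly_measurable
  have "(\<integral>\<^sup>+s. m s \<partial>distr (count_space UNIV \<Otimes>\<^sub>M M) borel (\<lambda>z. \<tau> (Suc (fst z)) (snd z)))
     = (\<integral>\<^sup>+z. m (\<tau> (Suc (fst z)) (snd z)) \<partial>(count_space UNIV \<Otimes>\<^sub>M M))"
    by (subst nn_integral_distr) auto
  also have "\<dots> = (\<integral>\<^sup>+i. \<integral>\<^sup>+\<omega>. m (\<tau> (Suc i) \<omega>) \<partial>M \<partial>count_space UNIV)"
    by (subst nn_integral_fst[symmetric]) auto
  finally show ?thesis by (simp add: nn_integral_count_space_nat)
qed

lemma renewal_function_mono: "s \<le> t \<Longrightarrow> renewal_function M \<tau> s \<le> renewal_function M \<tau> t"
  unfolding renewal_function_def by (intro suminf_le fin finite_measure_mono) auto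

lemma renewal_emeasure:
  assumes [measurable]: "B \<in> sets borel"
  shows "emeasure (distr (count_space UNIV \<Otimes>\<^sub>M M) borel (\<lambda>z. \<tau> (Suc (fst z)) (snd z))) B = (\<Sum>i. ennreal \<P>(\<omega> in M. \<tau> (Suc i) \<omega> \<in> B))"
proof -
  have eq: "(\<integral>\<^sup>+\<omega>. indicator B (\<tau> (Suc i) \<omega>) \<partial>M) = ennreal \<P>(\<omega> in M. \<tau> (Suc i) \<omega> \<in> B)" for i
  proof -
    have "(\<integral>\<^sup>+\<omega>. indicator B (\<tau> (Suc i) \<omega>) \<partial>M) = (\<integral>\<^sup>+\<omega>. indicator {\<omega>\<in>space M. \<tau> (Suc i) \<omega> \<in> B} \<omega> \<partial>M)"
      by (intro nn_integral_cong) (auto simp: indicator_def)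
    then show ?thesis by (simp add: emeasure_eq_measure)
  qed
  let ?\<kappa> = "distr (count_space UNIV \<Otimes>\<^sub>M M) borel (\<lambda>z. \<tau> (Suc (fst z)) (snd z))"
  have B: "B \<in> sets ?\<kappa>" by simp
  have "emeasure ?\<kappa> B = (\<integral>\<^sup>+s. indicator B s \<partial>?\<kappa>)"
    by (rule nn_integral_indicator[OF B, symmetric])
  also have "\<dots> = (\<Sum>i. \<integral>\<^sup>+\<omega>. indicator B (\<tau> (Suc i) \<omega>) \<partial>M)"
    by (rule renewal_nn_integral) simp
  finally show ?thesis unfolding eq .
qed

lemma renewal_atMost:
  "emeasure (distr (count_space UNIV \<Otimes>\<^sub>M M) borel (\<lambda>z. \<tau> (Suc (fst z)) (snd z))) {..t} = ennreal (renewal_function M \<tau> t)"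
  using fin[of t] by (simp add: renewal_emeasure renewal_function_def suminf_ennreal2)

text \<open>The renewal measure has infinite total mass. Cut off at a + 1 it is finite, and its
  distribution function agrees with the renewal function up to a + 1, hence near a.\<close>

lemma renewal_function_right_cont: "continuous (at_right a) (renewal_function M \<tau>)"
proof -
  let ?\<kappa> = "distr (count_space UNIV \<Otimes>\<^sub>M M) borel (\<lambda>z. \<tau> (Suc (fst z)) (snd z))"
  define \<nu> where "\<nu> = density ?\<kappa> (indicator {..a + 1})"
  have \<nu>: "emeasure \<nu> {..t} = ennreal (renewal_function M \<tau> t)" if "t \<le> a + 1" for t
  proof -
    have "emeasure \<nu> {..t} = (\<integral>\<^sup>+x. indicator {..a + 1} x * indicator {..t} x \<partial>?\<kappa>)"
      unfolding \<nu>_def by (subst emeasure_density) auto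
    also have "\<dots> = (\<integral>\<^sup>+x. indicator {..t} x \<partial>?\<kappa>)"
      using that by (intro nn_integral_cong) (auto simp: indicator_def)
    finally have "emeasure \<nu> {..t} = (\<integral>\<^sup>+x. indicator {..t} x \<partial>?\<kappa>)" .
    then show ?thesis by (simp add: renewal_atMost)
  qed
  have U0: "0 \<le> renewal_function M \<tau> t" for t
    unfolding renewal_function_def by (intro suminf_nonneg fin) auto
  have "emeasure \<nu> UNIV = (\<integral>\<^sup>+x. indicator {..a + 1} x \<partial>?\<kappa>)"
    unfolding \<nu>_def by (subst emeasure_density) auto
  then have "emeasure \<nu> (space \<nu>) \<noteq> \<infinity>" by (simp add: renewal_atMost \<nu>_def)
  then interpret \<nu>: finite_borel_measure \<nu>
    by (intro finite_borel_measure.intro finite_measureI finite_borel_measure_axioms.intro) (auto simp: \<nu>_def)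
  have cdf_eq: "cdf \<nu> t = renewal_function M \<tau> t" if "t \<le> a + 1" for t
    using \<nu>[OF that] U0 by (simp add: cdf_def measure_def)
  have "(cdf \<nu> \<longlongrightarrow> cdf \<nu> a) (at_right a)"
    using \<nu>.cdf_is_right_cont[of a] by (simp add: continuous_within)
  moreover have "\<forall>\<^sub>F t in at_right a. cdf \<nu> t = renewal_function M \<tau> t"
    unfolding eventually_at_right_field using cdf_eq by (intro exI[of _ "a + 1"]) auto
  ultimately show ?thesis
    unfolding continuous_within using cdf_eq[of a] by (auto intro: Lim_transform_eventually)
qed

text \<open>Monotonicity and right-continuity give \<open>interval_measure\<close> its meaning as
  the Stieltjes measure \<lambda>(ds). Agreement on half-open intervals, a generator closed under
  intersection, then identifies the two measures.\<close>

lemma interval_measure_renewal_function: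
  "interval_measure (renewal_function M \<tau>) = distr (count_space UNIV \<Otimes>\<^sub>M M) borel (\<lambda>z. \<tau> (Suc (fst z)) (snd z))"
    (is "?I = ?\<kappa>")
proof (rule measure_eqI_generator_eq)
  let ?E = "range (\<lambda>(a, b). {a<..b::real})"
  note Ioc = emeasure_interval_measure_Ioc[of _ _ "renewal_function M \<tau>", OF _ renewal_function_mono renewal_function_right_cont]
  have Int: "{a<..b} \<inter> {c<..d} = {max a c<..min b d}" for a b c d :: real by auto
  show "Int_stable ?E"
    unfolding Int_stable_def
  proof safe
    fix a b c d :: real
    have "{a<..b} \<inter> {c<..d} = (\<lambda>(a, b). {a<..b}) (max a c, min b d)" by (simp add: Int)
    then show "{a<..b} \<inter> {c<..d} \<in> ?E" by blast
  qed
  show "?E \<subseteq> Pow UNIV" by simp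
  have sb: "sets borel = sigma_sets UNIV ?E"
    by (subst borel_sigma_sets_Ioc) (simp add: sets_measure_of)
  show "sets ?I = sigma_sets UNIV ?E" "sets ?\<kappa> = sigma_sets UNIV ?E"
    using sb by simp_all
  show "range (\<lambda>i. {- real i<..real i}) \<subseteq> ?E" by auto
  show "(\<Union>i. {- real i<..real i}) = UNIV"
  proof (intro equalityI subsetI UNIV_I)
    fix x :: real
    obtain n where "\<bar>x\<bar> < real n" using reals_Archimedean2 by blast
    then show "x \<in> (\<Union>i. {- real i<..real i})" by (intro UN_I[of n]) auto
  qed
  show "emeasure ?I {- real i<..real i} \<noteq> \<infinity>" for i by (subst Ioc) auto
  fix B assume "B \<in> ?E"
  then obtain a b where B: "B = {a<..b}" by auto
  show "emeasure ?I B = emeasure ?\<kappa> B"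
  proof (cases "a \<le> b")
    case True
    have "\<P>(\<omega> in M. \<tau> (Suc i) \<omega> \<in> {a<..b}) = \<P>(\<omega> in M. \<tau> (Suc i) \<omega> \<le> b) - \<P>(\<omega> in M. \<tau> (Suc i) \<omega> \<le> a)" for i
      using True by (subst finite_measure_Diff[symmetric]) (auto intro!: arg_cong[where f=prob])
    then have "emeasure ?\<kappa> B = (\<Sum>i. ennreal (\<P>(\<omega> in M. \<tau> (Suc i) \<omega> \<le> b) - \<P>(\<omega> in M. \<tau> (Suc i) \<omega> \<le> a)))"
      unfolding B by (subst renewal_emeasure) auto
    also have "\<dots> = ennreal (\<Sum>i. \<P>(\<omega> in M. \<tau> (Suc i) \<omega> \<le> b) - \<P>(\<omega> in M. \<tau> (Suc i) \<omega> \<le> a))"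
      using True by (intro suminf_ennreal2 summable_diff fin) (auto intro!: finite_measure_mono)
    also have "(\<Sum>i. \<P>(\<omega> in M. \<tau> (Suc i) \<omega> \<le> b) - \<P>(\<omega> in M. \<tau> (Suc i) \<omega> \<le> a)) = renewal_function M \<tau> b - renewal_function M \<tau> a"
      unfolding renewal_function_def by (intro suminf_diff[symmetric] fin)
    finally show ?thesis unfolding B using Ioc[OF True] by simp
  qed (simp add: B)
qed

lemma AE_renewal_function_pos: "AE \<omega> in M. 0 < renewal_function M \<tau> (\<tau> (Suc 0) \<omega>)"
proof -
  interpret D: real_distribution "distr M borel (\<tau> (Suc 0))" by (intro real_distribution_distr) simp
  have [measurable]: "cdf (distr M borel (\<tau> (Suc 0))) \<in> borel_measurable borel"
    by (intro borel_measurable_mono monoI D.cdf_nondecreasing)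
  have "AE \<omega> in M. 0 < cdf (distr M borel (\<tau> (Suc 0))) (\<tau> (Suc 0) \<omega>)"
    using D.AE_cdf_pos by (subst (asm) AE_distr_iff) simp_all
  then show ?thesis
  proof eventually_elim
    case (elim \<omega>)
    let ?t = "\<tau> (Suc 0) \<omega>"
    have "cdf (distr M borel (\<tau> (Suc 0))) ?t = \<P>(\<omega>' in M. \<tau> (Suc 0) \<omega>' \<le> ?t)"
      by (simp add: cdf_def measure_distr vimage_def Int_def conj_commute)
    also have "\<dots> \<le> renewal_function M \<tau> ?t"
      unfolding renewal_function_def using sum_le_suminf[OF fin[of ?t], of "{0}"] by simp
    finally show ?case using elim by simp
  qed
qed

end

end

section \<open>Discounted series and the Matuszewska index\<close>

lemma (in prob_space) indep_vars_reindex: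
  assumes inj: "inj_on f I" and ind: "indep_vars M' X (f ` I)"
  shows "indep_vars (\<lambda>i. M' (f i)) (\<lambda>i. X (f i)) I"
  unfolding indep_vars_def2
proof (intro conjI ballI)
  fix i assume "i \<in> I"
  then show "X (f i) \<in> M \<rightarrow>\<^sub>M M' (f i)" using ind by (auto simp: indep_vars_def2)
next
  let ?F = "\<lambda>i. {X i -` A \<inter> space M |A. A \<in> sets (M' i)}"
  have F: "indep_sets ?F (f ` I)" using ind by (simp add: indep_vars_def2)
  show "indep_sets (\<lambda>i. ?F (f i)) I"
  proof (rule indep_setsI)
    fix i assume "i \<in> I"
    then show "?F (f i) \<subseteq> events" using F by (auto simp: indep_sets_def)
  next
    fix A J assume J: "J \<noteq> {}" "J \<subseteq> I" "finite J" "\<forall>j\<in>J. A j \<in> ?F (f j)"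
    define A' where "A' k = A (the_inv_into I f k)" for k
    have A': "A' (f j) = A j" if "j \<in> J" for j
      using inj that J by (auto simp: A'_def the_inv_into_f_f)
    have injJ: "inj_on f J" using inj J inj_on_subset by blast
    have "prob (\<Inter>k\<in>f ` J. A' k) = (\<Prod>k\<in>f ` J. prob (A' k))"
      using J A' by (intro indep_setsD[OF F]) auto
    moreover have "(\<Inter>k\<in>f ` J. A' k) = (\<Inter>j\<in>J. A j)" using A' by auto
    moreover have "(\<Prod>k\<in>f ` J. prob (A' k)) = (\<Prod>j\<in>J. prob (A j))"
      using A' by (simp add: prod.reindex[OF injJ])
    ultimately show "prob (\<Inter>j\<in>J. A j) = (\<Prod>j\<in>J. prob (A j))" by simp
  qed
qed

text \<open>Borel-Cantelli twice: eventually \<open>W n\<close> is at most r^(2n), by Markov's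
  inequality, and the norm of \<open>X n\<close> is at most r^(-n), by the polynomial tail. The
  terms are then dominated by r^n.\<close>

lemma (in prob_space) discounted_series_summable:
  fixes X :: "nat \<Rightarrow> 'a \<Rightarrow> 'c :: {second_countable_topology, banach}" and W :: "nat \<Rightarrow> 'a \<Rightarrow> real"
  assumes X[measurable]: "\<And>n. X n \<in> borel_measurable M" and W[measurable]: "\<And>n. W n \<in> borel_measurable M"
    and W_pos: "\<And>n \<omega>. \<omega> \<in> space M \<Longrightarrow> 0 < W n \<omega>"
    and tail: "\<And>n x. x0 \<le> x \<Longrightarrow> \<P>(\<omega> in M. x < norm (X n \<omega>)) \<le> C * x powr (- q)"
    and q: "0 < q" and s: "0 < s" and a: "0 \<le> a" "a < 1"
    and W_int: "\<And>n. integrable M (\<lambda>\<omega>. W n \<omega> powr s)" and W_moment: "\<And>n. (\<integral>\<omega>. W n \<omega> powr s \<partial>M) \<le> a ^ n"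
  shows "AE \<omega> in M. summable (\<lambda>n. W n \<omega> *\<^sub>R X n \<omega>)"
proof -
  \<comment> \<open>b lies strictly between a and 1, and r is chosen with r^(2s) = b, so that
    Markov's bound at the threshold r^(2n) is (a/b)^n.\<close>
  define b where "b = (1 + a) / 2"
  define r where "r = b powr (1 / (2 * s))"
  have b: "0 < b" "b < 1" "a < b" using a by (auto simp: b_def)
  have r0: "0 < r" using b by (simp add: r_def)
  have r1: "r < 1"
  proof -
    have "r < 1 powr (1 / (2 * s))" unfolding r_def using b s by (intro powr_less_mono2) auto
    then show ?thesis by simp
  qed
  have r2: "(r\<^sup>2 ^ n) powr s = b ^ n" for n
  proof -
    have "r\<^sup>2 powr s = b" using b s r0 by (simp add: r_def powr_powr flip: powr_numeral)
    then show ?thesis using r0 by (induction n) (auto simp: powr_mult)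
  qed
  have rq: "(1 / r ^ n) powr (- q) = (r powr q) ^ n" for n
  proof -
    have "(r ^ n) powr q = (r powr q) ^ n" using r0 by (induction n) (auto simp: powr_mult)
    then show ?thesis using r0 by (simp add: powr_divide powr_minus)
  qed
  have rq1: "r powr q < 1"
  proof -
    have "r powr q < 1 powr q" using r0 r1 q by (intro powr_less_mono2) auto
    then show ?thesis by simp
  qed
  have sumW: "summable (\<lambda>n. prob {\<omega>\<in>space M. r\<^sup>2 ^ n < W n \<omega>})"
  proof (rule summable_comparison_test)
    have "prob {\<omega>\<in>space M. r\<^sup>2 ^ n < W n \<omega>} \<le> (a / b) ^ n" for n
    proof -
      have "prob {\<omega>\<in>space M. r\<^sup>2 ^ n < W n \<omega>} = (\<integral>\<omega>. indicator {\<omega>\<in>space M. r\<^sup>2 ^ n < W n \<omega>} \<omega> \<partial>M)" by simp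
      also have "\<dots> \<le> (\<integral>\<omega>. W n \<omega> powr s / b ^ n \<partial>M)"
      proof (rule integral_mono)
        fix \<omega> assume \<omega>: "\<omega> \<in> space M"
        have "b ^ n \<le> W n \<omega> powr s" if "r\<^sup>2 ^ n < W n \<omega>"
          unfolding r2[symmetric] using that s r0 by (intro powr_mono2) auto
        then show "indicator {\<omega>\<in>space M. r\<^sup>2 ^ n < W n \<omega>} \<omega> \<le> W n \<omega> powr s / b ^ n"
          using b by (auto simp: indicator_def)
      qed (use W_int in \<open>auto intro!: integrable_real_indicator simp: emeasure_eq_measure\<close>)
      also have "\<dots> = (\<integral>\<omega>. W n \<omega> powr s \<partial>M) / b ^ n" by simp
      also have "\<dots> \<le> a ^ n / b ^ n" using W_moment[of n] b by (intro divide_right_mono) auto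
      finally show ?thesis by (simp add: power_divide)
    qed
    then show "\<exists>N. \<forall>n\<ge>N. norm (prob {\<omega>\<in>space M. r\<^sup>2 ^ n < W n \<omega>}) \<le> (a / b) ^ n" by simp
    show "summable (\<lambda>n. (a / b) ^ n)" using a b by (intro summable_geometric) auto
  qed
  have sumX: "summable (\<lambda>n. prob {\<omega>\<in>space M. 1 / r ^ n < norm (X n \<omega>)})"
  proof (rule summable_comparison_test_ev)
    obtain N where N: "x0 < (1 / r) ^ N" using real_arch_pow[of "1 / r" x0] r0 r1 by auto
    have "\<forall>\<^sub>F n in sequentially. x0 \<le> (1 / r) ^ n"
      using eventually_ge_at_top[of N]
    proof eventually_elim
      case (elim n)
      have "(1 / r) ^ N \<le> (1 / r) ^ n" using elim r0 r1 by (intro power_increasing) auto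
      then show ?case using N by linarith
    qed
    then show "\<forall>\<^sub>F n in sequentially. norm (prob {\<omega>\<in>space M. 1 / r ^ n < norm (X n \<omega>)}) \<le> C * (r powr q) ^ n"
    proof eventually_elim
      case (elim n)
      then have "x0 \<le> 1 / r ^ n" by (simp add: power_divide)
      from tail[OF this, of n] show ?case by (simp only: rq) simp
    qed
    show "summable (\<lambda>n. C * (r powr q) ^ n)" using rq1 by (intro summable_mult summable_geometric) auto
  qed
  have "AE \<omega> in M. \<forall>\<^sub>F n in sequentially. \<omega> \<in> space M - {\<omega>\<in>space M. r\<^sup>2 ^ n < W n \<omega>}"
    by (rule borel_cantelli_AE1[OF _ _ sumW]) (auto simp: emeasure_eq_measure)
  moreover have "AE \<omega> in M. \<forall>\<^sub>F n in sequentially. \<omega> \<in> space M - {\<omega>\<in>space M. 1 / r ^ n < norm (X n \<omega>)}"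
    by (rule borel_cantelli_AE1[OF _ _ sumX]) (auto simp: emeasure_eq_measure)
  ultimately show ?thesis
  proof eventually_elim
    case (elim \<omega>)
    from elim have "\<forall>\<^sub>F n in sequentially. norm (W n \<omega> *\<^sub>R X n \<omega>) \<le> r ^ n"
    proof eventually_elim
      case (elim n)
      then have "\<bar>W n \<omega>\<bar> * norm (X n \<omega>) \<le> r\<^sup>2 ^ n * (1 / r ^ n)"
        using r0 W_pos[of \<omega> n] by (intro mult_mono) auto
      also have "\<dots> = r ^ n" using r0 by (simp add: power2_eq_square power_mult_distrib)
      finally show ?case by simp
    qed
    then show ?case using r0 r1 by (intro summable_comparison_test_ev[OF _ summable_geometric[of r]]) auto
  qed
qed

text \<open>Under regular variation the lower limit is the limit v^(-\<alpha>), so the quotient of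
  logarithms is constantly -\<alpha> for v > 1. This translates hypothesis (4) into \<alpha> <
  p.\<close>

lemma upper_matuszewska_regularly_varying:
  assumes H: "rv_tail \<alpha> H" and eq: "\<And>x. 0 < x \<Longrightarrow> tail G x = H x"
  shows "upper_matuszewska G = ereal \<alpha>"
proof -
  have ratio: "lower_tail_ratio G v = ereal (v powr (- \<alpha>))" if v: "0 < v" for v
  proof -
    have "((\<lambda>x. H (v * x) / H x) \<longlongrightarrow> v powr (- \<alpha>)) at_top" using H v by (simp add: rv_tail_def)
    moreover have "\<forall>\<^sub>F x in at_top. H (v * x) / H x = tail G (v * x) / tail G x"
      using eventually_gt_at_top[of 0] by eventually_elim (use eq v in simp)
    ultimately have "((\<lambda>x. tail G (v * x) / tail G x) \<longlongrightarrow> v powr (- \<alpha>)) at_top"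
      by (rule Lim_transform_eventually)
    then have "((\<lambda>x. ereal (tail G (v * x) / tail G x)) \<longlongrightarrow> ereal (v powr (- \<alpha>))) at_top" by simp
    then show ?thesis unfolding lower_tail_ratio_def
      by (intro lim_imp_Liminf) auto
  qed
  have "eln (lower_tail_ratio G v) / ereal (ln v) = ereal (- \<alpha>)" if "1 < v" for v
    using that ln_gt_zero[OF that] by (simp add: ratio eln_def ln_powr)
  then have "\<forall>\<^sub>F v in at_top. eln (lower_tail_ratio G v) / ereal (ln v) = ereal (- \<alpha>)"
    by (rule eventually_mono[OF eventually_gt_at_top[of "1::real"]])
  then have "((\<lambda>v. eln (lower_tail_ratio G v) / ereal (ln v)) \<longlongrightarrow> ereal (- \<alpha>)) at_top"
    by (rule tendsto_eventually)
  then have "Lim at_top (\<lambda>v. eln (lower_tail_ratio G v) / ereal (ln v)) = ereal (- \<alpha>)"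
    by (intro tendsto_Lim) auto
  then show ?thesis by (simp add: upper_matuszewska_def)
qed

lemma tail_dist_along:
  fixes X :: "'a \<Rightarrow> real ^ 'd"
  assumes "prob_space M" and A: "A \<in> rare_sets" and X[measurable]: "X \<in> borel_measurable M"
  shows "tail (dist_along A (distr M borel X)) x = \<P>(\<omega> in M. x < gauge_sup A (X \<omega>))"
proof -
  interpret prob_space M by fact
  note [measurable] = gauge_sup_measurable[OF A]
  have "dist_along A (distr M borel X) = distr M borel (\<lambda>\<omega>. gauge_sup A (X \<omega>))"
    unfolding dist_along_def by (subst distr_distr) (auto simp: comp_def)
  then have "tail (dist_along A (distr M borel X)) x = 1 - \<P>(\<omega> in M. gauge_sup A (X \<omega>) \<le> x)"
    by (simp add: tail_def cdf_def measure_distr vimage_def Int_def conj_commute)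
  also have "\<dots> = prob (space M - {\<omega>\<in>space M. gauge_sup A (X \<omega>) \<le> x})"
    by (subst prob_compl) auto
  also have "space M - {\<omega>\<in>space M. gauge_sup A (X \<omega>) \<le> x} = {\<omega>\<in>space M. x < gauge_sup A (X \<omega>)}" by auto
  finally show ?thesis .
qed

lemma laplace_exponent_negative:
  assumes "laplace_exponent M R p < 0"
  shows "(\<integral>\<^sup>+\<omega>. ennreal (exp (- p * R 1 \<omega>)) \<partial>M) < 1"
proof -
  define I where "I = (\<integral>\<^sup>+\<omega>. ennreal (exp (- p * R 1 \<omega>)) \<partial>M)"
  have "eln (enn2ereal I) < 0" using assms by (simp add: laplace_exponent_def I_def)
  then show ?thesis unfolding I_def[symmetric]
  proof (cases I)
    case (real x)
    have "x < 1"
    proof (rule ccontr)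
      assume "\<not> x < 1"
      then have "0 \<le> eln (enn2ereal I)" using real by (simp add: eln_def enn2ereal_ennreal)
      then show False using \<open>eln (enn2ereal I) < 0\<close> by simp
    qed
    then show "I < 1" using real by (simp add: ennreal_less_one_iff)
  next
    case top
    then show "I < 1" using \<open>eln (enn2ereal I) < 0\<close> by (simp add: eln_def)
  qed
qed

text \<open>The gauge can vanish on large vectors, so convergence of the vector series needs control
  of the norm. If every coordinate is at most x/d then the l1 norm is at most x; a union bound over
  the d coordinates reduces the claim to \<open>MRV_component\<close>.\<close>

lemma MRV_norm_tail:
  fixes X :: "'a \<Rightarrow> real ^ 'd" and \<mu> :: "(ennreal ^ 'd) measure"
  assumes "prob_space M" and mrv: "MRV \<alpha> \<mu> G (distr M borel X)" and \<alpha>: "0 < \<alpha>"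
    and X[measurable]: "X \<in> borel_measurable M" and X_nonneg: "\<And>\<omega> j. \<omega> \<in> space M \<Longrightarrow> 0 \<le> X \<omega> $ j"
  obtains C x0 where "\<And>x. x0 \<le> x \<Longrightarrow> \<P>(\<omega> in M. x < norm (X \<omega>)) \<le> C * x powr (- (\<alpha> / 2))"
proof -
  interpret prob_space M by fact
  have rvG: "rv_tail \<alpha> (tail G)" using mrv by (intro regularly_varying_rv_tail) (simp add: MRV_def)
  have Gpos: "tail G x > 0" for x using rv_tail_pos[OF rvG] .
  obtain C y0 where C: "C > 0" "y0 > 0" "\<And>x. x \<ge> y0 \<Longrightarrow> tail G x \<le> C * x powr (- (\<alpha>/2))"
    using rv_tail_polynomial_upper[OF rvG, of "\<alpha>/2"] \<alpha> by auto
  define m where "m j = measure \<mu> {w. 1 < w $ j} + 1" for j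
  define d where "d = real CARD('d)"
  have d: "0 < d" by (simp add: d_def)
  have comp: "\<forall>\<^sub>F x in at_top. \<P>(\<omega> in M. x < X \<omega> $ j) \<le> m j * C * x powr (- (\<alpha>/2))" for j
  proof -
    have "\<forall>\<^sub>F x in at_top. measure (distr M borel X) {v. x < v $ j} / tail G x < m j"
      by (rule order_tendstoD(2)[OF MRV_component(1)[OF mrv \<alpha>]]) (simp add: m_def)
    then show ?thesis using eventually_ge_at_top[of y0]
    proof eventually_elim
      case (elim x)
      have "open {v :: real ^ 'd. x < v $ j}" by (intro open_Collect_less continuous_intros)
      then have "\<P>(\<omega> in M. x < X \<omega> $ j) = measure (distr M borel X) {v. x < v $ j}"
        by (subst measure_distr) (auto intro!: arg_cong[where f=prob])
      also have "\<dots> \<le> m j * tail G x" using elim(1) Gpos[of x] by (simp add: divide_less_eq)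
      also have "\<dots> \<le> m j * (C * x powr (- (\<alpha>/2)))"
        using C(3)[OF elim(2)] by (intro mult_left_mono) (auto simp: m_def)
      finally show ?case by simp
    qed
  qed
  have f: "filterlim (\<lambda>x. x * (1 / d)) at_top at_top"
    using d by (intro filterlim_at_top_mult_tendsto_pos[OF tendsto_const] filterlim_ident) auto
  have comp': "\<forall>\<^sub>F x in at_top. \<forall>j\<in>(UNIV :: 'd set). \<P>(\<omega> in M. x * (1 / d) < X \<omega> $ j) \<le> m j * C * (x * (1 / d)) powr (- (\<alpha>/2))"
    by (intro eventually_ball_finite ballI eventually_compose_filterlim[OF comp f]) auto
  then obtain x0 where x0: "\<And>x j. x0 \<le> x \<Longrightarrow> \<P>(\<omega> in M. x * (1 / d) < X \<omega> $ j) \<le> m j * C * (x * (1 / d)) powr (- (\<alpha>/2))"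
    unfolding eventually_at_top_linorder by blast
  have "\<P>(\<omega> in M. x < norm (X \<omega>)) \<le> ((\<Sum>j\<in>UNIV. m j * C) * (1 / d) powr (- (\<alpha>/2))) * x powr (- (\<alpha>/2))"
    if x: "max x0 1 \<le> x" for x
  proof -
    have [measurable]: "{\<omega>\<in>space M. x * (1 / d) < X \<omega> $ j} \<in> sets M" for j
    proof -
      have "{v :: real ^ 'd. x * (1 / d) < v $ j} \<in> sets borel"
        by (intro borel_open open_Collect_less continuous_intros)
      from measurable_sets[OF X this] show ?thesis by (simp add: vimage_def Int_def conj_commute)
    qed
    have "{\<omega>\<in>space M. x < norm (X \<omega>)} \<subseteq> (\<Union>j\<in>UNIV. {\<omega>\<in>space M. x * (1 / d) < X \<omega> $ j})"
    proof
      fix \<omega> assume \<omega>: "\<omega> \<in> {\<omega>\<in>space M. x < norm (X \<omega>)}"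
      have "\<exists>j. x * (1 / d) < X \<omega> $ j"
      proof (rule ccontr)
        assume "\<not> ?thesis"
        then have "(\<Sum>j\<in>UNIV. \<bar>X \<omega> $ j\<bar>) \<le> (\<Sum>j\<in>(UNIV :: 'd set). x * (1 / d))"
          using X_nonneg \<omega> by (intro sum_mono) (auto simp: not_less)
        also have "\<dots> = x" by (simp add: d_def)
        finally show False using norm_le_l1_cart[of "X \<omega>"] \<omega> by simp
      qed
      then show "\<omega> \<in> (\<Union>j\<in>UNIV. {\<omega>\<in>space M. x * (1 / d) < X \<omega> $ j})" using \<omega> by auto
    qed
    then have "\<P>(\<omega> in M. x < norm (X \<omega>)) \<le> prob (\<Union>j\<in>UNIV. {\<omega>\<in>space M. x * (1 / d) < X \<omega> $ j})"
      by (intro finite_measure_mono) auto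
    also have "\<dots> \<le> (\<Sum>j\<in>UNIV. \<P>(\<omega> in M. x * (1 / d) < X \<omega> $ j))"
      by (intro measure_UNION_le) auto
    also have "\<dots> \<le> (\<Sum>j\<in>UNIV. m j * C * (x * (1 / d)) powr (- (\<alpha>/2)))"
      using x by (intro sum_mono x0) auto
    also have "\<dots> = (\<Sum>j\<in>UNIV. (m j * C) * ((1 / d) powr (- (\<alpha>/2)) * x powr (- (\<alpha>/2))))"
      by (simp only: powr_mult) (simp add: mult_ac)
    also have "\<dots> = ((\<Sum>j\<in>UNIV. m j * C) * (1 / d) powr (- (\<alpha>/2))) * x powr (- (\<alpha>/2))"
      by (simp only: sum_distrib_right mult.assoc)
    finally show ?thesis .
  qed
  then show ?thesis using that by blast
qed

text \<open>Otherwise all arrivals would occur by time 0 almost surely, and the renewal series at 0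
  would be a divergent sum of ones.\<close>

lemma (in prob_space) first_arrival_positive:
  fixes \<tau> \<theta> :: "nat \<Rightarrow> 'a \<Rightarrow> real"
  assumes \<theta>_meas: "\<And>i. 1 \<le> i \<Longrightarrow> \<theta> i \<in> borel_measurable M"
    and \<theta>_ident: "\<And>i. 1 \<le> i \<Longrightarrow> distr M borel (\<theta> i) = distr M borel (\<theta> 1)"
    and \<tau>_sum: "\<And>i \<omega>. \<omega> \<in> space M \<Longrightarrow> \<tau> i \<omega> = (\<Sum>k\<in>{1..i}. \<theta> k \<omega>)"
    and fin: "summable (\<lambda>i. \<P>(\<omega> in M. \<tau> (Suc i) \<omega> \<le> 0))"
  shows "0 < \<P>(\<omega> in M. 0 < \<theta> 1 \<omega>)"
proof (rule ccontr)
  assume "\<not> ?thesis"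
  then have 0: "\<P>(\<omega> in M. 0 < \<theta> 1 \<omega>) = 0" using measure_nonneg by (auto simp: not_less intro: antisym)
  have "AE \<omega> in M. \<theta> i \<omega> \<le> 0" if i: "1 \<le> i" for i
  proof -
    note [measurable] = \<theta>_meas[OF i] \<theta>_meas[OF order.refl]
    have "measure (distr M borel (\<theta> i)) {0<..} = measure (distr M borel (\<theta> 1)) {0<..}" by (simp only: \<theta>_ident[OF i])
    then have "\<P>(\<omega> in M. 0 < \<theta> i \<omega>) = \<P>(\<omega> in M. 0 < \<theta> 1 \<omega>)"
      using \<theta>_meas[OF i] \<theta>_meas[OF order.refl] by (simp add: measure_distr vimage_def Int_def conj_commute)
    then have "\<P>(\<omega> in M. 0 < \<theta> i \<omega>) = 0" using 0 by simp
    then have "AE \<omega> in M. \<not> 0 < \<theta> i \<omega>" by (subst (asm) prob_eq_0) auto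
    then show ?thesis by (simp add: not_less)
  qed
  then have "AE \<omega> in M. \<forall>i\<in>{1..}. \<theta> i \<omega> \<le> 0" by (intro AE_ball_countable') auto
  then have all: "AE \<omega> in M. \<forall>i. \<tau> i \<omega> \<le> 0"
    using AE_space by eventually_elim (auto simp: \<tau>_sum intro!: sum_nonpos)
  have "\<P>(\<omega> in M. \<tau> (Suc i) \<omega> \<le> 0) = 1" for i
  proof -
    have m: "(\<lambda>\<omega>. \<Sum>k\<in>{1..Suc i}. \<theta> k \<omega>) \<in> borel_measurable M"
      by (intro borel_measurable_sum \<theta>_meas) auto
    have "\<tau> (Suc i) \<in> borel_measurable M"
      by (subst measurable_cong[OF \<tau>_sum]) (use m in auto)
    then have [measurable]: "\<tau> (Suc i) \<in> borel_measurable M" .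
    show ?thesis using all by (subst prob_Collect_eq_1) auto
  qed
  then have "(\<lambda>i. \<P>(\<omega> in M. \<tau> (Suc i) \<omega> \<le> 0)) = (\<lambda>_. 1)" by auto
  then show False using summable_LIMSEQ_zero[OF fin] LIMSEQ_unique[OF tendsto_const] by force
qed

context levy
begin

lemma laplace_finite_between:
  assumes p: "0 < a" "a < p" and lp: "laplace p 1 < 1" and s: "0 \<le> s"
  shows "laplace a s < \<infinity>"
proof -
  note [measurable] = R_measurable[OF s]
  have le: "exp (- a * r) \<le> 1 + exp (- p * r)" for r :: real
  proof (cases "0 \<le> r")
    case True
    then have "exp (- a * r) \<le> 1" using p by simp
    then show ?thesis by (smt (verit) exp_gt_zero)
  next
    case False
    then have "exp (- a * r) \<le> exp (- p * r)" using p by (simp add: mult_right_mono_neg)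
    then show ?thesis by linarith
  qed
  have "laplace a s \<le> (\<integral>\<^sup>+\<omega>. 1 + ennreal (exp (- p * R s \<omega>)) \<partial>M)"
    unfolding laplace_def
  proof (rule nn_integral_mono)
    fix \<omega>
    have "ennreal (exp (- a * R s \<omega>)) \<le> ennreal (1 + exp (- p * R s \<omega>))" by (rule ennreal_leI[OF le])
    then show "ennreal (exp (- a * R s \<omega>)) \<le> 1 + ennreal (exp (- p * R s \<omega>))" by (simp add: ennreal_plus)
  qed
  also have "\<dots> = 1 + laplace p s" by (subst nn_integral_add) (auto simp: laplace_def emeasure_space_1)
  also have "\<dots> \<le> 1 + 1" by (intro add_left_mono laplace_le_one lp s)
  also have "\<dots> < \<infinity>" by simp
  finally show ?thesis .
qed

text \<open>Integration against \<lambda>(ds) is a sum over arrivals. By independence of the arrival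
  times from \<open>R\<close>, the Laplace transform averaged over an arrival time is the discount
  moment at that time, a power of \<rho>. The sum begins with the first arrival, hence \<rho> / (1 -
  \<rho>).\<close>

lemma renewal_integral_laplace:
  fixes X :: "'a \<Rightarrow> 'b :: topological_space"
  assumes lt: "\<And>i. levy_time M R X (\<tau> (Suc i))"
    and fin: "\<And>t. summable (\<lambda>i. \<P>(\<omega> in M. \<tau> (Suc i) \<omega> \<le> t))" and \<tau>0: "\<tau> 0 \<in> borel_measurable M"
    and p: "0 < a" "a < p" and lp: "laplace p 1 < 1" and \<rho>: "0 \<le> \<rho>" "\<rho> < 1"
    and mom: "\<And>i. (\<integral>\<^sup>+\<omega>. ennreal (exp (- a * R (\<tau> (Suc i) \<omega>) \<omega>)) \<partial>M) = ennreal (\<rho> ^ Suc i)"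
  shows "(LINT s:{0..}|interval_measure (renewal_function M \<tau>). (LINT \<omega>|M. exp (- a * R s \<omega>))) = \<rho> / (1 - \<rho>)"
proof -
  have \<tau>_meas: "\<tau> i \<in> borel_measurable M" for i
    using \<tau>0 levy_time.T[OF lt] by (cases i) auto
  note I_eq = interval_measure_renewal_function[OF \<tau>_meas fin]
  \<comment> \<open>A Borel function on the whole line that agrees with \<open>laplace a\<close> for
    s >= 0; the measurability of \<open>laplace a\<close> is obtained through it.\<close>
  define mm where "mm s = (\<integral>\<^sup>+\<omega>. ennreal (exp (- a * path_eval (s, path \<omega>))) \<partial>M)" for s
  have mm[measurable]: "mm \<in> borel_measurable borel"
    using levy_time.section_measurable[OF lt, of "\<lambda>z. ennreal (exp (- a * snd z))"] by (simp add: mm_def[abs_def])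
  have mm_eq: "mm s = laplace a s" if "0 \<le> s" for s
    using levy_time.section_eq[OF lt that, of "\<lambda>z. ennreal (exp (- a * snd z))"] by (simp add: mm_def laplace_def)
  have inner: "(LINT \<omega>|M. exp (- a * R s \<omega>)) = enn2real (mm s)" if "0 \<le> s" for s
    unfolding mm_eq[OF that] laplace_def using R_measurable[OF that]
    by (intro integral_eq_nn_integral) auto
  have fin_mm: "mm s < \<infinity>" if "0 \<le> s" for s
    using laplace_finite_between[OF p lp that] mm_eq[OF that] by simp
  let ?I = "interval_measure (renewal_function M \<tau>)"
  have "(LINT s:{0..}|?I. (LINT \<omega>|M. exp (- a * R s \<omega>))) = (\<integral>s. indicator {0..} s * enn2real (mm s) \<partial>?I)"
    unfolding set_lebesgue_integral_def using inner by (intro Bochner_Integration.integral_cong) (auto simp: indicator_def)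
  also have "\<dots> = enn2real (\<integral>\<^sup>+s. ennreal (indicator {0..} s * enn2real (mm s)) \<partial>?I)"
    by (rule integral_eq_nn_integral) auto
  also have "(\<integral>\<^sup>+s. ennreal (indicator {0..} s * enn2real (mm s)) \<partial>?I) = (\<integral>\<^sup>+s. indicator {0..} s * mm s \<partial>?I)"
    using fin_mm by (intro nn_integral_cong) (auto simp: indicator_def less_top[symmetric])
  also have "\<dots> = (\<Sum>i. \<integral>\<^sup>+\<omega>. indicator {0..} (\<tau> (Suc i) \<omega>) * mm (\<tau> (Suc i) \<omega>) \<partial>M)"
    unfolding I_eq by (rule renewal_nn_integral[OF \<tau>_meas fin]) measurable
  also have "(\<lambda>i. \<integral>\<^sup>+\<omega>. indicator {0..} (\<tau> (Suc i) \<omega>) * mm (\<tau> (Suc i) \<omega>) \<partial>M) = (\<lambda>i. ennreal (\<rho> ^ Suc i))"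
  proof
    fix n
    have "(\<integral>\<^sup>+\<omega>. indicator {0..} (\<tau> (Suc n) \<omega>) * mm (\<tau> (Suc n) \<omega>) \<partial>M) = (\<integral>\<^sup>+\<omega>. laplace a (\<tau> (Suc n) \<omega>) \<partial>M)"
      using levy_time.T_nonneg[OF lt, of _ n] by (intro nn_integral_cong) (simp add: mm_eq)
    also have "\<dots> = ennreal (\<rho> ^ Suc n)"
      using levy_time.exp_R_T_moment[OF lt, of a n] mom[of n] by simp
    finally show "(\<integral>\<^sup>+\<omega>. indicator {0..} (\<tau> (Suc n) \<omega>) * mm (\<tau> (Suc n) \<omega>) \<partial>M) = ennreal (\<rho> ^ Suc n)" .
  qed
  also have "(\<Sum>i. ennreal (\<rho> ^ Suc i)) = ennreal (\<rho> / (1 - \<rho>))"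
  proof -
    have "(\<lambda>i. \<rho> * \<rho> ^ i) sums (\<rho> * (1 / (1 - \<rho>)))"
      using \<rho> by (intro sums_mult geometric_sums) auto
    then show ?thesis using \<rho> by (subst suminf_ennreal2) (auto simp: sums_iff)
  qed
  finally show ?thesis using \<rho> by simp
qed

end

lemma (in prob_space) indep_vimage_algebra_prob:
  assumes ind: "indep_set (sets (vimage_algebra (space M) f N1)) (sets (vimage_algebra (space M) g N2))"
    and f: "f \<in> space M \<rightarrow> space N1" and g: "g \<in> space M \<rightarrow> space N2"
    and u: "u \<in> N1 \<rightarrow>\<^sub>M K1" "C \<in> sets K1" and v: "v \<in> N2 \<rightarrow>\<^sub>M K2" "B \<in> sets K2"
    and U: "\<And>\<omega>. \<omega> \<in> space M \<Longrightarrow> U \<omega> = u (f \<omega>)" and V: "\<And>\<omega>. \<omega> \<in> space M \<Longrightarrow> V \<omega> = v (g \<omega>)"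
  shows "prob ((U -` C \<inter> space M) \<inter> (V -` B \<inter> space M)) = prob (U -` C \<inter> space M) * prob (V -` B \<inter> space M)"
    and "U -` C \<inter> space M \<in> sets M" and "V -` B \<inter> space M \<in> sets M"
proof -
  have 1: "U -` C \<inter> space M = f -` (u -` C \<inter> space N1) \<inter> space M" using U f by auto
  have 2: "V -` B \<inter> space M = g -` (v -` B \<inter> space N2) \<inter> space M" using V g by auto
  have 3: "U -` C \<inter> space M \<in> sets (vimage_algebra (space M) f N1)"
    unfolding 1 by (intro in_vimage_algebra measurable_sets[OF u])
  have 4: "V -` B \<inter> space M \<in> sets (vimage_algebra (space M) g N2)"
    unfolding 2 by (intro in_vimage_algebra measurable_sets[OF v])
  show "prob ((U -` C \<inter> space M) \<inter> (V -` B \<inter> space M)) = prob (U -` C \<inter> space M) * prob (V -` B \<inter> space M)"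
    by (rule indep_setD[OF ind 3 4])
  show "U -` C \<inter> space M \<in> sets M" "V -` B \<inter> space M \<in> sets M"
    using indep_setD_ev1[OF ind] indep_setD_ev2[OF ind] 3 4 by auto
qed

section \<open>The theorem\<close>

theorem corollary4p1:
  fixes M :: "'a measure"
    and A :: "(real ^ 'd) set"
    and X :: "'a \<Rightarrow> real ^ 'd"
    and Xs :: "nat \<Rightarrow> 'a \<Rightarrow> real ^ 'd"
    and \<tau> \<theta> :: "nat \<Rightarrow> 'a \<Rightarrow> real"
    and R :: "real \<Rightarrow> 'a \<Rightarrow> real"
    and h :: "real \<Rightarrow> real"
    and \<mu> :: "(ennreal ^ 'd) measure"
    and G :: "real measure"
    and \<alpha> p :: real
    and \<Lambda> E :: "real set"
    and Q :: "real measure"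
    and D :: "'a \<Rightarrow> real ^ 'd"
  assumes M: "prob_space M"
    and A: "A \<in> rare_sets"
    and X: "X \<in> borel_measurable M" "\<And>\<omega> j. \<omega> \<in> space M \<Longrightarrow> 0 \<le> X \<omega> $ j"
    and Xs_nonneg: "\<And>i \<omega> j. 1 \<le> i \<Longrightarrow> \<omega> \<in> space M \<Longrightarrow> 0 \<le> Xs i \<omega> $ j"
    and Xs_indep: "prob_space.indep_vars M (\<lambda>_. borel) Xs {1..}"
    and Xs_copies: "\<And>i. 1 \<le> i \<Longrightarrow> distr M borel (Xs i) = distr M borel X"
    and \<tau>: "\<And>\<omega>. \<omega> \<in> space M \<Longrightarrow> \<tau> 0 \<omega> = 0" "\<And>i \<omega>. \<omega> \<in> space M \<Longrightarrow> \<tau> i \<omega> \<le> \<tau> (Suc i) \<omega>"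
    and \<theta>: "\<And>i \<omega>. 1 \<le> i \<Longrightarrow> \<omega> \<in> space M \<Longrightarrow> \<theta> i \<omega> = \<tau> i \<omega> - \<tau> (i - 1) \<omega>"
    and renewal_finite: "\<And>t. summable (\<lambda>i. \<P>(\<omega> in M. \<tau> (Suc i) \<omega> \<le> t))"
    and \<Lambda>: "\<Lambda> = {t. renewal_function M \<tau> t > 0}"
    and R: "levy_process M R"
    and D: "\<And>\<omega>. D \<omega> = (\<Sum>i. exp (- R (\<tau> (Suc i) \<omega>) \<omega>) *\<^sub>R Xs (Suc i) \<omega>)"
    and \<theta>_indep: "prob_space.indep_vars M (\<lambda>_. borel) \<theta> {1..}"
    and \<theta>_ident: "\<And>i. 1 \<le> i \<Longrightarrow> distr M borel (\<theta> i) = distr M borel (\<theta> 1)"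
    and \<theta>_indep_rest: "prob_space.indep_set M
          (sets (vimage_algebra (space M) (\<lambda>\<omega>. \<lambda>i\<in>{1..}. \<theta> i \<omega>) (\<Pi>\<^sub>M i\<in>{1..}. borel)))
          (sets (vimage_algebra (space M)
             (\<lambda>\<omega>. (X \<omega>, (\<lambda>i\<in>{1..}. Xs i \<omega>), (\<lambda>t\<in>{0..}. R t \<omega>)))
             (borel \<Otimes>\<^sub>M ((\<Pi>\<^sub>M i\<in>{1..}. borel) \<Otimes>\<^sub>M (\<Pi>\<^sub>M t\<in>{0..}. borel)))))"
    and pairs_indep: "prob_space.indep_vars M (\<lambda>_. borel \<Otimes>\<^sub>M borel)
          (\<lambda>i \<omega>. (Xs i \<omega>, exp (R (\<tau> (i - 1) \<omega>) \<omega> - R (\<tau> i \<omega>) \<omega>))) {1..}"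
    and pairs_copies: "\<And>i. 1 \<le> i \<Longrightarrow>
          distr M (borel \<Otimes>\<^sub>M borel) (\<lambda>\<omega>. (Xs i \<omega>, exp (R (\<tau> (i - 1) \<omega>) \<omega> - R (\<tau> i \<omega>) \<omega>))) =
          distr M (borel \<Otimes>\<^sub>M borel) (\<lambda>\<omega>. (X \<omega>, exp (- R (\<theta> 1 \<omega>) \<omega>)))"
    and Q: "Q = distr M borel (\<lambda>\<omega>. exp (- R (\<theta> 1 \<omega>) \<omega>))"
    and h: "h \<in> borel_measurable (restrict_space borel {0..})" "\<And>y. 0 \<le> y \<Longrightarrow> 0 < h y"
    and h_bounds: "left_neighbourhood E (SUP y\<in>support Q. ereal y)"
          "0 < (INF y\<in>E. ereal (h y))" "(SUP y\<in>E. ereal (h y)) < \<infinity>"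
    and h_cond: "uniform_conditional_tail M X R (\<theta> 1) A h \<Lambda> (support Q)"
    and \<alpha>: "0 < \<alpha>"
    and mrv: "MRV \<alpha> \<mu> G (distr M borel X)"
    and \<mu>_A: "orthant_mass \<mu> A > 0"
    and p: "upper_matuszewska (dist_along A (distr M borel X)) < ereal p" "laplace_exponent M R p < 0"
  shows "(\<lambda>x. \<P>(\<omega> in M. D \<omega> \<in> dilate x A)) \<sim>[at_top]
         (\<lambda>x. orthant_mass \<mu> A * tail G x *
              (LINT \<omega>|M. exp (- \<alpha> * R (\<theta> 1 \<omega>) \<omega>) * h (exp (- R (\<theta> 1 \<omega>) \<omega>))) *
              (1 + (LINT u:\<Lambda>|distr M borel (\<theta> 1).
                     (LINT s:{0..}|interval_measure (renewal_function M \<tau>).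
                        (LINT \<omega>|M. exp (- \<alpha> * R s \<omega>))))))"
proof -
  interpret prob_space M by fact
  interpret levy M R by (intro levy.intro levy_axioms.intro M R)
  note [measurable] = gauge_sup_measurable[OF A] X(1)
  let ?g = "gauge_sup A"

  \<comment> \<open>Pairs of claim and discount factor\<close>
  define Y where "Y = (\<lambda>\<omega>. exp (- R (\<theta> 1 \<omega>) \<omega>))"
  \<comment> \<open>Indices are shifted to start at 0: \<open>Yp i\<close> discounts over the
    inter-arrival period i + 1, and \<open>Tn i\<close> already contains this factor.\<close>
  define Yp where "Yp i \<omega> = exp (R (\<tau> i \<omega>) \<omega> - R (\<tau> (Suc i) \<omega>) \<omega>)" for i \<omega>
  define Tn where "Tn i \<omega> = ?g (Xs (Suc i) \<omega>) * Yp i \<omega>" for i \<omega>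

  have range_Suc: "range Suc = {1..}" by (auto simp: image_iff) (metis Suc_le_D)
  have ind: "indep_vars (\<lambda>_. borel \<Otimes>\<^sub>M borel) (\<lambda>i \<omega>. (Xs (Suc i) \<omega>, Yp i \<omega>)) UNIV"
    using indep_vars_reindex[of Suc UNIV "\<lambda>_. borel \<Otimes>\<^sub>M borel"
        "\<lambda>i \<omega>. (Xs i \<omega>, exp (R (\<tau> (i - 1) \<omega>) \<omega> - R (\<tau> i \<omega>) \<omega>))"] pairs_indep
    by (simp add: range_Suc Yp_def)
  have pair_m: "(\<lambda>\<omega>. (Xs (Suc i) \<omega>, Yp i \<omega>)) \<in> M \<rightarrow>\<^sub>M borel \<Otimes>\<^sub>M borel" for i
    using ind by (auto simp: indep_vars_def2)
  have Xs_m[measurable]: "Xs (Suc i) \<in> borel_measurable M" for i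
    using measurable_compose[OF pair_m[of i] measurable_fst] by simp
  have Yp_m[measurable]: "Yp i \<in> borel_measurable M" for i
    using measurable_compose[OF pair_m[of i] measurable_snd] by simp
  have R0_m[measurable]: "R 0 \<in> borel_measurable M" by (rule R_measurable) simp
  have \<theta>1: "\<theta> 1 \<omega> = \<tau> 1 \<omega>" if "\<omega> \<in> space M" for \<omega> using \<theta>[of 1 \<omega>] \<tau>(1) that by simp
  \<comment> \<open>Measurability of \<open>R\<close> at a random time is taken from
    \<open>Yp 0\<close>, a component of an independent family. The factor
    \<open>exp (- R 0 \<omega>)\<close> appears because \<open>R 0\<close> is 0 only almost
    surely.\<close>
  have Y_m[measurable]: "Y \<in> borel_measurable M"
  proof -
    have "Y \<omega> = Yp 0 \<omega> * exp (- R 0 \<omega>)" if "\<omega> \<in> space M" for \<omega>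
      using \<theta>1[OF that] \<tau>(1)[OF that] by (simp add: Y_def Yp_def exp_add[symmetric])
    then show ?thesis by (subst measurable_cong) auto
  qed
  have Y_pos: "0 < Y \<omega>" and Yp_pos: "0 < Yp i \<omega>" for i \<omega> by (simp_all add: Y_def Yp_def)
  have law: "distr M (borel \<Otimes>\<^sub>M borel) (\<lambda>\<omega>. (Xs (Suc i) \<omega>, Yp i \<omega>)) = distr M (borel \<Otimes>\<^sub>M borel) (\<lambda>\<omega>. (X \<omega>, Y \<omega>))" for i
    using pairs_copies[of "Suc i"] by (simp add: Yp_def Y_def)
  have law_f: "distr M borel (\<lambda>\<omega>. f (Xs (Suc i) \<omega>, Yp i \<omega>)) = distr M borel (\<lambda>\<omega>. f (X \<omega>, Y \<omega>))"
    if f: "f \<in> borel_measurable (borel \<Otimes>\<^sub>M borel)" for f :: "(real ^ 'd) \<times> real \<Rightarrow> real" and i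
  proof -
    have "distr M borel (f \<circ> (\<lambda>\<omega>. (Xs (Suc i) \<omega>, Yp i \<omega>))) = distr M borel (f \<circ> (\<lambda>\<omega>. (X \<omega>, Y \<omega>)))"
      using distr_distr[OF f pair_m[of i]] distr_distr[OF f, of "\<lambda>\<omega>. (X \<omega>, Y \<omega>)" M] law[of i] by simp
    then show ?thesis by (simp add: comp_def)
  qed

  \<comment> \<open>Arrival times as sums of inter-arrival times\<close>
  have \<theta>_m: "\<theta> i \<in> borel_measurable M" if "1 \<le> i" for i
    using \<theta>_indep that by (auto simp: indep_vars_def2)
  have \<tau>_sum: "\<tau> i \<omega> = (\<Sum>k\<in>{1..i}. \<theta> k \<omega>)" if "\<omega> \<in> space M" for i \<omega>
  proof (induction i)
    case (Suc i)
    then show ?case using \<theta>[of "Suc i" \<omega>] that by simp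
  qed (use \<tau>(1) that in simp)
  have \<tau>_m[measurable]: "\<tau> i \<in> borel_measurable M" for i
  proof -
    have "(\<lambda>\<omega>. \<Sum>k\<in>{1..i}. \<theta> k \<omega>) \<in> borel_measurable M" by (intro borel_measurable_sum \<theta>_m) auto
    then show ?thesis by (subst measurable_cong[OF \<tau>_sum])
  qed
  have \<tau>_nonneg: "0 \<le> \<tau> i \<omega>" if "\<omega> \<in> space M" for i \<omega>
  proof (induction i)
    case (Suc i)
    then show ?case using \<tau>(2)[OF that, of i] by simp
  qed (use \<tau>(1) that in simp)

  \<comment> \<open>Independence of the arrival times from the claim and the path\<close>
  have time: "levy_time M R X (\<tau> (Suc i))" for i
  proof (intro levy_time.intro levy_time_axioms.intro)
    show "levy M R" by unfold_locales
    let ?\<Theta> = "\<lambda>\<omega>. \<lambda>i\<in>{1..}. \<theta> i \<omega>"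
    let ?\<Xi> = "\<lambda>\<omega>. (X \<omega>, (\<lambda>i\<in>{1..}. Xs i \<omega>), (\<lambda>t\<in>{0..}. R t \<omega>))"
    fix C B assume C: "C \<in> sets (borel :: real measure)"
      and B: "B \<in> sets (borel \<Otimes>\<^sub>M (\<Pi>\<^sub>M t\<in>{0..}. borel) :: ((real ^ 'd) \<times> (real \<Rightarrow> real)) measure)"
    show "prob ((\<tau> (Suc i) -` C \<inter> space M) \<inter> ((\<lambda>\<omega>. (X \<omega>, path \<omega>)) -` B \<inter> space M)) =
      prob (\<tau> (Suc i) -` C \<inter> space M) * prob ((\<lambda>\<omega>. (X \<omega>, path \<omega>)) -` B \<inter> space M)"
    proof (rule indep_vimage_algebra_prob(1)[OF \<theta>_indep_rest])
      show "(\<lambda>f. \<Sum>k\<in>{1..Suc i}. f k) \<in> (\<Pi>\<^sub>M i\<in>{1..}. borel) \<rightarrow>\<^sub>M (borel :: real measure)"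
        by (intro borel_measurable_sum measurable_component_singleton) auto
      show "(\<lambda>z. (fst z, snd (snd z))) \<in> borel \<Otimes>\<^sub>M ((\<Pi>\<^sub>M i\<in>{1..}. borel) \<Otimes>\<^sub>M (\<Pi>\<^sub>M t\<in>{0..}. borel)) \<rightarrow>\<^sub>M borel \<Otimes>\<^sub>M (\<Pi>\<^sub>M t\<in>{0..}. borel)"
        by measurable
      show "\<tau> (Suc i) \<omega> = (\<Sum>k\<in>{1..Suc i}. ?\<Theta> \<omega> k)" if "\<omega> \<in> space M" for \<omega>
        unfolding \<tau>_sum[OF that] by (intro sum.cong) auto
      show "(X \<omega>, path \<omega>) = (fst (?\<Xi> \<omega>), snd (snd (?\<Xi> \<omega>)))" for \<omega> by (simp add: path_def)
      show "?\<Theta> \<in> space M \<rightarrow> space (\<Pi>\<^sub>M i\<in>{1..}. borel)" by (auto simp: space_PiM)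
      show "?\<Xi> \<in> space M \<rightarrow> space (borel \<Otimes>\<^sub>M ((\<Pi>\<^sub>M i\<in>{1..}. borel) \<Otimes>\<^sub>M (\<Pi>\<^sub>M t\<in>{0..}. borel)))"
        by (auto simp: space_PiM space_pair_measure)
    qed (rule C, rule B)
  qed (use \<tau>_nonneg in auto)
  have \<tau>1_meas: "\<theta> 1 \<in> borel_measurable M" by (rule \<theta>_m) simp
  have time1: "levy_time M R X (\<theta> 1)"
  proof (intro levy_time.intro levy_time_axioms.intro)
    show "levy M R" by unfold_locales
    fix C B assume C: "C \<in> sets (borel :: real measure)"
      and B: "B \<in> sets (borel \<Otimes>\<^sub>M (\<Pi>\<^sub>M t\<in>{0..}. borel) :: ((real ^ 'd) \<times> (real \<Rightarrow> real)) measure)"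
    have "\<theta> 1 -` C \<inter> space M = \<tau> (Suc 0) -` C \<inter> space M" using \<theta>1 by auto
    then show "prob ((\<theta> 1 -` C \<inter> space M) \<inter> ((\<lambda>\<omega>. (X \<omega>, path \<omega>)) -` B \<inter> space M)) =
      prob (\<theta> 1 -` C \<inter> space M) * prob ((\<lambda>\<omega>. (X \<omega>, path \<omega>)) -` B \<inter> space M)"
      using levy_time.independent[OF time C B, of 0] by simp
  qed (use \<theta>1 \<tau>_nonneg \<tau>1_meas in auto)

  \<comment> \<open>Contraction, positivity of the first arrival and the set
    \<open>\<Lambda>\<close>\<close>
  have lp: "laplace p 1 < 1"
    using laplace_exponent_negative[OF p(2)] by (simp add: laplace_def)
  have \<theta>1_pos: "0 < \<P>(\<omega> in M. 0 < \<theta> 1 \<omega>)"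
    by (rule first_arrival_positive[OF \<theta>_m \<theta>_ident \<tau>_sum renewal_finite])
  have \<Lambda>_ae: "AE \<omega> in M. \<theta> 1 \<omega> \<in> \<Lambda>"
    using AE_renewal_function_pos[OF \<tau>_m renewal_finite] AE_space
    by eventually_elim (use \<theta>1 in \<open>simp add: \<Lambda>\<close>)

  \<comment> \<open>Tail of the gauge of one claim\<close>
  define Fb where "Fb x = \<P>(\<omega> in M. x < ?g (X \<omega>))" for x
  have Fb_lim: "((\<lambda>x. Fb x / tail G x) \<longlongrightarrow> orthant_mass \<mu> A) at_top"
    unfolding Fb_def by (rule MRV_rare_set[OF mrv \<alpha> A X])
  have rvG: "rv_tail \<alpha> (tail G)" using mrv by (intro regularly_varying_rv_tail) (simp add: MRV_def)
  have Gpos: "tail G x > 0" for x using rv_tail_pos[OF rvG] .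
  have rvF: "rv_tail \<alpha> Fb"
  proof (rule rv_tail_equivalent[OF Fb_lim \<mu>_A])
    show "((\<lambda>x. tail G (t * x) / tail G x) \<longlongrightarrow> t powr (- \<alpha>)) at_top" if "0 < t" for t
      using rvG that by (simp add: rv_tail_def)
    show "antimono Fb" unfolding Fb_def by (auto intro!: antimonoI finite_measure_mono)
  qed (simp_all add: Fb_def)
  have Fb_pos: "0 < Fb x" for x using rv_tail_pos[OF rvF] .
  have \<alpha>p: "\<alpha> < p"
    using p(1) upper_matuszewska_regularly_varying[OF rvF, of "dist_along A (distr M borel X)"]
      tail_dist_along[OF M A X(1)] by (simp add: Fb_def)

  \<comment> \<open>Moments of one discount factor\<close>
  have Y_powr: "Y \<omega> powr q = exp (- q * R (\<theta> 1 \<omega>) \<omega>)" for q \<omega>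
    by (simp add: Y_def powr_def)
  have Y_mom: "(\<integral>\<^sup>+\<omega>. ennreal (Y \<omega> powr p) \<partial>M) < 1"
    unfolding Y_powr by (rule levy_time.exp_R_T_moment_less_one[OF time1 lp \<theta>1_pos])
  have Y_int: "integrable M (\<lambda>\<omega>. Y \<omega> powr p)"
    by (rule integrableI_nonneg) (use Y_mom in \<open>auto intro: less_trans\<close>)
  have Y_less: "(\<integral>\<omega>. Y \<omega> powr p \<partial>M) < 1"
    using Y_mom nn_integral_eq_integral[OF Y_int] by simp

  \<comment> \<open>Tail of one discounted claim\<close>
  define k where "k y = indicator {0..} y * h y" for y :: real
  have k_m[measurable]: "k \<in> borel_measurable borel"
    using h(1) by (simp add: borel_measurable_restrict_space_iff k_def[abs_def])
  have k_nonneg: "0 \<le> k y" for y using h(2)[of y] by (auto simp: k_def indicator_def)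
  have k_Y: "k (Y \<omega>) = h (Y \<omega>)" "0 < k (Y \<omega>)" for \<omega>
    using Y_pos[of \<omega>] h(2)[of "Y \<omega>"] by (auto simp: k_def)
  have ut: "uniform_conditional_tail M X R (\<theta> 1) A h \<Lambda> (support (distr M borel Y))"
    using h_cond by (simp add: Q Y_def)
  obtain K where K: "AE \<omega> in M. k (Y \<omega>) \<le> K"
    "\<And>e. 0 < e \<Longrightarrow> e < 1 \<Longrightarrow> \<exists>x1. tail_factorization (\<lambda>\<omega>. ?g (X \<omega>)) Y k e x1"
    by (rule conditional_tail_condition[OF time1 A ut Y_def Y_m \<Lambda>_ae k_m k_nonneg _ Fb_def Fb_pos])
       (use h(2) in \<open>auto simp: k_def\<close>)
  define c where "c = (\<integral>\<omega>. Y \<omega> powr \<alpha> * k (Y \<omega>) \<partial>M)"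
  have breiman: "((\<lambda>x. \<P>(\<omega> in M. ?g (X \<omega>) * Y \<omega> > x) / Fb x) \<longlongrightarrow> c) at_top"
    unfolding c_def
    by (rule breiman_dependent[OF _ Y_m Y_pos k_m k_nonneg K(1) Fb_def rvF \<alpha> \<alpha>p Y_int K(2)]) auto

  define H where "H x = \<P>(\<omega> in M. Tn 0 \<omega> > x)" for x
  have Tn_law: "distr M borel (Tn i) = distr M borel (\<lambda>\<omega>. ?g (X \<omega>) * Y \<omega>)" for i
    using law_f[of "\<lambda>z. ?g (fst z) * snd z" i] by (simp add: Tn_def[abs_def])
  have Yp_law: "distr M borel (Yp i) = distr M borel Y" for i
    using law_f[of snd i] by simp
  have Tn_m[measurable]: "Tn i \<in> borel_measurable M" for i unfolding Tn_def[abs_def] by measurable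
  have H_eq: "H x = \<P>(\<omega> in M. ?g (X \<omega>) * Y \<omega> > x)" for x
  proof -
    have "measure (distr M borel (Tn 0)) {x<..} = measure (distr M borel (\<lambda>\<omega>. ?g (X \<omega>) * Y \<omega>)) {x<..}"
      by (simp only: Tn_law[of 0])
    then show ?thesis by (simp add: measure_distr H_def vimage_def Int_def conj_commute)
  qed
  \<comment> \<open>Regular variation passes from \<open>Fb\<close> to \<open>H\<close> only if the
    ratio has a positive limit. The integrand is positive; its integrability is needed so that the
    integral does not take the default value 0.\<close>
  have c_pos: "0 < c"
  proof -
    have "0 \<le> K" 
    proof -
      have "AE \<omega> in M. 0 \<le> K" using K(1) by eventually_elim (use k_nonneg order_trans in blast)
      then show ?thesis by simp
    qed
    have i: "integrable M (\<lambda>\<omega>. Y \<omega> powr \<alpha> * k (Y \<omega>))"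
    proof (rule Bochner_Integration.integrable_bound[of M "\<lambda>\<omega>. (1 + Y \<omega> powr p) * K"])
      show "integrable M (\<lambda>\<omega>. (1 + Y \<omega> powr p) * K)" using Y_int by simp
      show "AE \<omega> in M. norm (Y \<omega> powr \<alpha> * k (Y \<omega>)) \<le> norm ((1 + Y \<omega> powr p) * K)"
        using K(1)
      proof eventually_elim
        case (elim \<omega>)
        have "Y \<omega> powr \<alpha> \<le> 1 + Y \<omega> powr p"
          using \<alpha> \<alpha>p Y_pos[of \<omega>] powr_mono[of \<alpha> p "Y \<omega>"] powr_le1[of \<alpha> "Y \<omega>"] powr_ge_zero[of "Y \<omega>" p]
          by (cases "Y \<omega> \<le> 1") linarith+
        then have "Y \<omega> powr \<alpha> * k (Y \<omega>) \<le> (1 + Y \<omega> powr p) * K"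
          using elim k_nonneg[of "Y \<omega>"] by (intro mult_mono) (auto simp: add_nonneg_nonneg)
        then show ?case using k_nonneg[of "Y \<omega>"] by (simp add: abs_of_nonneg)
      qed
    qed simp
    have "0 \<le> c" unfolding c_def using k_nonneg by (intro integral_nonneg_AE) auto
    moreover have "c \<noteq> 0"
    proof
      assume "c = 0"
      then have "AE \<omega> in M. Y \<omega> powr \<alpha> * k (Y \<omega>) = 0"
        unfolding c_def using i k_nonneg by (subst (asm) integral_nonneg_eq_0_iff_AE) auto
      then have "AE \<omega> in M. False" by eventually_elim (use Y_pos k_Y in \<open>simp add: less_le\<close>)
      then show False by simp
    qed
    ultimately show ?thesis by simp
  qed
  have HF: "((\<lambda>x. H x / Fb x) \<longlongrightarrow> c) at_top" using breiman by (simp add: H_eq)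
  have rvH: "rv_tail \<alpha> H"
  proof (rule rv_tail_equivalent[OF HF c_pos])
    show "((\<lambda>x. Fb (t * x) / Fb x) \<longlongrightarrow> t powr (- \<alpha>)) at_top" if "0 < t" for t
      using rvF that by (simp add: rv_tail_def)
    show "antimono H" unfolding H_def by (auto intro!: antimonoI finite_measure_mono)
  qed (simp_all add: H_def)

  \<comment> \<open>The perpetuity of discounted gauges\<close>
  have Yp_int: "integrable M (\<lambda>\<omega>. Yp 0 \<omega> powr p)" and Yp_moment: "(\<integral>\<omega>. Yp 0 \<omega> powr q \<partial>M) = (\<integral>\<omega>. Y \<omega> powr q \<partial>M)" for q
  proof -
    have "integrable (distr M borel (Yp 0)) (\<lambda>y. y powr p)"
      unfolding Yp_law using Y_int by (simp add: integrable_distr_eq)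
    then show "integrable M (\<lambda>\<omega>. Yp 0 \<omega> powr p)" by (simp add: integrable_distr_eq)
    have "(\<integral>y. y powr q \<partial>distr M borel (Yp 0)) = (\<integral>y. y powr q \<partial>distr M borel Y)" by (simp only: Yp_law)
    then show "(\<integral>\<omega>. Yp 0 \<omega> powr q \<partial>M) = (\<integral>\<omega>. Y \<omega> powr q \<partial>M)" by (simp add: integral_distr)
  qed
  interpret P: perpetuity M Tn Yp \<alpha> p
  proof (intro perpetuity.intro perpetuity_axioms.intro)
    show "prob_space M" by fact
    show "indep_vars (\<lambda>_. borel \<Otimes>\<^sub>M borel) (\<lambda>i \<omega>. (Tn i \<omega>, Yp i \<omega>)) UNIV"
      using indep_vars_compose2[OF ind, of "\<lambda>_ z. (?g (fst z) * snd z, snd z)" "\<lambda>_. borel \<Otimes>\<^sub>M borel"]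
      by (simp add: Tn_def)
    show "0 \<le> Tn i \<omega>" for i \<omega> using gauge_sup_nonneg[OF A] Yp_pos by (simp add: Tn_def less_imp_le)
    show "0 < Yp i \<omega>" for i \<omega> by (rule Yp_pos)
    show "distr M borel (Tn i) = distr M borel (Tn 0)" for i by (simp only: Tn_law)
    show "distr M borel (Yp i) = distr M borel (Yp 0)" for i by (simp only: Yp_law)
    show "rv_tail \<alpha> (\<lambda>x. \<P>(\<omega> in M. Tn 0 \<omega> > x))" using rvH unfolding H_def[abs_def] .
    show "(\<integral>\<omega>. Yp 0 \<omega> powr p \<partial>M) < 1" using Y_less by (simp add: Yp_moment)
  qed (use \<alpha> \<alpha>p Yp_int in auto)
  have P_H: "P.H = H" by (simp add: P.H_def[abs_def] H_def[abs_def])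
  define \<rho> where "\<rho> = P.\<rho> \<alpha>"
  have \<rho>: "0 \<le> \<rho>" "\<rho> < 1" using P.\<rho>_integrable_less_one[of \<alpha>] \<alpha> \<alpha>p by (auto simp: \<rho>_def)

  \<comment> \<open>The increments telescope; \<open>R 0\<close> stays in the formula because it
    vanishes only almost surely.\<close>
  have W_exp: "P.W n \<omega> = exp (R 0 \<omega> - R (\<tau> n \<omega>) \<omega>)" if "\<omega> \<in> space M" for n \<omega>
  proof (induction n)
    case 0
    then show ?case using \<tau>(1)[OF that] by (simp add: P.W_def)
  next
    case (Suc n)
    have "P.W (Suc n) \<omega> = P.W n \<omega> * Yp n \<omega>" by (simp add: P.W_def)
    then show ?case using Suc Yp_def[of n \<omega>] by (simp add: exp_add[symmetric])
  qed
  have W_R: "AE \<omega> in M. \<forall>n. P.W n \<omega> = exp (- R (\<tau> n \<omega>) \<omega>)"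
    using R_zero AE_space by eventually_elim (simp add: W_exp)
  have Z_eq: "P.Z n \<omega> = ?g (P.W (Suc n) \<omega> *\<^sub>R Xs (Suc n) \<omega>)" if "\<omega> \<in> space M" for n \<omega>
    using P.W_pos[OF that, of "Suc n"]
    by (simp add: gauge_sup_scale[OF A] P.Z_def Tn_def P.W_def mult_ac)

  \<comment> \<open>Convergence of the vector series and the sandwich for its gauge\<close>
  have D_m[measurable]: "D \<in> borel_measurable M"
  proof -
    have "exp (- R (\<tau> (Suc i) \<omega>) \<omega>) = P.W (Suc i) \<omega> * exp (- R 0 \<omega>)" if "\<omega> \<in> space M" for i \<omega>
      using W_exp[OF that, of "Suc i"] by (simp add: exp_add[symmetric])
    then have "(\<lambda>\<omega>. exp (- R (\<tau> (Suc i) \<omega>) \<omega>)) \<in> borel_measurable M" for i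
      by (subst measurable_cong) auto
    then have "(\<lambda>\<omega>. \<Sum>i. exp (- R (\<tau> (Suc i) \<omega>) \<omega>) *\<^sub>R Xs (Suc i) \<omega>) \<in> borel_measurable M"
      by (intro borel_measurable_suminf borel_measurable_scaleR) auto
    then show ?thesis unfolding D[abs_def] .
  qed
  obtain C x0 where tail_X: "\<And>x. x0 \<le> x \<Longrightarrow> \<P>(\<omega> in M. x < norm (X \<omega>)) \<le> C * x powr (- (\<alpha> / 2))"
    using MRV_norm_tail[OF M mrv \<alpha> X] by blast
  have summ: "AE \<omega> in M. summable (\<lambda>n. P.W (Suc n) \<omega> *\<^sub>R Xs (Suc n) \<omega>)"
  proof (rule discounted_series_summable[where s=p and a="P.\<rho> p" and q="\<alpha>/2" and C=C and ?x0.0=x0])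
    have \<rho>p: "0 \<le> P.\<rho> p" "P.\<rho> p < 1" using P.\<rho>_integrable_less_one[of p] \<alpha> \<alpha>p by auto
    then show "0 \<le> P.\<rho> p" "P.\<rho> p < 1" by auto
    show "\<P>(\<omega> in M. x < norm (Xs (Suc n) \<omega>)) \<le> C * x powr (- (\<alpha> / 2))" if "x0 \<le> x" for n x
    proof -
      have S: "{v :: real ^ 'd. x < norm v} \<in> sets borel" by measurable
      have "measure (distr M borel (Xs (Suc n))) {v. x < norm v} = measure (distr M borel X) {v. x < norm v}"
        using Xs_copies[of "Suc n"] by simp
      then show ?thesis using tail_X[OF that] S by (simp add: measure_distr vimage_def Int_def conj_commute)
    qed
    show "integrable M (\<lambda>\<omega>. P.W (Suc n) \<omega> powr p)" for n
      using \<alpha> \<alpha>p by (intro P.W_powr_integral) auto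
    show "(\<integral>\<omega>. P.W (Suc n) \<omega> powr p \<partial>M) \<le> P.\<rho> p ^ n" for n
      using P.W_powr_integral(2)[of p "Suc n"] \<alpha> \<alpha>p \<rho>p by (simp add: mult_left_le_one_le)
  qed (use \<alpha> \<alpha>p P.W_pos in auto)

  have sandwich: "AE \<omega> in M. summable (\<lambda>n. P.Z n \<omega>) \<and> (\<forall>n. P.Z n \<omega> \<le> ?g (D \<omega>)) \<and> ?g (D \<omega>) \<le> (\<Sum>n. P.Z n \<omega>)"
    using summ W_R AE_space
  proof eventually_elim
    case (elim \<omega>)
    let ?z = "\<lambda>n. P.W (Suc n) \<omega> *\<^sub>R Xs (Suc n) \<omega>"
    have D_eq: "D \<omega> = (\<Sum>n. ?z n)" unfolding D using elim(2) by simp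
    have z_nonneg: "0 \<le> ?z n $ j" for n j
      using P.W_pos[OF elim(3), of "Suc n"] Xs_nonneg[of "Suc n" \<omega> j] elim(3) by simp
    have comp: "?z n $ j \<le> D \<omega> $ j" for n j
    proof -
      have s: "(\<lambda>n. ?z n $ j) sums (D \<omega> $ j)" unfolding D_eq by (intro sums_vec_nth summable_sums elim(1))
      show ?thesis using sum_le_suminf[OF sums_summable[OF s], of "{n}"] z_nonneg sums_unique[OF s] by simp
    qed
    obtain r where r: "r > 0" "\<And>v. ?g v \<le> norm v / r" using gauge_sup_norm_bound[OF A] by blast
    \<comment> \<open>With nonnegative coordinates, convergence of each coordinate series gives
      absolute convergence; the norm bound on the gauge then makes the gauges summable.\<close>
    have sn: "summable (\<lambda>n. norm (?z n))"
    proof (rule summable_comparison_test)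
      have "summable (\<lambda>n. ?z n $ j)" for j by (intro summable_vec_nth elim(1))
      then show "summable (\<lambda>n. \<Sum>j\<in>UNIV. ?z n $ j)" by (intro summable_sum)
      have "norm (?z n) \<le> (\<Sum>j\<in>UNIV. ?z n $ j)" for n
        using norm_le_l1_cart[of "?z n"] z_nonneg[of n] by (simp add: abs_of_nonneg)
      then show "\<exists>N. \<forall>n\<ge>N. norm (norm (?z n)) \<le> (\<Sum>j\<in>UNIV. ?z n $ j)" by simp
    qed
    have sg: "summable (\<lambda>n. ?g (?z n))"
    proof (rule summable_comparison_test)
      show "summable (\<lambda>n. norm (?z n) / r)" using sn by (rule summable_divide)
      have "norm (?g v) \<le> norm v / r" for v using r(2)[of v] gauge_sup_nonneg[OF A, of v] by simp
      then show "\<exists>N. \<forall>n\<ge>N. norm (?g (?z n)) \<le> norm (?z n) / r" by blast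
    qed
    show ?case
      using sg gauge_sup_suminf[OF A elim(1) sg] gauge_sup_mono[OF A comp] by (simp add: Z_eq[OF elim(3)] D_eq)
  qed
  have gD[measurable]: "(\<lambda>\<omega>. ?g (D \<omega>)) \<in> borel_measurable M" by measurable
  have perp: "((\<lambda>x. \<P>(\<omega> in M. ?g (D \<omega>) > x) / H x) \<longlongrightarrow> 1 / (1 - \<rho>)) at_top"
    using P.tail_of_sum[OF gD sandwich] by (simp add: P_H \<rho>_def)

  \<comment> \<open>The renewal constant\<close>
  have renewal_int: "(LINT s:{0..}|interval_measure (renewal_function M \<tau>). (LINT \<omega>|M. exp (- \<alpha> * R s \<omega>))) = \<rho> / (1 - \<rho>)"
  proof (rule renewal_integral_laplace[OF time renewal_finite \<tau>_m \<alpha> \<alpha>p lp \<rho>])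
    fix i
    have "(\<integral>\<^sup>+\<omega>. ennreal (exp (- \<alpha> * R (\<tau> (Suc i) \<omega>) \<omega>)) \<partial>M) = (\<integral>\<^sup>+\<omega>. ennreal (P.W (Suc i) \<omega> powr \<alpha>) \<partial>M)"
    proof (rule nn_integral_cong_AE)
      show "AE \<omega> in M. ennreal (exp (- \<alpha> * R (\<tau> (Suc i) \<omega>) \<omega>)) = ennreal (P.W (Suc i) \<omega> powr \<alpha>)"
        using W_R by eventually_elim (simp add: powr_def)
    qed
    also have "\<dots> = ennreal (\<rho> ^ Suc i)"
      using P.W_powr_integral[of \<alpha> "Suc i"] \<alpha> \<alpha>p by (subst nn_integral_eq_integral) (auto simp: \<rho>_def)
    finally show "(\<integral>\<^sup>+\<omega>. ennreal (exp (- \<alpha> * R (\<tau> (Suc i) \<omega>) \<omega>)) \<partial>M) = ennreal (\<rho> ^ Suc i)" .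
  qed
  \<comment> \<open>The integrand is constant in u, and \<Lambda> has full mass under the law of the
    first inter-arrival time.\<close>
  have outer_int: "(LINT u:\<Lambda>|distr M borel (\<theta> 1). J) = J" for J :: real
  proof -
    have "mono (renewal_function M \<tau>)" by (intro monoI renewal_function_mono[OF \<tau>_m renewal_finite])
    then have "renewal_function M \<tau> \<in> borel_measurable borel" by (rule borel_measurable_mono)
    then have \<Lambda>_m: "\<Lambda> \<in> sets borel" unfolding \<Lambda> by measurable
    have "measure (distr M borel (\<theta> 1)) \<Lambda> = \<P>(\<omega> in M. \<theta> 1 \<omega> \<in> \<Lambda>)"
      using \<tau>1_meas \<Lambda>_m by (simp add: measure_distr vimage_def Int_def conj_commute)
    also have "\<dots> = 1" using \<Lambda>_ae \<tau>1_meas \<Lambda>_m by (subst prob_Collect_eq_1) auto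
    finally show ?thesis using \<Lambda>_m by (simp add: set_lebesgue_integral_def)
  qed
  have c_eq: "(LINT \<omega>|M. exp (- \<alpha> * R (\<theta> 1 \<omega>) \<omega>) * h (exp (- R (\<theta> 1 \<omega>) \<omega>))) = c"
    using Y_powr[of _ \<alpha>] k_Y(1) by (simp add: c_def Y_def)
  have geo: "1 + \<rho> / (1 - \<rho>) = 1 / (1 - \<rho>)" using \<rho> by (simp add: field_simps)

  \<comment> \<open>Combining the asymptotic relations\<close>
  let ?m = "orthant_mass \<mu> A"
  \<comment> \<open>Three ratios are chained: D against one discounted claim, with limit 1/(1 -
    \<rho>); the discounted against the undiscounted claim, with limit c; and the claim against
    \<open>tail G\<close>, with limit \<mu>(A).\<close>
  have "((\<lambda>x. \<P>(\<omega> in M. ?g (D \<omega>) > x) / H x * (H x / Fb x) * (Fb x / tail G x) / (?m * c * (1 / (1 - \<rho>))))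
      \<longlongrightarrow> 1 / (1 - \<rho>) * c * ?m / (?m * c * (1 / (1 - \<rho>)))) at_top"
    using \<mu>_A c_pos \<rho> by (intro tendsto_divide tendsto_mult perp HF Fb_lim tendsto_const) auto
  moreover have "1 / (1 - \<rho>) * c * ?m / (?m * c * (1 / (1 - \<rho>))) = 1" using \<mu>_A c_pos \<rho> by simp
  moreover have "\<forall>\<^sub>F x in at_top. \<P>(\<omega> in M. ?g (D \<omega>) > x) / H x * (H x / Fb x) * (Fb x / tail G x) / (?m * c * (1 / (1 - \<rho>)))
      = \<P>(\<omega> in M. D \<omega> \<in> dilate x A) / (?m * tail G x * c * (1 / (1 - \<rho>)))"
    using eventually_gt_at_top[of 0]
  proof eventually_elim
    case (elim x)
    have "\<P>(\<omega> in M. D \<omega> \<in> dilate x A) = \<P>(\<omega> in M. ?g (D \<omega>) > x)"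
      using less_gauge_sup_iff[OF A elim] by simp
    then show ?case using rv_tail_pos[OF rvH, of x] Fb_pos[of x] Gpos[of x] by (simp add: field_simps)
  qed
  ultimately have "((\<lambda>x. \<P>(\<omega> in M. D \<omega> \<in> dilate x A) / (?m * tail G x * c * (1 / (1 - \<rho>)))) \<longlongrightarrow> 1) at_top"
    by (simp only: tendsto_cong)
  then show ?thesis
    unfolding renewal_int outer_int c_eq geo by (rule asymp_equivI')
qed

end
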